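(* Let $a<A<\omega$, let $\mathcal{F}$ be a class of $A$-frames, and let $\mathcal{I}$ be a class of Noetherian orders containing all finite trees. Then: (1) $\mathrm{Sat}(\Sigma^a_{\mathcal{I}}\mathcal{F}) \le_T^{\mathrm{PSPACE}} \mathrm{Sat}(\mathcal{F}^{\forall})$. (2) If moreover $\mathcal{I}$ is closed under finite disjoint unions, then $\mathrm{Sat}\big((\Sigma^a_{\mathcal{I}}\mathcal{F})^{\forall}\big) \le_T^{\mathrm{PSPACE}} \mathrm{Sat}(\mathcal{F}^{\forall})$.
   Context: For an ordinal $A\le\omega$, $A$-formulas are built from countably many propositional variables with $\bot,\to$ and unary modalities $\Diamond_b$, $b<A$. An $A$-frame is $(W,(R_b)_{b<A})$ with $W\neq\emptyset$, $R_b\subseteq W\times W$; models and truth are standard Kripke ones. For a class $\mathcal{C}$ of frames, $\mathrm{Sat}(\mathcal{C})$ is the set of formulas (in the signature of $\mathcal{C}$) true at some point of some model on a frame in $\mathcal{C}$. For an $A$-frame $\mathbf{F}=(W,(R_0,R_1,\dots))$, $\mathbf{F}^{\forall}$ is the $(1+A)$-frame $(W,(W\times W,R_0,R_1,\dots))$; $\mathcal{C}^{\forall}=\{\mathbf{F}^{\forall}:\mathbf{F}\in\mathcal{C}\}$. Sums: given an $A$-frame $\mathbf{I}=(I,(S_b)_{b<A})$ and $A$-frames $\mathbf{F}_i=(W_i,(R_{i,b})_{b<A})$, $i\in I$, the sum $\Sigma_{i\in\mathbf{I}}\mathbf{F}_i$ has domain $\{(i,w):i\in I,w\in W_i\}$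 and $(i,w)R^\Sigma_b(j,v)$ iff ($i=j$ and $wR_{i,b}v$) or ($i\neq j$ and $iS_bj$). For a unimodal frame $(I,S)$ and $a<A$, the $a$-sum $\Sigma^a_{(I,S)}\mathbf{F}_i$ is the sum over the $A$-frame on $I$ whose $a$-th relation is $S$ and all other relations empty. For a class $\mathcal{I}$ of unimodal frames and a class $\mathcal{F}$ of $A$-frames, $\Sigma^a_{\mathcal{I}}\mathcal{F}$ is the class of all $a$-sums $\Sigma^a_{\mathbf{I}}\mathbf{F}_i$ with $\mathbf{I}\in\mathcal{I}$ and all $\mathbf{F}_i\in\mathcal{F}$. A Noetherian order is a strict partial order with no infinite ascending chains. A finite tree is a finite strict partial order with a least element in which, for each $i$, $\{j: j<i\}$ is a chain. Disjoint unions of frames are the usual ones. $P\le_T^{\mathrm{PSPACE}} Q$ means $P$ is decided by a deterministic oracle machine with oracle $Q$ all of whose tapes (including the oracle tape) are polynomially space bounded. *)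

theory Defs
  imports "HOL-Computational_Algebra.Polynomial"
begin

section \<open>Modal formulas and Kripke frames\<close>

datatype fm = Var nat | Bot | Imp fm fm | Dia nat fm

primrec is_fm :: "nat \<Rightarrow> fm \<Rightarrow> bool" where
  "is_fm A (Var n) \<longleftrightarrow> True"
| "is_fm A Bot \<longleftrightarrow> True"
| "is_fm A (Imp \<phi> \<psi>) \<longleftrightarrow> is_fm A \<phi> \<and> is_fm A \<psi>"
| "is_fm A (Dia b \<phi>) \<longleftrightarrow> b < A \<and> is_fm A \<phi>"

record 'w frame =
  worlds :: "'w set"
  rel :: "nat \<Rightarrow> ('w \<times> 'w) set"

text \<open>An \<open>A\<close>-frame has relations indexed by \<open>b < A\<close>; the unused components of the
  family are fixed to be empty, so that each \<open>A\<close>-frame has a unique representation.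
  Unimodal frames are 1-frames.\<close>

definition is_frame :: "nat \<Rightarrow> 'w frame \<Rightarrow> bool" where
  "is_frame A F \<longleftrightarrow> worlds F \<noteq> {} \<and>
     (\<forall>b<A. rel F b \<subseteq> worlds F \<times> worlds F) \<and> (\<forall>b\<ge>A. rel F b = {})"

primrec holds :: "'w frame \<Rightarrow> (nat \<Rightarrow> 'w set) \<Rightarrow> 'w \<Rightarrow> fm \<Rightarrow> bool" where
  "holds F V w (Var n) \<longleftrightarrow> w \<in> V n"
| "holds F V w Bot \<longleftrightarrow> False"
| "holds F V w (Imp \<phi> \<psi>) \<longleftrightarrow> (holds F V w \<phi> \<longrightarrow> holds F V w \<psi>)"
| "holds F V w (Dia b \<phi>) \<longleftrightarrow> (\<exists>v\<in>worlds F. (w, v) \<in> rel F b \<and> holds F V v \<phi>)"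

definition Sat :: "nat \<Rightarrow> 'w frame set \<Rightarrow> fm set" where
  "Sat A C = {\<phi>. is_fm A \<phi> \<and>
     (\<exists>F\<in>C. \<exists>V. (\<forall>n. V n \<subseteq> worlds F) \<and> (\<exists>w\<in>worlds F. holds F V w \<phi>))}"

definition univ_frame :: "'w frame \<Rightarrow> 'w frame" where
  "univ_frame F = \<lparr>worlds = worlds F,
     rel = (\<lambda>b. case b of 0 \<Rightarrow> worlds F \<times> worlds F | Suc c \<Rightarrow> rel F c)\<rparr>"


section \<open>Sums of frames\<close>

definition sum_frame :: "'i frame \<Rightarrow> ('i \<Rightarrow> 'w frame) \<Rightarrow> ('i \<times> 'w) frame" where
  "sum_frame I F = \<lparr>worlds = (SIGMA i:worlds I. worlds (F i)),
     rel = (\<lambda>b. {((i, w), (j, v)) | i w j v.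
        i \<in> worlds I \<and> w \<in> worlds (F i) \<and> j \<in> worlds I \<and> v \<in> worlds (F j) \<and>
        (i = j \<and> (w, v) \<in> rel (F i) b \<or> i \<noteq> j \<and> (i, j) \<in> rel I b)})\<rparr>"

definition a_sum :: "nat \<Rightarrow> 'i frame \<Rightarrow> ('i \<Rightarrow> 'w frame) \<Rightarrow> ('i \<times> 'w) frame" where
  "a_sum a I F =
     sum_frame \<lparr>worlds = worlds I, rel = (\<lambda>b. if b = a then rel I 0 else {})\<rparr> F"

definition a_sums :: "nat \<Rightarrow> 'i frame set \<Rightarrow> 'w frame set \<Rightarrow> ('i \<times> 'w) frame set" where
  "a_sums a \<I> \<F> = {a_sum a I F | I F. I \<in> \<I> \<and> (\<forall>i\<in>worlds I. F i \<in> \<F>)}"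


section \<open>Classes of orders\<close>

definition strict_order :: "'i frame \<Rightarrow> bool" where
  "strict_order I \<longleftrightarrow> is_frame 1 I \<and> irrefl (rel I 0) \<and> trans (rel I 0)"

definition noetherian_order :: "'i frame \<Rightarrow> bool" where
  "noetherian_order I \<longleftrightarrow> strict_order I \<and>
     \<not> (\<exists>f :: nat \<Rightarrow> 'i. \<forall>n. (f n, f (Suc n)) \<in> rel I 0)"

definition finite_tree :: "'i frame \<Rightarrow> bool" where
  "finite_tree I \<longleftrightarrow> strict_order I \<and> finite (worlds I) \<and>
     (\<exists>r\<in>worlds I. \<forall>i\<in>worlds I. i = r \<or> (r, i) \<in> rel I 0) \<and>
     (\<forall>i\<in>worlds I. total_on {j. (j, i) \<in> rel I 0} (rel I 0))"

definition frame_iso :: "'v frame \<Rightarrow> 'w frame \<Rightarrow> bool" where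
  "frame_iso F G \<longleftrightarrow> (\<exists>f. bij_betw f (worlds F) (worlds G) \<and>
     (\<forall>b. \<forall>x\<in>worlds F. \<forall>y\<in>worlds F. (x, y) \<in> rel F b \<longleftrightarrow> (f x, f y) \<in> rel G b))"

definition disjoint_union :: "nat \<Rightarrow> (nat \<Rightarrow> 'w frame) \<Rightarrow> (nat \<times> 'w) frame" where
  "disjoint_union n F = \<lparr>worlds = (SIGMA k:{..<n}. worlds (F k)),
     rel = (\<lambda>b. {((k, x), (k, y)) | k x y. k < n \<and> (x, y) \<in> rel (F k) b})\<rparr>"

text \<open>The members of a class \<open>\<I>\<close> all live on one type, hence membership in \<open>\<I>\<close> of
  frames living on other types is understood up to isomorphism. Every finite tree is
  isomorphic to one on natural numbers.\<close>

definition contains_finite_trees :: "'i frame set \<Rightarrow> bool" where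
  "contains_finite_trees \<I> \<longleftrightarrow>
     (\<forall>T :: nat frame. finite_tree T \<longrightarrow> (\<exists>I\<in>\<I>. frame_iso T I))"

text \<open>The empty union is excluded, since frames are nonempty.\<close>

definition closed_disjoint_unions :: "'i frame set \<Rightarrow> bool" where
  "closed_disjoint_unions \<I> \<longleftrightarrow>
     (\<forall>n>0. \<forall>F. (\<forall>k<n. F k \<in> \<I>) \<longrightarrow> (\<exists>I\<in>\<I>. frame_iso (disjoint_union n F) I))"


section \<open>Deterministic oracle machines\<close>

text \<open>Tapes are infinite to the right only; a tape is given by its contents and the position
  of its head. Moving left from cell 0 leaves the head in place.\<close>

datatype 's cell = Blank | is_Inp: Inp (the_Inp: 's) | Aux nat

datatype state = Start | Accept | Reject | Query | Yes | No | Internal nat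

datatype move = Go_Left | Stay | Go_Right

type_synonym 's tape = "(nat \<Rightarrow> 's cell) \<times> nat"
type_synonym 's config = "state \<times> 's tape list"

record 's otm =
  n_tapes :: nat
  n_aux :: nat
  n_states :: nat
  delta :: "state \<Rightarrow> 's cell list \<Rightarrow> state \<times> ('s cell \<times> move) list"

definition symbols :: "'s otm \<Rightarrow> 's cell set" where
  "symbols M = {Blank} \<union> range Inp \<union> Aux ` {..<n_aux M}"

definition states :: "'s otm \<Rightarrow> state set" where
  "states M = {Start, Accept, Reject, Query, Yes, No} \<union> Internal ` {..<n_states M}"

text \<open>Tape 0 is the input tape, tape 1 is the oracle tape, the others are work tapes.
  For an input alphabet \<open>'s\<close> that is finite, the restriction of \<^term>\<open>delta\<close> to the relevant
  arguments is a finite table.\<close>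

definition is_otm :: "'s otm \<Rightarrow> bool" where
  "is_otm M \<longleftrightarrow> n_tapes M \<ge> 2 \<and>
     (\<forall>q\<in>states M. \<forall>cs. length cs = n_tapes M \<and> set cs \<subseteq> symbols M \<longrightarrow>
        (case delta M q cs of (q', acts) \<Rightarrow>
           q' \<in> states M \<and> length acts = n_tapes M \<and> fst ` set acts \<subseteq> symbols M))"

fun read :: "'s tape \<Rightarrow> 's cell" where
  "read (f, h) = f h"

fun act :: "'s cell \<times> move \<Rightarrow> 's tape \<Rightarrow> 's tape" where
  "act (c, m) (f, h) =
     (f(h := c), case m of Go_Left \<Rightarrow> h - 1 | Stay \<Rightarrow> h | Go_Right \<Rightarrow> h + 1)"

text \<open>The queried word is the longest initial segment of the tape that consists of input symbols.\<close>

definition query_word :: "'s tape \<Rightarrow> 's list" where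
  "query_word t =
     map (\<lambda>i. the_Inp (fst t i)) [0..<(LEAST n. \<not> is_Inp (fst t n))]"

definition step :: "'s list set \<Rightarrow> 's otm \<Rightarrow> 's config \<Rightarrow> 's config" where
  "step Q M = (\<lambda>(q, ts).
     if q = Accept \<or> q = Reject then (q, ts)
     else if q = Query then (if query_word (ts ! 1) \<in> Q then Yes else No, ts)
     else (case delta M q (map read ts) of (q', acts) \<Rightarrow> (q', map2 act acts ts)))"

definition init :: "'s otm \<Rightarrow> 's list \<Rightarrow> 's config" where
  "init M w = (Start,
     ((\<lambda>i. if i < length w then Inp (w ! i) else Blank), 0) #
     replicate (n_tapes M - 1) (\<lambda>_. Blank, 0))"

definition run :: "'s list set \<Rightarrow> 's otm \<Rightarrow> 's list \<Rightarrow> nat \<Rightarrow> 's config" where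
  "run Q M w t = (step Q M ^^ t) (init M w)"

text \<open>The space bound is uniform over all tapes, the oracle tape included.\<close>

definition pspace_turing_reducible ::
    "('s::finite) list set \<Rightarrow> 's list set \<Rightarrow> bool" (infix "\<le>\<^sub>T\<^sub>P\<^sub>S\<^sub>P\<^sub>A\<^sub>C\<^sub>E" 50) where
  "P \<le>\<^sub>T\<^sub>P\<^sub>S\<^sub>P\<^sub>A\<^sub>C\<^sub>E Q \<longleftrightarrow> (\<exists>(M :: 's otm) (p :: nat poly). is_otm M \<and>
     (\<forall>w. (\<exists>t. fst (run Q M w t) = (if w \<in> P then Accept else Reject)) \<and>
          (\<forall>t. \<forall>(f, h)\<in>set (snd (run Q M w t)). h < poly p (length w))))"


section \<open>Formulas as words\<close>

text \<open>Formulas are written in Polish notation; indices of variables and modalities are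
  written in binary, least significant digit first, with 0 as the empty word.\<close>

datatype sym = SVar | SBot | SImp | SDia | S0 | S1

instance sym :: finite
proof
  have "UNIV = {SVar, SBot, SImp, SDia, S0, S1}"
    using sym.exhaust by blast
  then show "finite (UNIV :: sym set)" by (metis finite.emptyI finite_insert)
qed

fun bits :: "nat \<Rightarrow> sym list" where
  "bits n = (if n = 0 then [] else (if even n then S0 else S1) # bits (n div 2))"

declare bits.simps [simp del]

primrec word_of :: "fm \<Rightarrow> sym list" where
  "word_of (Var n) = SVar # bits n"
| "word_of Bot = [SBot]"
| "word_of (Imp \<phi> \<psi>) = SImp # word_of \<phi> @ word_of \<psi>"
| "word_of (Dia b \<phi>) = SDia # bits b @ word_of \<phi>"

end

theory Submission
  imports Defs "HOL-Library.Sublist" "HOL-Library.Countable"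
begin

text \<open>
  Let a formula be true in an \<open>a\<close>-sum over a Noetherian order. In the summand at \<open>i\<close>, truth only
  depends on the set \<open>U i\<close> of the arguments of modalities that are realized strictly above \<open>i\<close>:
  \<open>\<Diamond>\<^sub>a \<psi>\<close> can be replaced by truth if \<open>\<psi>\<close> is in \<open>U i\<close>, and is evaluated inside the summand
  otherwise. So a set \<open>X\<close> is the set of all arguments realized in some sum iff for
  every nonempty \<open>Y \<subseteq> X\<close> there is a set \<open>Z \<subseteq> X\<close>, disjoint from \<open>Y\<close>, which is again such a set, and a summand
  that realizes, with \<open>Z\<close> above it, something in \<open>Y\<close> and nothing outside \<open>X\<close>. Given a sum, take
  a maximal index \<open>i\<close> at which something in \<open>Y\<close> is realized, and \<open>Z = U i\<close>; conversely, unravelling the choices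
  for singletons \<open>Y\<close> gives a sum over a finite forest. The condition on the summand is
  the satisfiability of one formula with the universal modality, whence one oracle query.
  As \<open>Z\<close> is a proper subset of \<open>X\<close>, the alternation of the choices of \<open>Y\<close> and \<open>Z\<close> is a game of linear length
  on sets of positions in the input word, which is searched depth first in polynomial space.
\<close>


text \<open>Arguments are named by positions, so that every set in the game is a Boolean track on a
  copy of the input, and a query is read off such a row symbol by symbol, arguments being delimited
  by counting arities. The set \<open>T\<close> is fixed before the game: the universal modality of
  the sum cannot be evaluated from what lies above a summand. Both parts share one argument. For
  \<open>s = 1\<close> only position 0 has to be realized somewhere, and the paths starting with 0,
  a finite tree, are enough as indices; for \<open>s = 0\<close> every member of \<open>T\<close>
  has to be realized, so all paths are kept and a disjoint union joins their trees. The challenge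
  \<open>Y\<close> ranges over sets, like \<open>T\<close> and the reply \<open>Z\<close>, so that
  one enumeration, the binary increment of a track, serves for all three. The reduction asks for
  termination and space, not for time, which permits exhaustive search. The machine repeats a single
  command, with an oracle call between two rounds; the whole state of the search is therefore kept
  on tapes: the current row, a stack of rows, and a one-symbol register. Every space bound is
  carried along with the semantics of commands, since it concerns all configurations of a
  run.\<close>

primrec shift_fm :: "nat \<Rightarrow> fm \<Rightarrow> fm" where
  "shift_fm s (Var n) = Var n"
| "shift_fm s Bot = Bot"
| "shift_fm s (Imp \<phi> \<psi>) = Imp (shift_fm s \<phi>) (shift_fm s \<psi>)"
| "shift_fm s (Dia b \<phi>) = Dia (b + s) (shift_fm s \<phi>)"

text \<open>A position \<open>k\<close> of a modality in the word of a formula stands for the occurrence of its argument: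
  \<open>T\<close> contains the positions realized anywhere, \<open>Z\<close> those realized strictly above the summand. The
  premise \<open>\<bottom> \<rightarrow> Var b\<close> is idle; it takes up the bits of the index \<open>b\<close>, so that
  the word of the translation arises symbol by symbol. With \<open>s = 1\<close> indices are
  shifted to make room for the universal modality; with \<open>s = 0\<close> the formula already has it.\<close>

primrec tr :: "nat \<Rightarrow> nat \<Rightarrow> nat set \<Rightarrow> nat set \<Rightarrow> nat \<Rightarrow> fm \<Rightarrow> fm" where
  "tr s a T Z k (Var n) = Var n"
| "tr s a T Z k Bot = Bot"
| "tr s a T Z k (Imp \<phi> \<psi>) =
     Imp (tr s a T Z (Suc k) \<phi>) (tr s a T Z (Suc k + length (word_of \<phi>)) \<psi>)"
| "tr s a T Z k (Dia b \<phi>) =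
     Imp (if (b + s = 0 \<and> k \<in> T) \<or> (b + s = Suc a \<and> k \<in> Z) then Bot else Imp Bot Bot)
       (Dia (b + s) (Imp (Imp Bot (Var b)) (tr s a T Z (Suc k + length (bits b)) \<phi>)))"

text \<open>The entries are a position, the position where the argument starts, and the argument. Position 0 is
  that of an additional modality in front of the whole formula.\<close>

primrec dias :: "nat \<Rightarrow> fm \<Rightarrow> (nat \<times> nat \<times> fm) list" where
  "dias k (Var n) = []"
| "dias k Bot = []"
| "dias k (Imp \<phi> \<psi>) = dias (Suc k) \<phi> @ dias (Suc k + length (word_of \<phi>)) \<psi>"
| "dias k (Dia b \<phi>) =
     (k, Suc k + length (bits b), \<phi>) # dias (Suc k + length (bits b)) \<phi>"

text \<open>The index is kept in place of the starting position because the word of a query copies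
  its bits; \<open>arg_pos\<close> recovers the position.\<close>

primrec dias_ix :: "nat \<Rightarrow> fm \<Rightarrow> (nat \<times> nat \<times> fm) list" where
  "dias_ix k (Var n) = []"
| "dias_ix k Bot = []"
| "dias_ix k (Imp \<phi> \<psi>) = dias_ix (Suc k) \<phi> @ dias_ix (Suc k + length (word_of \<phi>)) \<psi>"
| "dias_ix k (Dia b \<phi>) = (k, b, \<phi>) # dias_ix (Suc k + length (bits b)) \<phi>"

text \<open>Index 0 has the empty binary word, so \<open>arg_pos\<close> places the whole formula at
  position 1.\<close>

definition args_ix :: "fm \<Rightarrow> (nat \<times> nat \<times> fm) list" where
  "args_ix \<phi> = (0, 0, \<phi>) # dias_ix 1 \<phi>"

definition args :: "fm \<Rightarrow> (nat \<times> nat \<times> fm) list" where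
  "args \<phi> = (0, 1, \<phi>) # dias 1 \<phi>"

abbreviation arg_pos :: "nat \<times> nat \<times> fm \<Rightarrow> nat \<times> nat \<times> fm" where
  "arg_pos \<equiv> \<lambda>(q, b, \<psi>). (q, Suc q + length (bits b), \<psi>)"

lemma dias_conv: "dias k \<phi> = map arg_pos (dias_ix k \<phi>)"
  by (induction \<phi> arbitrary: k) auto

lemma args_conv: "args \<phi> = map arg_pos (args_ix \<phi>)"
  by (simp add: args_def args_ix_def dias_conv bits.simps)

text \<open>A disjunction over the entries with position in \<open>S\<close>, each \<open>D\<close>
  joined to the rest as \<not> D \<longrightarrow> \<chi>, with \<open>Bot\<close> at the end. As in
  \<open>tr\<close>, the idle premise takes up the bits of \<open>b\<close>, so that an argument is
  copied from the symbol right after its modality on.\<close>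

definition some_real :: "nat \<Rightarrow> nat \<Rightarrow> nat set \<Rightarrow> nat set \<Rightarrow> nat set \<Rightarrow> (nat \<times> nat \<times> fm) list \<Rightarrow> fm" where
  "some_real s a T Z S ps = foldr (\<lambda>(q, b, \<psi>) \<chi>. if q \<in> S
     then Imp (Imp (Dia 0 (Imp (Imp Bot (Var b)) (tr s a T Z (Suc q + length (bits b)) \<psi>))) Bot) \<chi>
     else \<chi>) ps Bot"

text \<open>A conjunction written as a negated implication. All disjuncts start with the universal
  modality, so the truth value is the same at all worlds of a summand.\<close>

definition query :: "nat \<Rightarrow> nat \<Rightarrow> fm \<Rightarrow> nat set \<Rightarrow> nat set \<Rightarrow> nat set \<Rightarrow> nat set \<Rightarrow> fm" where
  "query s a \<phi> T X Y Z =
     Imp (Imp (some_real s a T Z Y (args_ix \<phi>)) (some_real s a T Z (- X) (args_ix \<phi>))) Bot"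

text \<open>\<open>qs X Y Z\<close> says that some summand with \<open>Z\<close> above it realizes an element of \<open>Y\<close> and nothing
  outside \<open>X\<close>.\<close>

inductive forest :: "(nat set \<Rightarrow> nat set \<Rightarrow> nat set \<Rightarrow> bool) \<Rightarrow> nat set \<Rightarrow> bool" for qs where
  forestI: "(\<And>Y. Y \<subseteq> X \<Longrightarrow> Y \<noteq> {} \<Longrightarrow>
      \<exists>Z. Z \<subseteq> X \<and> Z \<inter> Y = {} \<and> qs X Y Z \<and> forest qs Z) \<Longrightarrow> forest qs X"

section \<open>Semantics and signature of the queries\<close>

lemma holds_some_real:
  "holds G V w (some_real s a T Z S ps) \<longleftrightarrow>
     (\<exists>(q, k, \<psi>)\<in>set (map arg_pos ps). q \<in> S \<and> holds G V w (Dia 0 (tr s a T Z k \<psi>)))"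
proof (induction ps)
  case (Cons p ps)
  obtain q b \<psi> where p: "p = (q, b, \<psi>)" by (cases p)
  have "some_real s a T Z S (p # ps) = (if q \<in> S then
      Imp (Imp (Dia 0 (Imp (Imp Bot (Var b)) (tr s a T Z (Suc q + length (bits b)) \<psi>))) Bot)
      (some_real s a T Z S ps) else some_real s a T Z S ps)"
    by (simp add: some_real_def p)
  then show ?case using Cons p by auto
qed (simp add: some_real_def)

text \<open>The two sides of an implication occupy disjoint intervals of the word; hence a position
  determines its occurrence, as used in \<open>dias_unique\<close>.\<close>

lemma dias_ge: "(q, k', \<psi>) \<in> set (dias k \<phi>) \<Longrightarrow> k \<le> q \<and> q < k + length (word_of \<phi>)"
proof (induction \<phi> arbitrary: k)
  case (Imp \<phi> \<psi>)
  then show ?case by fastforce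
next
  case (Dia b \<phi>)
  then show ?case by fastforce
qed auto

lemma dias_unique:
  "(q, k1, \<psi>1) \<in> set (dias k \<phi>) \<Longrightarrow> (q, k2, \<psi>2) \<in> set (dias k \<phi>) \<Longrightarrow> k1 = k2 \<and> \<psi>1 = \<psi>2"
proof (induction \<phi> arbitrary: k)
  case (Imp \<phi> \<psi>)
  then show ?case by (fastforce dest: dias_ge)
next
  case (Dia b \<phi>)
  then show ?case by (fastforce dest: dias_ge)
qed auto

lemma args_unique:
  "(q, k1, \<psi>1) \<in> set (args \<phi>) \<Longrightarrow> (q, k2, \<psi>2) \<in> set (args \<phi>) \<Longrightarrow> k1 = k2 \<and> \<psi>1 = \<psi>2"
  unfolding args_def by (auto dest: dias_unique dias_ge)

lemma is_fm_tr: "is_fm B \<phi> \<Longrightarrow> is_fm (B + s) (tr s a T Z k \<phi>)"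
  by (induction \<phi> arbitrary: k) auto

lemma is_fm_dias: "is_fm B \<phi> \<Longrightarrow> (q, k', \<psi>) \<in> set (dias k \<phi>) \<Longrightarrow> is_fm B \<psi>"
  by (induction \<phi> arbitrary: k) auto

lemma is_fm_some_real:
  "B + s > 0 \<Longrightarrow> (\<And>q b \<psi>. (q, b, \<psi>) \<in> set ps \<Longrightarrow> is_fm B \<psi>) \<Longrightarrow> is_fm (B + s) (some_real s a T Z S ps)"
proof (induction ps)
  case (Cons p ps)
  then show ?case by (cases p) (auto simp: some_real_def intro!: is_fm_tr)
qed (auto simp: some_real_def)

lemma is_fm_query:
  assumes "is_fm B \<phi>" "B + s > 0"
  shows "is_fm (B + s) (query s a \<phi> T X Y Z)"
proof -
  have "is_fm B \<psi>" if "(q, b, \<psi>) \<in> set (args_ix \<phi>)" for q b \<psi>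
  proof -
    have "arg_pos (q, b, \<psi>) \<in> set (args \<phi>)" using that unfolding args_conv by force
    then show ?thesis using assms is_fm_dias by (auto simp: args_def)
  qed
  then show ?thesis unfolding query_def using assms by (auto intro!: is_fm_some_real)
qed

lemma univ_frame_sel [simp]:
  "worlds (univ_frame F) = worlds F"
  "rel (univ_frame F) 0 = worlds F \<times> worlds F"
  "rel (univ_frame F) (Suc c) = rel F c"
  by (auto simp: univ_frame_def)

lemma a_sum_worlds [simp]:
  "worlds (a_sum a I F) = (SIGMA i:worlds I. worlds (F i))"
  by (auto simp: a_sum_def sum_frame_def)

lemma a_sum_rel:
  "((i, w), (j, v)) \<in> rel (a_sum a I F) b \<longleftrightarrow>
     i \<in> worlds I \<and> w \<in> worlds (F i) \<and> j \<in> worlds I \<and> v \<in> worlds (F j) \<and>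
        (i = j \<and> (w, v) \<in> rel (F i) b \<or> i \<noteq> j \<and> b = a \<and> (i, j) \<in> rel I 0)"
  by (auto simp: a_sum_def sum_frame_def)

lemma holds_query:
  "holds G V w (query s a \<phi> T X Y Z) \<longleftrightarrow>
     (\<exists>(q, k, \<psi>)\<in>set (args \<phi>). q \<in> Y \<and> holds G V w (Dia 0 (tr s a T Z k \<psi>))) \<and>
     \<not> (\<exists>(q, k, \<psi>)\<in>set (args \<phi>). q \<notin> X \<and> holds G V w (Dia 0 (tr s a T Z k \<psi>)))"
  unfolding query_def args_conv by (simp add: holds_some_real)

section \<open>Completeness\<close>

lemma forest_of_model:
  fixes \<F> :: "'w frame set" and I :: "'i frame"
  assumes I: "noetherian_order I" and F: "\<forall>i\<in>worlds I. F i \<in> \<F>"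
    and x: "x \<in> worlds (a_sum a I F)"
    and hx: "holds (univ_frame (a_sum a I F)) V x (shift_fm s \<phi>)"
    and fm: "is_fm B \<phi>" and B: "B + s = Suc A"
  shows "\<exists>T. T \<subseteq> fst ` set (args \<phi>) \<and> 0 \<in> T \<and>
    forest (\<lambda>X Y Z. query s a \<phi> T X Y Z \<in> Sat (Suc A) (univ_frame ` \<F>)) T"
proof -
  let ?S = "univ_frame (a_sum a I F)"
  define R where "R i = {q. \<exists>k \<psi>. (q, k, \<psi>) \<in> set (args \<phi>) \<and>
     (\<exists>w\<in>worlds (F i). holds ?S V (i, w) (shift_fm s \<psi>))}" for i
  define U where "U i = (\<Union>j\<in>{j. (i, j) \<in> rel I 0}. R j)" for i
  define T where "T = (\<Union>i\<in>worlds I. R i)"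
  let ?qs = "\<lambda>X Y Z. query s a \<phi> T X Y Z \<in> Sat (Suc A) (univ_frame ` \<F>)"
  have so: "strict_order I" using I by (simp add: noetherian_order_def)
  have rI: "rel I 0 \<subseteq> worlds I \<times> worlds I" and tI: "trans (rel I 0)" and iI: "irrefl (rel I 0)"
    using so by (auto simp: strict_order_def is_frame_def)
  have wfI: "wf ((rel I 0)\<inverse>)"
    using I unfolding noetherian_order_def wf_iff_no_infinite_down_chain by auto
  define W where "W i n = {w\<in>worlds (F i). (i, w) \<in> V n}" for i n
  \<comment> \<open>The truth lemma: with the valuation cut down to the summand at \<open>i\<close>
    and \<open>U i\<close> recorded in the translation, evaluation inside the summand agrees with
    evaluation in the sum.\<close>
  have argsub: "set (dias k \<psi>) \<subseteq> set (args \<phi>) \<Longrightarrow> i \<in> worlds I \<Longrightarrow> w \<in> worlds (F i) \<Longrightarrow>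
     \<forall>j\<in>worlds I. R j \<subseteq> T \<Longrightarrow>
     holds (univ_frame (F i)) (W i) w (tr s a T (U i) k \<psi>) \<longleftrightarrow> holds ?S V (i, w) (shift_fm s \<psi>)"
    for i w k \<psi>
  proof (induction \<psi> arbitrary: w k)
    case (Var n)
    then show ?case by (auto simp: W_def)
  next
    case Bot
    then show ?case by simp
  next
    case (Imp \<psi>1 \<psi>2)
    then show ?case by simp
  next
    case (Dia b \<psi>)
    let ?k = "Suc k + length (bits b)"
    have mem: "(k, ?k, \<psi>) \<in> set (args \<phi>)" using Dia.prems by auto
    have IH: "holds (univ_frame (F i)) (W i) v (tr s a T (U i) ?k \<psi>) \<longleftrightarrow>
        holds ?S V (i, v) (shift_fm s \<psi>)" if "v \<in> worlds (F i)" for v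
      using Dia that by auto
    have kR: "k \<in> R j \<longleftrightarrow> (\<exists>v\<in>worlds (F j). holds ?S V (j, v) (shift_fm s \<psi>))" for j
      using mem args_unique unfolding R_def by blast
    have kT: "k \<in> T \<longleftrightarrow> (\<exists>j\<in>worlds I. \<exists>v\<in>worlds (F j). holds ?S V (j, v) (shift_fm s \<psi>))"
      unfolding T_def using kR by auto
    have kU: "k \<in> U i \<longleftrightarrow> (\<exists>j. (i, j) \<in> rel I 0 \<and> (\<exists>v\<in>worlds (F j). holds ?S V (j, v) (shift_fm s \<psi>)))"
      unfolding U_def using kR by auto
    consider "b + s = 0" | "b + s = Suc a" | c where "b + s = Suc c" "c \<noteq> a"
      by (metis not0_implies_Suc)
    then show ?case
    proof cases
      case 1
      \<comment> \<open>A local witness of the universal modality is also a global one, so the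
        disjunct that remains in the translation adds nothing to \<open>k \<in> T\<close>.\<close>
      have "(\<exists>v\<in>worlds (F i). holds ?S V (i, v) (shift_fm s \<psi>)) \<Longrightarrow> k \<in> T"
        unfolding kT using Dia.prems(2) by blast
      moreover have "holds ?S V (i, w) (shift_fm s (Dia b \<psi>)) \<longleftrightarrow> k \<in> T"
        unfolding kT using 1 Dia.prems(2,3) by simp
      ultimately show ?thesis using 1 IH Dia.prems(3) by (simp cong: bex_cong) blast
    next
      case 2
      have "(\<exists>p\<in>worlds ?S. ((i, w), p) \<in> rel ?S (Suc a) \<and> holds ?S V p (shift_fm s \<psi>)) \<longleftrightarrow>
         k \<in> U i \<or> (\<exists>v\<in>worlds (F i). (w, v) \<in> rel (F i) a \<and> holds ?S V (i, v) (shift_fm s \<psi>))"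
      proof
        assume "\<exists>p\<in>worlds ?S. ((i, w), p) \<in> rel ?S (Suc a) \<and> holds ?S V p (shift_fm s \<psi>)"
        then obtain j v where j: "j \<in> worlds I" "v \<in> worlds (F j)" "((i, w), (j, v)) \<in> rel (a_sum a I F) a"
          "holds ?S V (j, v) (shift_fm s \<psi>)" by auto
        then show "k \<in> U i \<or> (\<exists>v\<in>worlds (F i). (w, v) \<in> rel (F i) a \<and> holds ?S V (i, v) (shift_fm s \<psi>))"
          unfolding kU a_sum_rel by blast
      next
        assume "k \<in> U i \<or> (\<exists>v\<in>worlds (F i). (w, v) \<in> rel (F i) a \<and> holds ?S V (i, v) (shift_fm s \<psi>))"
        then obtain j v where j: "v \<in> worlds (F j)" "holds ?S V (j, v) (shift_fm s \<psi>)"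
          "(i, j) \<in> rel I 0 \<or> j = i \<and> (w, v) \<in> rel (F i) a" unfolding kU by blast
        \<comment> \<open>The sum uses the order only between different indices; irreflexivity
          supplies the difference.\<close>
        then have "j \<in> worlds I" "(i, j) \<in> rel I 0 \<longrightarrow> i \<noteq> j" using rI iI Dia.prems(2) by (auto simp: irrefl_def)
        then have "((i, w), (j, v)) \<in> rel (a_sum a I F) a" "(j, v) \<in> worlds ?S"
          using j Dia.prems(2,3) unfolding a_sum_rel by auto
        then show "\<exists>p\<in>worlds ?S. ((i, w), p) \<in> rel ?S (Suc a) \<and> holds ?S V p (shift_fm s \<psi>)"
          using j by (metis univ_frame_sel(3))
      qed
      then show ?thesis using 2 IH by (simp cong: bex_cong)
    next
      case 3
      then have "holds ?S V (i, w) (shift_fm s (Dia b \<psi>)) \<longleftrightarrow>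
         (\<exists>v\<in>worlds (F i). (w, v) \<in> rel (F i) c \<and> holds ?S V (i, v) (shift_fm s \<psi>))"
        using Dia.prems(2,3) by (simp add: a_sum_rel)
      then show ?thesis using 3 IH by (simp cong: bex_cong)
    qed
  qed
  have RT: "\<forall>j\<in>worlds I. R j \<subseteq> T" by (auto simp: T_def)
  have argsd: "set (dias k \<psi>) \<subseteq> set (args \<phi>)" if "(q, k, \<psi>) \<in> set (args \<phi>)" for q k \<psi>
  proof -
    have "(q, k, \<psi>) \<in> set (dias m \<chi>) \<Longrightarrow> set (dias k \<psi>) \<subseteq> set (dias m \<chi>)" for m \<chi>
    proof (induction \<chi> arbitrary: m)
      case (Imp \<chi>1 \<chi>2)
      then show ?case by fastforce
    qed auto
    then show ?thesis using that unfolding args_def by fastforce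
  qed
  have tru: "holds (univ_frame (F i)) (W i) w (tr s a T (U i) k \<psi>) \<longleftrightarrow> holds ?S V (i, w) (shift_fm s \<psi>)"
    if "(q, k, \<psi>) \<in> set (args \<phi>)" "i \<in> worlds I" "w \<in> worlds (F i)" for q k \<psi> i w
    using argsub[OF argsd] that RT by blast
  \<comment> \<open>Generalized to upward closed \<open>J\<close>, because \<open>U i\<close> is the
    union over the indices above \<open>i\<close>, which form such a set by transitivity. The
    induction is on the number of realized positions, not on the order.\<close>
  have cl: "forest ?qs (\<Union>i\<in>J. R i)" if "J \<subseteq> worlds I" "\<forall>i\<in>J. \<forall>j. (i, j) \<in> rel I 0 \<longrightarrow> j \<in> J" for J
    using that
  proof (induction "card (\<Union>i\<in>J. R i)" arbitrary: J rule: less_induct)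
    case less
    have fin: "finite (\<Union>i\<in>J. R i)"
      by (rule finite_subset[of _ "fst ` set (args \<phi>)"]) (force simp: R_def)+
    show ?case
    proof (rule forestI)
      fix Y assume Y: "Y \<subseteq> (\<Union>i\<in>J. R i)" "Y \<noteq> {}"
      then obtain i0 where "i0 \<in> {i\<in>J. R i \<inter> Y \<noteq> {}}" by blast
      with wfI obtain i where i: "i \<in> {i\<in>J. R i \<inter> Y \<noteq> {}}"
        and mx: "\<And>j. (j, i) \<in> (rel I 0)\<inverse> \<Longrightarrow> j \<notin> {i\<in>J. R i \<inter> Y \<noteq> {}}"
        by (rule wfE_min) blast
      have iJ: "i \<in> J" "i \<in> worlds I" using i less.prems(1) by blast+
      have sub: "U i \<subseteq> (\<Union>i\<in>J. R i)" unfolding U_def using less.prems(2) iJ(1) by blast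
      have "R j \<inter> Y = {}" if "(i, j) \<in> rel I 0" for j
        using mx[of j] that iJ(1) less.prems(2) by blast
      then have dis: "U i \<inter> Y = {}" unfolding U_def by blast
      \<comment> \<open>A member of \<open>Y\<close> realized at \<open>i\<close> lies in the union
        over \<open>J\<close> but not in \<open>U i\<close>, so the cardinality drops.\<close>
      obtain p where p: "p \<in> R i" "p \<in> Y" using i by auto
      have "p \<notin> U i" "p \<in> (\<Union>i\<in>J. R i)" using dis p iJ(1) by blast+
      then have "U i \<subset> (\<Union>i\<in>J. R i)" using sub by (metis psubsetI)
      then have cd: "card (U i) < card (\<Union>i\<in>J. R i)" using fin psubset_card_mono by blast
      have f: "forest ?qs (U i)"
        unfolding U_def
      proof (rule less.hyps)
        show "card (\<Union> (R ` {j. (i, j) \<in> rel I 0})) < card (\<Union> (R ` J))" using cd by (simp add: U_def)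
        show "{j. (i, j) \<in> rel I 0} \<subseteq> worlds I" using rI by blast
        show "\<forall>j\<in>{j. (i, j) \<in> rel I 0}. \<forall>l. (j, l) \<in> rel I 0 \<longrightarrow> l \<in> {j. (i, j) \<in> rel I 0}"
          using tI by (auto dest: transD)
      qed
      from p obtain k \<psi> w where w: "(p, k, \<psi>) \<in> set (args \<phi>)" "w \<in> worlds (F i)"
        "holds ?S V (i, w) (shift_fm s \<psi>)" by (auto simp: R_def)
      have "holds (univ_frame (F i)) (W i) w (query s a \<phi> T (\<Union>i\<in>J. R i) Y (U i))"
        unfolding holds_query
      proof (intro conjI notI)
        show "\<exists>(q, k, \<psi>)\<in>set (args \<phi>). q \<in> Y \<and>
           holds (univ_frame (F i)) (W i) w (Dia 0 (tr s a T (U i) k \<psi>))"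
          using w p tru[OF w(1) iJ(2) w(2)] by (intro bexI[OF _ w(1)]) (simp, blast)
      next
        assume "\<exists>(q, k, \<psi>)\<in>set (args \<phi>). q \<notin> (\<Union>i\<in>J. R i) \<and>
           holds (univ_frame (F i)) (W i) w (Dia 0 (tr s a T (U i) k \<psi>))"
        then obtain q k' \<psi>' v where q: "(q, k', \<psi>') \<in> set (args \<phi>)" "q \<notin> (\<Union>i\<in>J. R i)"
          "v \<in> worlds (F i)" "holds (univ_frame (F i)) (W i) v (tr s a T (U i) k' \<psi>')" by auto
        then have "q \<in> R i" using tru[OF q(1) iJ(2) q(3)] by (auto simp: R_def)
        then show False using q iJ by auto
      qed
      moreover have WW: "\<forall>n. W i n \<subseteq> worlds (univ_frame (F i))" by (auto simp: W_def)
      ultimately have "?qs (\<Union>i\<in>J. R i) Y (U i)"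
        unfolding Sat_def using w(2) bspec[OF F iJ(2)] is_fm_query[OF fm, of s] B WW
        by (simp, blast)
      then show "\<exists>Z\<subseteq>\<Union> (R ` J). Z \<inter> Y = {} \<and> ?qs (\<Union> (R ` J)) Y Z \<and> forest ?qs Z"
        using sub dis f by auto
    qed
  qed
  have "\<forall>i\<in>worlds I. \<forall>j. (i, j) \<in> rel I 0 \<longrightarrow> j \<in> worlds I" using rI by blast
  from cl[OF order.refl this] have "forest ?qs T" by (simp only: T_def)
  moreover have "0 \<in> T"
  proof (cases x)
    case (Pair i w)
    then show ?thesis using x hx unfolding T_def R_def args_def by auto
  qed
  moreover have "T \<subseteq> fst ` set (args \<phi>)" by (force simp: T_def R_def)
  ultimately show ?thesis by blast
qed

section \<open>Soundness\<close>

locale unravel =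
  fixes s a :: nat and \<phi> :: fm and A :: nat and \<F> :: "'w frame set" and T :: "nat set"
  assumes T: "T \<subseteq> fst ` set (args \<phi>)" and T0: "0 \<in> T"
    and forestT: "forest (\<lambda>X Y Z. query s a \<phi> T X Y Z \<in> Sat (Suc A) (univ_frame ` \<F>)) T"
begin

abbreviation qs where "qs \<equiv> (\<lambda>X Y Z. query s a \<phi> T X Y Z \<in> Sat (Suc A) (univ_frame ` \<F>))"

definition nx :: "nat set \<Rightarrow> nat \<Rightarrow> nat set" where
  "nx D q = (SOME Z. Z \<subseteq> D \<and> q \<notin> Z \<and> qs D {q} Z \<and> forest qs Z)"

definition fr :: "nat set \<Rightarrow> nat \<Rightarrow> 'w frame" where
  "fr D q = (SOME F. F \<in> \<F> \<and> (\<exists>V. \<exists>w\<in>worlds F. holds (univ_frame F) V w (query s a \<phi> T D {q} (nx D q))))"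

definition va :: "nat set \<Rightarrow> nat \<Rightarrow> nat \<Rightarrow> 'w set" where
  "va D q = (SOME V. \<exists>w\<in>worlds (fr D q). holds (univ_frame (fr D q)) V w (query s a \<phi> T D {q} (nx D q)))"

lemma nx:
  assumes "forest qs D" "q \<in> D"
  shows "nx D q \<subseteq> D" "q \<notin> nx D q" "qs D {q} (nx D q)" "forest qs (nx D q)"
proof -
  have "\<exists>Z. Z \<subseteq> D \<and> Z \<inter> {q} = {} \<and> qs D {q} Z \<and> forest qs Z"
    using assms(1) by (rule forest.cases) (use assms(2) in blast)
  then have "\<exists>Z. Z \<subseteq> D \<and> q \<notin> Z \<and> qs D {q} Z \<and> forest qs Z" by auto
  from someI_ex[OF this] show "nx D q \<subseteq> D" "q \<notin> nx D q" "qs D {q} (nx D q)" "forest qs (nx D q)"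
    unfolding nx_def by blast+
qed

lemma fr:
  assumes "forest qs D" "q \<in> D"
  shows "fr D q \<in> \<F>"
    "\<exists>w\<in>worlds (fr D q). holds (univ_frame (fr D q)) (va D q) w (query s a \<phi> T D {q} (nx D q))"
proof -
  have "\<exists>F. F \<in> \<F> \<and> (\<exists>V. \<exists>w\<in>worlds F. holds (univ_frame F) V w (query s a \<phi> T D {q} (nx D q)))"
    using nx(3)[OF assms] unfolding Sat_def by auto
  from someI_ex[OF this]
  have *: "fr D q \<in> \<F> \<and> (\<exists>V. \<exists>w\<in>worlds (fr D q). holds (univ_frame (fr D q)) V w (query s a \<phi> T D {q} (nx D q)))"
    unfolding fr_def .
  then show "fr D q \<in> \<F>" by blast
  from * have "\<exists>V. \<exists>w\<in>worlds (fr D q). holds (univ_frame (fr D q)) V w (query s a \<phi> T D {q} (nx D q))" by blast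
  from someI_ex[OF this]
  show "\<exists>w\<in>worlds (fr D q). holds (univ_frame (fr D q)) (va D q) w (query s a \<phi> T D {q} (nx D q))"
    unfolding va_def .
qed

text \<open>A path lists the successive choices of an element to be realized; its label
  \<open>foldl nx T \<pi>\<close> is the set of positions realized strictly above its end.\<close>

definition paths :: "nat list set" where
  "paths = {\<pi>. \<pi> \<noteq> [] \<and> (\<forall>\<rho> q \<sigma>. \<pi> = \<rho> @ q # \<sigma> \<longrightarrow> q \<in> foldl nx T \<rho>)}"

abbreviation lab where "lab \<equiv> foldl nx T"

text \<open>The unfolding used in inductions from the end of a path. The empty list is no path; it
  acts as a virtual root with label \<open>T\<close>, so that the paths form a forest.\<close>

lemma paths_snoc: "\<pi> @ [q] \<in> paths \<longleftrightarrow> (\<pi> = [] \<or> \<pi> \<in> paths) \<and> q \<in> lab \<pi>"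
proof
  assume *: "\<pi> @ [q] \<in> paths"
  then have "q \<in> lab \<pi>" unfolding paths_def by blast
  moreover have "r \<in> lab \<rho>" if "\<pi> = \<rho> @ r # \<sigma>" for \<rho> r \<sigma>
  proof -
    have "\<pi> @ [q] = \<rho> @ r # (\<sigma> @ [q])" using that by simp
    then show ?thesis using * unfolding paths_def by blast
  qed
  ultimately show "(\<pi> = [] \<or> \<pi> \<in> paths) \<and> q \<in> lab \<pi>" unfolding paths_def by blast
next
  assume *: "(\<pi> = [] \<or> \<pi> \<in> paths) \<and> q \<in> lab \<pi>"
  have "r \<in> lab \<rho>" if "\<pi> @ [q] = \<rho> @ r # \<sigma>" for \<rho> r \<sigma>
  proof (cases \<sigma> rule: rev_cases)
    case Nil
    then show ?thesis using that * by simp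
  next
    case (snoc \<sigma>' x)
    then have "\<pi> = \<rho> @ r # \<sigma>'" using that by simp
    then show ?thesis using * unfolding paths_def by blast
  qed
  then show "\<pi> @ [q] \<in> paths" unfolding paths_def by blast
qed

lemma paths_prefix: "\<pi> @ \<rho> \<in> paths \<Longrightarrow> \<pi> \<noteq> [] \<Longrightarrow> \<pi> \<in> paths"
  by (induction \<rho> rule: rev_induct) (auto simp: paths_snoc simp flip: append_assoc)

lemma forest_lab: "\<pi> = [] \<or> \<pi> \<in> paths \<Longrightarrow> forest qs (lab \<pi>)"
  by (induction \<pi> rule: rev_induct) (auto simp: paths_snoc forestT nx(4))

lemma lab_mono: "\<pi> @ \<rho> \<in> paths \<Longrightarrow> lab (\<pi> @ \<rho>) \<subseteq> lab \<pi>"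
proof (induction \<rho> rule: rev_induct)
  case (snoc q \<rho>)
  have "\<pi> @ \<rho> = [] \<or> \<pi> @ \<rho> \<in> paths" "q \<in> lab (\<pi> @ \<rho>)"
    using snoc.prems paths_snoc[of "\<pi> @ \<rho>" q] by auto
  then have "lab (\<pi> @ \<rho> @ [q]) \<subseteq> lab (\<pi> @ \<rho>)"
    using nx(1)[OF forest_lab[of "\<pi> @ \<rho>"], of q] by simp
  then show ?case using snoc.IH \<open>\<pi> @ \<rho> = [] \<or> \<pi> @ \<rho> \<in> paths\<close> by auto
qed simp

lemma finite_T: "finite T" using T by (rule finite_subset) simp

lemma lab_subset: "\<pi> \<in> paths \<Longrightarrow> lab \<pi> \<subseteq> T"
  using lab_mono[of "[]" \<pi>] by simp

text \<open>Every step removes its own element from the label, so depth is traded against the size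
  of the label. This bounds the depth and yields the finiteness of the index order.\<close>

lemma paths_size: "\<pi> \<in> paths \<Longrightarrow> set \<pi> \<subseteq> T \<and> length \<pi> + card (lab \<pi>) \<le> card T"
proof (induction \<pi> rule: rev_induct)
  case Nil
  then show ?case by (simp add: paths_def)
next
  case (snoc q \<pi>)
  then have q: "\<pi> = [] \<or> \<pi> \<in> paths" "q \<in> lab \<pi>" by (auto simp: paths_snoc)
  have sub: "lab \<pi> \<subseteq> T" using q(1) lab_subset by auto
  then have fin: "finite (lab \<pi>)" using finite_T finite_subset by blast
  have "lab (\<pi> @ [q]) \<subset> lab \<pi>" using nx(1,2)[OF forest_lab[OF q(1)] q(2)] q(2) by auto
  then have "card (lab (\<pi> @ [q])) < card (lab \<pi>)" using fin psubset_card_mono by blast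
  then show ?case using snoc.IH q sub by auto
qed

lemma finite_paths: "finite paths"
proof (rule finite_subset)
  show "paths \<subseteq> {\<pi>. set \<pi> \<subseteq> T \<and> length \<pi> \<le> card T}" using paths_size by fastforce
qed (simp add: finite_lists_length_le finite_T)

abbreviation Fr where "Fr \<pi> \<equiv> fr (lab (butlast \<pi>)) (last \<pi>)"
abbreviation Va where "Va \<pi> \<equiv> va (lab (butlast \<pi>)) (last \<pi>)"

definition realized :: "nat list \<Rightarrow> nat \<Rightarrow> bool" where
  "realized \<pi> q \<longleftrightarrow> (\<exists>k \<psi>. (q, k, \<psi>) \<in> set (args \<phi>) \<and>
     (\<exists>v\<in>worlds (Fr \<pi>). holds (univ_frame (Fr \<pi>)) (Va \<pi>) v (tr s a T (lab \<pi>) k \<psi>)))"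

text \<open>The summand at a path was chosen for the label of its predecessor, with \<open>Y\<close>
  the singleton of the last element. The positive half of the query gives the second claim, the
  negative half the third.\<close>

lemma path_step:
  assumes "\<pi> \<in> paths"
  shows "Fr \<pi> \<in> \<F>" "realized \<pi> (last \<pi>)" "realized \<pi> q \<Longrightarrow> q \<in> lab (butlast \<pi>)"
proof -
  let ?\<rho> = "butlast \<pi>" and ?q = "last \<pi>"
  have ne: "\<pi> \<noteq> []" using assms by (simp add: paths_def)
  then have e: "\<pi> = ?\<rho> @ [?q]" by simp
  then have p: "?\<rho> = [] \<or> ?\<rho> \<in> paths" "?q \<in> lab ?\<rho>" using assms paths_snoc by metis+
  have l: "lab \<pi> = nx (lab ?\<rho>) ?q" by (subst e) simp
  note f = fr[OF forest_lab[OF p(1)] p(2)]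
  show "Fr \<pi> \<in> \<F>" using f(1) .
  from f(2) obtain w where w: "w \<in> worlds (Fr \<pi>)"
    "holds (univ_frame (Fr \<pi>)) (Va \<pi>) w (query s a \<phi> T (lab ?\<rho>) {?q} (lab \<pi>))"
    unfolding l by blast
  then show "realized \<pi> (last \<pi>)" unfolding realized_def holds_query by auto
  assume "realized \<pi> q"
  then show "q \<in> lab (butlast \<pi>)" using w unfolding realized_def holds_query by auto
qed

text \<open>Labels shrink along a path, and a summand realizes nothing outside the label of its
  predecessor. This is one half of reading \<open>lab \<pi>\<close> as the set realized strictly
  above \<pi>; for the other half, an element \<open>k\<close> of it is realized at
  \<open>\<pi> @ [k]\<close>.\<close>

lemma realized_below:
  assumes "\<pi> @ \<rho> \<in> paths" "\<rho> \<noteq> []" "realized (\<pi> @ \<rho>) q"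
  shows "q \<in> lab \<pi>"
proof -
  have q: "q \<in> lab (\<pi> @ butlast \<rho>)" using path_step(3)[OF assms(1,3)] assms(2) by (simp add: butlast_append)
  show ?thesis
  proof (cases "\<pi> @ butlast \<rho> = []")
    case False
    have "(\<pi> @ butlast \<rho>) @ [last \<rho>] \<in> paths" using assms by simp
    then have "\<pi> @ butlast \<rho> \<in> paths" using False paths_prefix by blast
    then show ?thesis using lab_mono q by blast
  qed (use q in auto)
qed

text \<open>The index set \<open>J\<close> is a parameter, to cover both a single tree and the whole
  forest. Closure under extension keeps everything in a label realized above; if the formula has the
  universal modality, \<open>J\<close> must contain all paths, since each element of
  \<open>T\<close> has to be realized.\<close>

lemma truth:
  fixes I :: "'i frame" and g :: "'i \<Rightarrow> nat list"
  assumes g: "bij_betw g (worlds I) J" and J: "J \<subseteq> paths"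
    and closed: "\<And>\<pi> \<rho>. \<pi> \<in> J \<Longrightarrow> \<pi> @ \<rho> \<in> paths \<Longrightarrow> \<pi> @ \<rho> \<in> J"
    and ord: "\<And>i j. i \<in> worlds I \<Longrightarrow> j \<in> worlds I \<Longrightarrow> (i, j) \<in> rel I 0 \<longleftrightarrow> strict_prefix (g i) (g j)"
    and all: "s = 0 \<Longrightarrow> J = paths"
    and V: "V = (\<lambda>n. {(i, w). i \<in> worlds I \<and> w \<in> worlds (Fr (g i)) \<and> w \<in> Va (g i) n})"
  shows "set (dias k \<psi>) \<subseteq> set (args \<phi>) \<Longrightarrow> i \<in> worlds I \<Longrightarrow> w \<in> worlds (Fr (g i)) \<Longrightarrow>
    holds (univ_frame (a_sum a I (\<lambda>i. Fr (g i)))) V (i, w) (shift_fm s \<psi>) \<longleftrightarrow>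
    holds (univ_frame (Fr (g i))) (Va (g i)) w (tr s a T (lab (g i)) k \<psi>)"
proof (induction \<psi> arbitrary: i w k)
  case (Var n)
  then show ?case by (auto simp: V)
next
  case Bot
  then show ?case by simp
next
  case (Imp \<psi>1 \<psi>2)
  show ?case
    using Imp.prems Imp.IH(1)[of "Suc k" i w] Imp.IH(2)[of "Suc k + length (word_of \<psi>1)" i w] by simp
next
  case (Dia b \<psi>)
  let ?S = "univ_frame (a_sum a I (\<lambda>i. Fr (g i)))"
  let ?k = "Suc k + length (bits b)"
  have mem: "(k, ?k, \<psi>) \<in> set (args \<phi>)" using Dia.prems by auto
  have IH: "holds ?S V (j, v) (shift_fm s \<psi>) \<longleftrightarrow>
      holds (univ_frame (Fr (g j))) (Va (g j)) v (tr s a T (lab (g j)) ?k \<psi>)"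
    if "j \<in> worlds I" "v \<in> worlds (Fr (g j))" for j v
    using Dia.IH[of ?k j v] Dia.prems(1) that by simp
  have kR: "realized (g j) k \<longleftrightarrow> (\<exists>v\<in>worlds (Fr (g j)). holds ?S V (j, v) (shift_fm s \<psi>))"
    if "j \<in> worlds I" for j
  proof -
    have "realized (g j) k \<longleftrightarrow> (\<exists>v\<in>worlds (Fr (g j)).
        holds (univ_frame (Fr (g j))) (Va (g j)) v (tr s a T (lab (g j)) ?k \<psi>))"
      using mem args_unique unfolding realized_def by blast
    then show ?thesis using IH[OF that] by (simp cong: bex_cong)
  qed
  have gJ: "g j \<in> paths" if "j \<in> worlds I" for j using g J that bij_betwE by blast
  have gsurj: "\<exists>j\<in>worlds I. g j = \<pi>" if "\<pi> \<in> J" for \<pi>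
    using g that by (metis bij_betw_imp_surj_on imageE)
  have inT: "k \<in> T" if "j \<in> worlds I" "realized (g j) k" for j
    using realized_below[of "[]" "g j" k] gJ[OF that(1)] that by (auto simp: paths_def)
  \<comment> \<open>The one-element path \<open>[k]\<close> realizes \<open>k\<close>.\<close>
  have fT: "\<exists>j\<in>worlds I. realized (g j) k" if "s = 0" "k \<in> T"
  proof -
    have "[k] \<in> paths" using that paths_snoc[of "[]" k] by simp
    then show ?thesis using all that gsurj path_step(2)[of "[k]"] by (metis last.simps)
  qed
  have lab1: "k \<in> lab (g i)" if j: "j \<in> worlds I" "(i, j) \<in> rel I 0" "realized (g j) k" for j
  proof -
    obtain \<rho> where "g j = g i @ \<rho>" "\<rho> \<noteq> []"
      using ord[OF Dia.prems(2) j(1)] j(2) by (auto simp: strict_prefix_def prefix_def)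
    then show ?thesis using realized_below[of "g i" \<rho> k] j(3) gJ[OF j(1)] by simp
  qed
  have lab2: "\<exists>j\<in>worlds I. (i, j) \<in> rel I 0 \<and> realized (g j) k" if "k \<in> lab (g i)"
  proof -
    have "g i \<in> J" using g Dia.prems(2) bij_betwE by blast
    moreover have *: "g i @ [k] \<in> paths" using that gJ[OF Dia.prems(2)] paths_snoc by blast
    ultimately have "g i @ [k] \<in> J" using closed by blast
    then obtain j where j: "j \<in> worlds I" "g j = g i @ [k]" using gsurj by blast
    then have "(i, j) \<in> rel I 0" using ord Dia.prems(2) by (simp add: strict_prefix_def)
    moreover have "realized (g j) k" using path_step(2)[OF *] j by simp
    ultimately show ?thesis using j by blast
  qed
  have kw: "v \<in> worlds (Fr (g j)) \<Longrightarrow> j \<in> worlds I \<Longrightarrow>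
      holds (univ_frame (Fr (g j))) (Va (g j)) v (tr s a T (lab (g j)) ?k \<psi>) \<Longrightarrow> realized (g j) k" for j v
    unfolding realized_def using mem by blast
  consider "b + s = 0" | "b + s = Suc a" | c where "b + s = Suc c" "c \<noteq> a"
    by (metis not0_implies_Suc)
  then show ?case
  proof cases
    case 1
    have "holds ?S V (i, w) (shift_fm s (Dia b \<psi>)) \<longleftrightarrow>
       (\<exists>j\<in>worlds I. \<exists>v\<in>worlds (Fr (g j)). holds ?S V (j, v) (shift_fm s \<psi>))"
      using 1 Dia.prems(2,3) by simp
    also have "\<dots> \<longleftrightarrow> (\<exists>j\<in>worlds I. realized (g j) k)" using kR by (simp cong: bex_cong)
    also have "\<dots> \<longleftrightarrow> k \<in> T" using inT fT 1 by auto
    finally have "holds ?S V (i, w) (shift_fm s (Dia b \<psi>)) \<longleftrightarrow> k \<in> T" .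
    moreover have "(\<exists>v\<in>worlds (Fr (g i)). holds (univ_frame (Fr (g i))) (Va (g i)) v (tr s a T (lab (g i)) ?k \<psi>)) \<Longrightarrow> k \<in> T"
      using inT kw Dia.prems(2) by blast
    ultimately show ?thesis using 1 Dia.prems(3) by auto
  next
    case 2
    let ?R = "\<exists>v\<in>worlds (Fr (g i)). (w, v) \<in> rel (Fr (g i)) a \<and> holds ?S V (i, v) (shift_fm s \<psi>)"
    have ir: "(i, j) \<in> rel I 0 \<Longrightarrow> j \<in> worlds I \<Longrightarrow> i \<noteq> j" for j
      using ord[of i j] by auto
    have "holds ?S V (i, w) (shift_fm s (Dia b \<psi>)) \<longleftrightarrow>
       (\<exists>j\<in>worlds I. \<exists>v\<in>worlds (Fr (g j)). ((i, w), (j, v)) \<in> rel (a_sum a I (\<lambda>i. Fr (g i))) a \<and>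
          holds ?S V (j, v) (shift_fm s \<psi>))"
      using 2 by simp
    also have "\<dots> \<longleftrightarrow> (\<exists>j\<in>worlds I. (i, j) \<in> rel I 0 \<and>
        (\<exists>v\<in>worlds (Fr (g j)). holds ?S V (j, v) (shift_fm s \<psi>))) \<or> ?R"
      unfolding a_sum_rel using Dia.prems(2,3) ir by blast
    also have "\<dots> \<longleftrightarrow> (\<exists>j\<in>worlds I. (i, j) \<in> rel I 0 \<and> realized (g j) k) \<or> ?R" using kR by blast
    also have "\<dots> \<longleftrightarrow> k \<in> lab (g i) \<or> ?R" using lab1 lab2 by blast
    finally show ?thesis using 2 IH Dia.prems(2) by (simp cong: bex_cong)
  next
    case 3
    then have "holds ?S V (i, w) (shift_fm s (Dia b \<psi>)) \<longleftrightarrow>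
       (\<exists>v\<in>worlds (Fr (g i)). (w, v) \<in> rel (Fr (g i)) c \<and> holds ?S V (i, v) (shift_fm s \<psi>))"
      using Dia.prems(2,3) by (simp add: a_sum_rel)
    then show ?thesis using 3 IH Dia.prems(2) by (simp cong: bex_cong)
  qed
qed

lemma model_of_unravel:
  fixes I :: "'i frame" and g :: "'i \<Rightarrow> nat list"
  assumes g: "bij_betw g (worlds I) J" and J: "J \<subseteq> paths"
    and closed: "\<And>\<pi> \<rho>. \<pi> \<in> J \<Longrightarrow> \<pi> @ \<rho> \<in> paths \<Longrightarrow> \<pi> @ \<rho> \<in> J"
    and ord: "\<And>i j. i \<in> worlds I \<Longrightarrow> j \<in> worlds I \<Longrightarrow> (i, j) \<in> rel I 0 \<longleftrightarrow> strict_prefix (g i) (g j)"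
    and all: "s = 0 \<Longrightarrow> J = paths" and J0: "[0] \<in> J"
  shows "\<exists>F V x. (\<forall>i\<in>worlds I. F i \<in> \<F>) \<and> (\<forall>n. V n \<subseteq> worlds (a_sum a I F)) \<and> x \<in> worlds (a_sum a I F) \<and>
    holds (univ_frame (a_sum a I F)) V x (shift_fm s \<phi>)"
proof -
  define V where "V = (\<lambda>n. {(i, w). i \<in> worlds I \<and> w \<in> worlds (Fr (g i)) \<and> w \<in> Va (g i) n})"
  obtain i where i: "i \<in> worlds I" "g i = [0]" using g J0 by (metis bij_betw_imp_surj_on imageE)
  have p: "[0] \<in> paths" using J0 J by blast
  from path_step(2)[OF p] obtain k \<psi> v where v: "(0, k, \<psi>) \<in> set (args \<phi>)" "v \<in> worlds (Fr (g i))"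
     "holds (univ_frame (Fr (g i))) (Va (g i)) v (tr s a T (lab (g i)) k \<psi>)"
    unfolding realized_def i(2) by auto
  \<comment> \<open>Position 0 precedes all modalities of the formula, so its only entry is that of
    the whole formula.\<close>
  have "k = 1 \<and> \<psi> = \<phi>" using args_unique[OF v(1), of 1 \<phi>] by (simp add: args_def)
  then have "holds (univ_frame (a_sum a I (\<lambda>i. Fr (g i)))) V (i, v) (shift_fm s \<phi>)"
    using truth[OF g J closed ord all V_def, of 1 \<phi> i v] v i by (auto simp: args_def)
  moreover have "\<forall>i\<in>worlds I. Fr (g i) \<in> \<F>"
    using path_step(1) g J bij_betwE by blast
  ultimately show ?thesis using i v
    by (intro exI[of _ "\<lambda>i. Fr (g i)"] exI[of _ V] exI[of _ "(i, v)"]) (auto simp: V_def)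
qed

text \<open>Paths with a common first element, ordered by strict prefix, form a tree with root
  \<open>[q]\<close>: two prefixes of one list are comparable. They are coded by numbers because the
  hypothesis on \<open>\<I>\<close> speaks of trees on numbers.\<close>

lemma tree_iso:
  fixes \<I> :: "'i frame set"
  assumes \<I>: "contains_finite_trees \<I>" and q: "q \<in> T"
  shows "\<exists>I\<in>\<I>. \<exists>g. bij_betw g (worlds I) {\<pi>\<in>paths. hd \<pi> = q} \<and>
    (\<forall>i\<in>worlds I. \<forall>j\<in>worlds I. (i, j) \<in> rel I 0 \<longleftrightarrow> strict_prefix (g i) (g j))"
proof -
  let ?J = "{\<pi>\<in>paths. hd \<pi> = q}"
  let ?h = "to_nat :: nat list \<Rightarrow> nat"
  define N where "N = \<lparr>worlds = ?h ` ?J, rel = (\<lambda>b. if b = 0 then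
     {(?h \<pi>, ?h \<rho>) | \<pi> \<rho>. \<pi> \<in> ?J \<and> \<rho> \<in> ?J \<and> strict_prefix \<pi> \<rho>} else {})\<rparr>"
  have r0: "rel N 0 = {(?h \<pi>, ?h \<rho>) | \<pi> \<rho>. \<pi> \<in> ?J \<and> \<rho> \<in> ?J \<and> strict_prefix \<pi> \<rho>}"
    and wN: "worlds N = ?h ` ?J" by (auto simp: N_def)
  have rh: "(?h \<pi>, ?h \<rho>) \<in> rel N 0 \<longleftrightarrow> strict_prefix \<pi> \<rho>" if "\<pi> \<in> ?J" "\<rho> \<in> ?J" for \<pi> \<rho>
    using that unfolding r0 by auto
  have qJ: "[q] \<in> ?J" using q paths_snoc[of "[]" q] by simp
  have "finite_tree N" unfolding finite_tree_def
  proof (intro conjI)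
    show "strict_order N" unfolding strict_order_def
    proof (intro conjI)
      show "is_frame 1 N" unfolding is_frame_def using qJ by (auto simp: N_def)
      show "irrefl (rel N 0)" unfolding irrefl_def r0 by auto
      show "trans (rel N 0)" unfolding trans_def r0 using strict_prefix_def prefix_order.less_trans by fastforce
    qed
    show "finite (worlds N)" unfolding wN using finite_paths by simp
    show "\<exists>r\<in>worlds N. \<forall>i\<in>worlds N. i = r \<or> (r, i) \<in> rel N 0"
    proof (intro bexI ballI)
      fix i assume "i \<in> worlds N"
      then obtain \<pi> where \<pi>: "\<pi> \<in> ?J" "i = ?h \<pi>" by (auto simp: wN)
      then have "prefix [q] \<pi>" by (cases \<pi>) (auto simp: paths_def)
      then show "i = ?h [q] \<or> (?h [q], i) \<in> rel N 0"
        using rh[OF qJ \<pi>(1)] \<pi>(2) by (auto simp: strict_prefix_def)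
    qed (use qJ in \<open>auto simp: wN\<close>)
    show "\<forall>i\<in>worlds N. total_on {j. (j, i) \<in> rel N 0} (rel N 0)"
    proof (intro ballI total_onI)
      fix i x y assume "x \<in> {j. (j, i) \<in> rel N 0}" "y \<in> {j. (j, i) \<in> rel N 0}" "x \<noteq> y"
      then obtain \<pi> \<rho> \<sigma> where *: "x = ?h \<pi>" "y = ?h \<rho>" "\<pi> \<in> ?J" "\<rho> \<in> ?J" "strict_prefix \<pi> \<sigma>" "strict_prefix \<rho> \<sigma>"
        "\<pi> \<noteq> \<rho>" unfolding r0 by auto
      then have "prefix \<pi> \<rho> \<or> prefix \<rho> \<pi>" using prefix_same_cases strict_prefix_def by metis
      then show "(x, y) \<in> rel N 0 \<or> (y, x) \<in> rel N 0" using * rh by (auto simp: strict_prefix_def)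
    qed
  qed
  then obtain I where I: "I \<in> \<I>" "frame_iso N I" using \<I> unfolding contains_finite_trees_def by blast
  then obtain f where f: "bij_betw f (worlds N) (worlds I)"
    "\<And>b x y. x \<in> worlds N \<Longrightarrow> y \<in> worlds N \<Longrightarrow> (x, y) \<in> rel N b \<longleftrightarrow> (f x, f y) \<in> rel I b"
    unfolding frame_iso_def by blast
  have b: "bij_betw (f \<circ> ?h) ?J (worlds I)"
    by (rule bij_betw_trans[OF _ f(1)]) (auto simp: wN bij_betw_def intro: inj_on_subset[OF inj_to_nat])
  let ?g = "inv_into ?J (f \<circ> ?h)"
  have g: "bij_betw ?g (worlds I) ?J" using b by (rule bij_betw_inv_into)
  have "(i, j) \<in> rel I 0 \<longleftrightarrow> strict_prefix (?g i) (?g j)" if "i \<in> worlds I" "j \<in> worlds I" for i j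
  proof -
    have m: "?g i \<in> ?J" "?g j \<in> ?J" using g that bij_betwE by blast+
    have e: "f (?h (?g i)) = i" "f (?h (?g j)) = j"
      using bij_betw_inv_into_right[OF b that(1)] bij_betw_inv_into_right[OF b that(2)] by simp_all
    have "(?h (?g i), ?h (?g j)) \<in> rel N 0 \<longleftrightarrow> (i, j) \<in> rel I 0"
      using f(2)[of "?h (?g i)" "?h (?g j)" 0, unfolded wN, OF imageI imageI, OF m] unfolding e .
    then show ?thesis using rh[OF m] by blast
  qed
  then show ?thesis using I g by blast
qed

text \<open>Lists with different first elements are incomparable, so the forest of all paths is the
  disjoint union of the trees of \<open>tree_iso\<close>, indexed through an enumeration of
  \<open>T\<close>. The union is nonempty as 0 is in \<open>T\<close>.\<close>

lemma forest_iso: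
  fixes \<I> :: "'i frame set"
  assumes \<I>: "contains_finite_trees \<I>" "closed_disjoint_unions \<I>"
  shows "\<exists>I\<in>\<I>. \<exists>g. bij_betw g (worlds I) paths \<and>
    (\<forall>i\<in>worlds I. \<forall>j\<in>worlds I. (i, j) \<in> rel I 0 \<longleftrightarrow> strict_prefix (g i) (g j))"
proof -
  obtain e where e: "bij_betw e {0..<card T} T" using ex_bij_betw_nat_finite[OF finite_T] by blast
  let ?J = "\<lambda>q. {\<pi>\<in>paths. hd \<pi> = q}"
  define ok where "ok q I g \<longleftrightarrow> I \<in> \<I> \<and> bij_betw g (worlds I) (?J q) \<and>
    (\<forall>i\<in>worlds I. \<forall>j\<in>worlds I. (i, j) \<in> rel I 0 \<longleftrightarrow> strict_prefix (g i) (g j))"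
    for q and I :: "'i frame" and g
  have "\<forall>q\<in>T. \<exists>I g. ok q I g"
    using tree_iso[OF \<I>(1)] unfolding ok_def by (simp add: Bex_def)
  from bchoice[OF this] obtain K where "\<forall>q\<in>T. \<exists>g. ok q (K q) g" ..
  from bchoice[OF this] obtain G where okG: "\<forall>q\<in>T. ok q (K q) (G q)" ..
  have K1: "K q \<in> \<I>" and K2: "bij_betw (G q) (worlds (K q)) (?J q)"
    and K3: "\<And>i j. i \<in> worlds (K q) \<Longrightarrow> j \<in> worlds (K q) \<Longrightarrow>
      (i, j) \<in> rel (K q) 0 \<longleftrightarrow> strict_prefix (G q i) (G q j)" if "q \<in> T" for q
    using okG that by (auto simp: ok_def)
  let ?U = "disjoint_union (card T) (\<lambda>k. K (e k))"
  have eT: "e k \<in> T" if "k < card T" for k using bij_betwE[OF e] that by simp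
  have "card T > 0" using T0 finite_T card_gt_0_iff by blast
  then obtain I where I: "I \<in> \<I>" "frame_iso ?U I"
    using \<I>(2)[unfolded closed_disjoint_unions_def, rule_format, of "card T" "\<lambda>k. K (e k)"] K1[OF eT] by auto
  obtain f where f: "bij_betw f (worlds ?U) (worlds I)"
    "\<And>b x y. x \<in> worlds ?U \<Longrightarrow> y \<in> worlds ?U \<Longrightarrow> (x, y) \<in> rel ?U b \<longleftrightarrow> (f x, f y) \<in> rel I b"
    using I(2) unfolding frame_iso_def by blast
  define h where "h = (\<lambda>(k, x). G (e k) x)"
  have wU: "worlds ?U = (SIGMA k:{..<card T}. worlds (K (e k)))" by (simp add: disjoint_union_def)
  have Gm: "G q x \<in> ?J q" if "q \<in> T" "x \<in> worlds (K q)" for q x using bij_betwE[OF K2[OF that(1)]] that(2) by simp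
  have h: "bij_betw h (worlds ?U) paths" unfolding bij_betw_def
  proof
    show "inj_on h (worlds ?U)"
    proof (rule inj_onI)
      fix x y assume "x \<in> worlds ?U" "y \<in> worlds ?U" "h x = h y"
      then obtain k u l v where *: "x = (k, u)" "y = (l, v)" "k < card T" "l < card T"
        "u \<in> worlds (K (e k))" "v \<in> worlds (K (e l))" "G (e k) u = G (e l) v"
        unfolding wU h_def by auto
      have "e k = e l" using Gm[OF eT[OF *(3)] *(5)] Gm[OF eT[OF *(4)] *(6)] *(7) by simp
      then have "k = l" using e *(3,4) unfolding bij_betw_def inj_on_def by auto
      moreover from this have "u = v" using bij_betw_imp_inj_on[OF K2[OF eT[OF *(3)]]] *(5,6,7) by (auto dest: inj_onD)
      ultimately show "x = y" using * by simp
    qed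
    show "h ` worlds ?U = paths"
    proof
      show "h ` worlds ?U \<subseteq> paths"
      proof
        fix \<pi> assume "\<pi> \<in> h ` worlds ?U"
        then obtain k u where "k < card T" "u \<in> worlds (K (e k))" "\<pi> = G (e k) u"
          unfolding wU h_def by auto
        then show "\<pi> \<in> paths" using Gm[OF eT] by simp
      qed
      show "paths \<subseteq> h ` worlds ?U"
      proof
        fix \<pi> assume \<pi>: "\<pi> \<in> paths"
        then obtain q \<sigma> where "\<pi> = q # \<sigma>" by (cases \<pi>) (auto simp: paths_def)
        then have q: "hd \<pi> = q" "q \<in> T" using paths_size[OF \<pi>] by auto
        then have "q \<in> e ` {0..<card T}" using bij_betw_imp_surj_on[OF e] by simp
        then obtain k where k: "k < card T" "e k = q" by auto
        have "\<pi> \<in> G q ` worlds (K q)" using bij_betw_imp_surj_on[OF K2[OF q(2)]] \<pi> q(1) by simp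
        then obtain u where "u \<in> worlds (K q)" "G q u = \<pi>" by auto
        then have "h (k, u) = \<pi>" "(k, u) \<in> worlds ?U" unfolding wU h_def using k by simp_all
        then show "\<pi> \<in> h ` worlds ?U" by (metis imageI)
      qed
    qed
  qed
  have ho: "(x, y) \<in> rel ?U 0 \<longleftrightarrow> strict_prefix (h x) (h y)" if xy: "x \<in> worlds ?U" "y \<in> worlds ?U" for x y
  proof -
    obtain k u l v where *: "x = (k, u)" "y = (l, v)" "k < card T" "l < card T"
        "u \<in> worlds (K (e k))" "v \<in> worlds (K (e l))" using xy unfolding wU by auto
    show ?thesis
    proof (cases "k = l")
      case True
      then have "(x, y) \<in> rel ?U 0 \<longleftrightarrow> (u, v) \<in> rel (K (e k)) 0"
        using * by (auto simp: disjoint_union_def)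
      then show ?thesis using * True K3[OF eT[OF *(3)]] by (simp add: h_def)
    next
      case False
      then have "e k \<noteq> e l" using e *(3,4) unfolding bij_betw_def inj_on_def by auto
      moreover have g: "G (e k) u \<in> ?J (e k)" "G (e l) v \<in> ?J (e l)" using Gm[OF eT] *(3-6) by simp_all
      ultimately have "\<not> strict_prefix (G (e k) u) (G (e l) v)"
        by (auto simp: strict_prefix_def prefix_def paths_def)
      then show ?thesis using * False by (auto simp: disjoint_union_def h_def)
    qed
  qed
  let ?f = "inv_into (worlds ?U) f"
  have fi: "bij_betw ?f (worlds I) (worlds ?U)" using f(1) by (rule bij_betw_inv_into)
  have "(i, j) \<in> rel I 0 \<longleftrightarrow> strict_prefix ((h \<circ> ?f) i) ((h \<circ> ?f) j)" if "i \<in> worlds I" "j \<in> worlds I" for i j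
  proof -
    have m: "?f i \<in> worlds ?U" "?f j \<in> worlds ?U" using bij_betwE[OF fi] that by simp_all
    have "f (?f i) = i" "f (?f j) = j" using bij_betw_inv_into_right[OF f(1)] that by auto
    then show ?thesis using f(2)[OF m, of 0] ho[OF m] by simp
  qed
  with bij_betw_trans[OF fi h] show ?thesis using I(1)
    by (intro bexI[of _ I] exI[of _ "h \<circ> ?f"] conjI ballI)
qed

end

section \<open>Satisfiability in sums characterized by \<open>forest\<close>\<close>

lemma shift_fm_0 [simp]: "shift_fm 0 \<phi> = \<phi>" by (induction \<phi>) auto

text \<open>A shifted formula never reaches the universal relation; thus satisfiability in sums
  becomes satisfiability in their expansions, and both parts of the theorem are treated
  alike.\<close>

lemma holds_shift_1: "holds (univ_frame F) V w (shift_fm (Suc 0) \<phi>) \<longleftrightarrow> holds F V w \<phi>"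
  by (induction \<phi> arbitrary: w) auto

text \<open>The semantic core: what remains is to decide the right-hand side in polynomial space
  with the oracle.\<close>

theorem Sat_sums_iff_forest:
  fixes \<F> :: "'w frame set" and \<I> :: "'i frame set"
  assumes noeth: "\<forall>I\<in>\<I>. noetherian_order I" and trees: "contains_finite_trees \<I>"
    and fm: "is_fm B \<phi>" and s: "s = 1 \<and> B = A \<or> s = 0 \<and> B = Suc A \<and> closed_disjoint_unions \<I>"
  shows "\<phi> \<in> (if s = 1 then Sat A (a_sums a \<I> \<F>) else Sat (Suc A) (univ_frame ` a_sums a \<I> \<F>)) \<longleftrightarrow>
    (\<exists>T. T \<subseteq> fst ` set (args \<phi>) \<and> 0 \<in> T \<and>
      forest (\<lambda>X Y Z. query s a \<phi> T X Y Z \<in> Sat (Suc A) (univ_frame ` \<F>)) T)" (is "?L \<longleftrightarrow> ?R")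
proof -
  have L: "?L \<longleftrightarrow> (\<exists>I\<in>\<I>. \<exists>F V x. (\<forall>i\<in>worlds I. F i \<in> \<F>) \<and> (\<forall>n. V n \<subseteq> worlds (a_sum a I F)) \<and>
     x \<in> worlds (a_sum a I F) \<and> holds (univ_frame (a_sum a I F)) V x (shift_fm s \<phi>))"
    (is "?L \<longleftrightarrow> ?M")
  proof (cases "s = 1")
    case True
    have "?L \<longleftrightarrow> (\<exists>S\<in>a_sums a \<I> \<F>. \<exists>V. (\<forall>n. V n \<subseteq> worlds S) \<and> (\<exists>x\<in>worlds S. holds (univ_frame S) V x (shift_fm s \<phi>)))"
      using fm s True unfolding Sat_def by (simp add: holds_shift_1)
    also have "\<dots> \<longleftrightarrow> ?M" unfolding a_sums_def by blast
    finally show ?thesis .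
  next
    case False
    have "?L \<longleftrightarrow> (\<exists>S\<in>a_sums a \<I> \<F>. \<exists>V. (\<forall>n. V n \<subseteq> worlds S) \<and> (\<exists>x\<in>worlds S. holds (univ_frame S) V x (shift_fm s \<phi>)))"
      using fm s False unfolding Sat_def by simp
    also have "\<dots> \<longleftrightarrow> ?M" unfolding a_sums_def by blast
    finally show ?thesis .
  qed
  show ?thesis
  proof
    assume ?L
    then obtain I F V x where *: "I \<in> \<I>" "\<forall>i\<in>worlds I. F i \<in> \<F>" "x \<in> worlds (a_sum a I F)"
      "holds (univ_frame (a_sum a I F)) V x (shift_fm s \<phi>)" unfolding L by blast
    show ?R using forest_of_model[OF _ *(2,3,4) fm] noeth *(1) s by auto
  next
    assume ?R
    then obtain T where T: "T \<subseteq> fst ` set (args \<phi>)" "0 \<in> T"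
      "forest (\<lambda>X Y Z. query s a \<phi> T X Y Z \<in> Sat (Suc A) (univ_frame ` \<F>)) T" by blast
    interpret unravel s a \<phi> A \<F> T using T by unfold_locales
    have p0: "[0] \<in> paths" using T0 paths_snoc[of "[]" 0] by simp
    show ?L
    proof (cases "s = 0")
      case True
      then obtain I g where I: "I \<in> \<I>" "bij_betw g (worlds I) paths"
        "\<forall>i\<in>worlds I. \<forall>j\<in>worlds I. (i, j) \<in> rel I 0 \<longleftrightarrow> strict_prefix (g i) (g j)"
        using forest_iso[OF trees] s by auto
      show ?thesis unfolding L
        by (rule bexI[OF _ I(1)], rule model_of_unravel[OF I(2)]) (use I(3) p0 in auto)
    next
      case False
      obtain I g where I: "I \<in> \<I>" "bij_betw g (worlds I) {\<pi>\<in>paths. hd \<pi> = 0}"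
        "\<forall>i\<in>worlds I. \<forall>j\<in>worlds I. (i, j) \<in> rel I 0 \<longleftrightarrow> strict_prefix (g i) (g j)"
        using tree_iso[OF trees T0] by auto
      have "\<pi> @ \<rho> \<in> {\<pi>\<in>paths. hd \<pi> = 0}" if "\<pi> \<in> {\<pi>\<in>paths. hd \<pi> = 0}" "\<pi> @ \<rho> \<in> paths" for \<pi> \<rho>
        using that by (auto simp: paths_def)
      then show ?thesis unfolding L
        by (intro bexI[OF _ I(1)], intro model_of_unravel[OF I(2)]) (use I(3) p0 False in auto)
    qed
  qed
qed

section \<open>Tokens\<close>

text \<open>A token stands for one symbol of the input word. The Boolean of \<open>TVar\<close> and the second one of
  \<open>TBit\<close> mark the last symbol of a binary number; the natural number of \<open>TDia\<close> repeats
  the index spelled by the following bits. With the arities below, a word of tokens is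
  a Polish word.\<close>

datatype tok = TRoot | TVar bool | TBit bool bool | TBot | TImp | TDia nat

text \<open>A binary number counts as one term, a chain of unary bits closed by a nullary one. A
  modality has two arguments, the number and the formula, unless the number is the empty
  word.\<close>

fun ar :: "tok \<Rightarrow> nat" where
  "ar TRoot = 1"
| "ar (TVar l) = (if l then 0 else 1)"
| "ar (TBit v l) = (if l then 0 else 1)"
| "ar TBot = 0"
| "ar TImp = 2"
| "ar (TDia b) = (if b = 0 then 1 else 2)"

text \<open>The usual counter for Polish notation: \<open>k\<close> terms are still expected, and
  the count must not reach 0 before the end.\<close>

fun ari :: "nat \<Rightarrow> tok list \<Rightarrow> bool" where
  "ari k [] \<longleftrightarrow> k = 0"
| "ari k (t # ts) \<longleftrightarrow> k > 0 \<and> ari (k - 1 + ar t) ts"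

fun tbits :: "nat \<Rightarrow> tok list" where
  "tbits n = (if n = 0 then [] else TBit (odd n) (n div 2 = 0) # tbits (n div 2))"
declare tbits.simps [simp del]

primrec toks :: "fm \<Rightarrow> tok list" where
  "toks (Var n) = TVar (n = 0) # tbits n"
| "toks Bot = [TBot]"
| "toks (Imp \<phi> \<psi>) = TImp # toks \<phi> @ toks \<psi>"
| "toks (Dia b \<phi>) = TDia b # tbits b @ toks \<phi>"

lemma bits_0 [simp]: "bits 0 = []" and tbits_0 [simp]: "tbits 0 = []"
  by (simp_all add: bits.simps tbits.simps)

lemma length_tbits [simp]: "length (tbits n) = length (bits n)"
proof (induction n rule: less_induct)
  case (less n)
  then show ?case by (cases "n = 0") (simp_all add: bits.simps[of n] tbits.simps[of n])
qed

lemma length_toks [simp]: "length (toks \<phi>) = length (word_of \<phi>)"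
  by (induction \<phi>) auto

lemma ari_tbits: "n > 0 \<Longrightarrow> ari k (tbits n @ ts) \<longleftrightarrow> k > 0 \<and> ari (k - 1) ts"
proof (induction n arbitrary: k rule: less_induct)
  case (less n)
  show ?case
  proof (cases "n div 2 = 0")
    case True
    then show ?thesis using less.prems by (simp add: tbits.simps[of n])
  next
    case False
    then have "n div 2 < n" "n div 2 > 0" by auto
    then show ?thesis using less.IH[of "n div 2" k] False less.prems
      by (simp add: tbits.simps[of n]) auto
  qed
qed

lemma ari_toks: "ari k (toks \<phi> @ ts) \<longleftrightarrow> k > 0 \<and> ari (k - 1) ts"
proof (induction \<phi> arbitrary: k ts)
  case (Var n)
  then show ?case by (cases "n = 0") (auto simp: ari_tbits)
next
  case (Dia b \<phi>)
  then show ?case by (cases "b = 0") (auto simp: ari_tbits)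
qed auto

subsection \<open>Tokenization\<close>

text \<open>The word is read from right to left. The number is the value, capped at \<open>C\<close>, of the bits
  read since the last symbol that is not a bit; \<open>None\<close> is a syntax error.\<close>

fun tstep :: "nat \<Rightarrow> sym \<Rightarrow> nat option \<Rightarrow> nat option \<times> tok" where
  "tstep C x None = (None, TBot)"
| "tstep C SVar (Some v) = (Some 0, TVar (v = 0))"
| "tstep C SBot (Some v) = (if v = 0 then Some 0 else None, TBot)"
| "tstep C SImp (Some v) = (if v = 0 then Some 0 else None, TImp)"
| "tstep C SDia (Some v) = (if v < C then (Some 0, TDia v) else (None, TBot))"
| "tstep C S0 (Some v) = (if v = 0 then None else Some (min C (2 * v)), TBit False False)"
| "tstep C S1 (Some v) = (Some (min C (2 * v + 1)), TBit True (v = 0))"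

primrec tz :: "nat \<Rightarrow> sym list \<Rightarrow> nat option \<times> tok list" where
  "tz C [] = (Some 0, [])"
| "tz C (x # w) = (fst (tstep C x (fst (tz C w))), snd (tstep C x (fst (tz C w))) # snd (tz C w))"

text \<open>As \<open>C\<close> is positive, capping at \<open>C\<close> preserves whether the value
  is 0 and whether it is below \<open>C\<close>, the two facts that the tokenization tests; and
  capped values still determine the capped double.\<close>

lemma tz_bits:
  assumes "C > 0" "tz C w = (Some 0, ts)"
  shows "tz C (bits n @ w) = (Some (min C n), tbits n @ ts)"
proof (induction n rule: less_induct)
  case (less n)
  show ?case
  proof (cases "n = 0")
    case True
    then show ?thesis using assms by simp
  next
    case False
    then have IH: "tz C (bits (n div 2) @ w) = (Some (min C (n div 2)), tbits (n div 2) @ ts)"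
      using less by simp
    show ?thesis
    proof (cases "even n")
      case True
      then have "n div 2 \<noteq> 0" using False by auto
      moreover have "min C (2 * min C (n div 2)) = min C (2 * (n div 2))" by (simp add: min_def)
      then have "min C (2 * min C (n div 2)) = min C n" using True by simp
      ultimately show ?thesis using IH True False assms
        by (simp add: bits.simps[of n] tbits.simps[of n])
    next
      case odd: False
      have "min C (Suc (2 * min C (n div 2))) = min C (Suc (2 * (n div 2)))"
        using assms(1) by (simp add: min_def)
      moreover have "Suc (2 * (n div 2)) = n" using odd by simp
      ultimately have "min C (Suc (2 * min C (n div 2))) = min C n" by simp
      moreover have "min C (n div 2) = 0 \<longleftrightarrow> n div 2 = 0" using assms(1) by (auto simp: min_def)
      ultimately show ?thesis using IH odd False assms
        by (simp add: bits.simps[of n] tbits.simps[of n])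
    qed
  qed
qed

lemma tz_word_of:
  assumes "C > 0"
  shows "is_fm C \<phi> \<Longrightarrow> tz C w = (Some 0, ts) \<Longrightarrow> tz C (word_of \<phi> @ w) = (Some 0, toks \<phi> @ ts)"
proof (induction \<phi> arbitrary: w ts)
  case (Var n)
  then show ?case using tz_bits[OF assms, of w ts n] assms by (auto simp: min_def)
next
  case (Dia b \<phi>)
  then have "tz C (word_of \<phi> @ w) = (Some 0, toks \<phi> @ ts)" by simp
  from tz_bits[OF assms this, of b] Dia.prems show ?case by (simp add: min_def)
qed auto

lemma bits_double: "n > 0 \<Longrightarrow> bits (2 * n) = S0 # bits n" "bits (Suc (2 * n)) = S1 # bits n"
  and tbits_double: "n > 0 \<Longrightarrow> tbits (2 * n) = TBit False False # tbits n"
    "tbits (Suc (2 * n)) = TBit True (n = 0) # tbits n"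
  by (simp_all add: bits.simps[of "2 * n"] bits.simps[of "Suc (2 * n)"]
      tbits.simps[of "2 * n"] tbits.simps[of "Suc (2 * n)"])

text \<open>The state only contains a capped value; this recovers the number that was actually read,
  and leaves a rest in state \<open>Some 0\<close>, from which parsing goes on.\<close>

lemma tz_SomeD:
  assumes "C > 0"
  shows "tz C w = (Some v, ts) \<Longrightarrow> \<exists>n w' ts'. w = bits n @ w' \<and> ts = tbits n @ ts' \<and>
    v = min C n \<and> tz C w' = (Some 0, ts')"
proof (induction w arbitrary: v ts)
  case Nil
  then show ?case using assms by (auto intro!: exI[of _ 0])
next
  case (Cons x w)
  obtain r ts1 where 1: "tz C w = (r, ts1)" by fastforce
  then obtain v1 where r: "r = Some v1" using Cons.prems by (cases r) auto
  obtain n w' ts' where n: "w = bits n @ w'" "ts1 = tbits n @ ts'" "v1 = min C n" "tz C w' = (Some 0, ts')"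
    using Cons.IH 1 r by blast
  show ?case
  proof (cases "v = 0")
    case True
    then show ?thesis using Cons.prems assms by (intro exI[of _ 0]) simp
  next
    case False
    then have x: "x = S0 \<or> x = S1" using Cons.prems 1 r by (cases x) (auto split: if_splits)
    then show ?thesis
    proof
      assume "x = S0"
      \<comment> \<open>A digit \<open>S0\<close> with value 0 after it would be a zero in the most
        significant place, which \<open>tstep\<close> rejects and no \<open>bits n\<close>
        contains.\<close>
      moreover from this have "n > 0" using Cons.prems 1 r n assms by (auto split: if_splits)
      ultimately show ?thesis using Cons.prems 1 r n
        by (intro exI[of _ "2 * n"] exI[of _ w'] exI[of _ ts']) (auto simp: bits_double tbits_double split: if_splits)
    next
      assume "x = S1"
      then show ?thesis using Cons.prems 1 r n assms
        by (intro exI[of _ "Suc (2 * n)"] exI[of _ w'] exI[of _ ts']) (auto simp: bits_double tbits_double)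
    qed
  qed
qed

text \<open>Stated for \<open>k\<close> consecutive formulas, because the counter of
  \<open>ari\<close> rises at an implication.\<close>

lemma tz_parse:
  assumes "C > 0"
  shows "tz C w = (Some 0, ts) \<Longrightarrow> ari k ts \<Longrightarrow> \<exists>\<phi>s. length \<phi>s = k \<and> w = concat (map word_of \<phi>s) \<and>
    ts = concat (map toks \<phi>s) \<and> (\<forall>\<phi>\<in>set \<phi>s. is_fm C \<phi>)"
proof (induction w arbitrary: k ts rule: length_induct)
  case (1 w)
  show ?case
  proof (cases w)
    case Nil
    then show ?thesis using 1 by simp
  next
    case (Cons x w1)
    obtain r ts1 where t1: "tz C w1 = (r, ts1)" by fastforce
    then obtain v1 where r: "r = Some v1" using 1 Cons by (cases r) auto
    obtain n w2 ts2 where n: "w1 = bits n @ w2" "ts1 = tbits n @ ts2" "v1 = min C n" "tz C w2 = (Some 0, ts2)"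
      using tz_SomeD[OF assms] t1 r by blast
    have IH1: "\<exists>\<phi>s. length \<phi>s = j \<and> w1 = concat (map word_of \<phi>s) \<and>
      ts1 = concat (map toks \<phi>s) \<and> (\<forall>\<phi>\<in>set \<phi>s. is_fm C \<phi>)" if "v1 = 0" "ari j ts1" for j
      using 1(1) that t1 r Cons by auto
    have IH2: "\<exists>\<phi>s. length \<phi>s = j \<and> w2 = concat (map word_of \<phi>s) \<and>
      ts2 = concat (map toks \<phi>s) \<and> (\<forall>\<phi>\<in>set \<phi>s. is_fm C \<phi>)" if "ari j ts2" for j
      using 1(1) that n Cons by auto
    have ts: "Some 0 = fst (tstep C x (Some v1))" "ts = snd (tstep C x (Some v1)) # ts1"
      using 1(2) Cons t1 r by auto
    have vn: "v1 = 0 \<longleftrightarrow> n = 0" using n(3) assms by (simp add: min_def)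
    have w: "w = x # bits n @ w2" using Cons n(1) by simp
    have tsn: "ts = snd (tstep C x (Some v1)) # tbits n @ ts2" using ts(2) n(2) by simp
    have ak: "ari k (snd (tstep C x (Some v1)) # tbits n @ ts2)" using 1(3) by (simp only: tsn)
    show ?thesis
    proof (cases x)
      case SVar
      have "k > 0 \<and> ari (k - 1) ts2"
        using ak vn by (cases "n = 0") (simp_all add: SVar ari_tbits)
      then obtain \<phi>s where *: "length \<phi>s = k - 1" "w2 = concat (map word_of \<phi>s)"
        "ts2 = concat (map toks \<phi>s)" "\<forall>\<phi>\<in>set \<phi>s. is_fm C \<phi>" "k > 0" using IH2[of "k - 1"] by auto
      show ?thesis
        by (rule exI[of _ "Var n # \<phi>s"]) (use * vn in \<open>simp add: w tsn SVar\<close>)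
    next
      case SBot
      have v: "v1 = 0" using ts(1) by (simp add: SBot split: if_splits)
      then have "k > 0 \<and> ari (k - 1) ts2" using ak vn by (simp add: SBot)
      then obtain \<phi>s where *: "length \<phi>s = k - 1" "w2 = concat (map word_of \<phi>s)"
        "ts2 = concat (map toks \<phi>s)" "\<forall>\<phi>\<in>set \<phi>s. is_fm C \<phi>" "k > 0" using IH2[of "k - 1"] by auto
      show ?thesis
        by (rule exI[of _ "Bot # \<phi>s"]) (use * vn v in \<open>simp add: w tsn SBot\<close>)
    next
      case SImp
      have v: "v1 = 0" using ts(1) by (simp add: SImp split: if_splits)
      then have "k > 0 \<and> ari (Suc k) ts2" using ak vn by (cases k) (simp_all add: SImp)
      then obtain \<phi>s where *: "length \<phi>s = Suc k" "w2 = concat (map word_of \<phi>s)"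
        "ts2 = concat (map toks \<phi>s)" "\<forall>\<phi>\<in>set \<phi>s. is_fm C \<phi>" "k > 0" using IH2[of "Suc k"] by auto
      then obtain \<phi> \<psi> \<chi>s where "\<phi>s = \<phi> # \<psi> # \<chi>s"
        by (cases \<phi>s; cases "tl \<phi>s") auto
      then show ?thesis
        by (intro exI[of _ "Imp \<phi> \<psi> # \<chi>s"]) (use * vn v in \<open>simp add: w tsn SImp\<close>)
    next
      case SDia
      have v: "v1 < C" using ts(1) by (simp add: SDia split: if_splits)
      then have nv: "v1 = n" using n(3) by (simp add: min_def split: if_splits)
      have "k > 0 \<and> ari k ts2"
        using ak vn v nv by (cases "n = 0"; cases k) (simp_all add: SDia ari_tbits)
      then obtain \<phi>s where *: "length \<phi>s = k" "w2 = concat (map word_of \<phi>s)"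
        "ts2 = concat (map toks \<phi>s)" "\<forall>\<phi>\<in>set \<phi>s. is_fm C \<phi>" "k > 0" using IH2[of k] by auto
      then obtain \<phi> \<chi>s where "\<phi>s = \<phi> # \<chi>s" by (cases \<phi>s) auto
      then show ?thesis
        by (intro exI[of _ "Dia n \<phi> # \<chi>s"]) (use * v nv in \<open>simp add: w tsn SDia\<close>)
    next
      case S0
      then show ?thesis using ts(1) assms by (simp split: if_splits)
    next
      case S1
      then show ?thesis using ts(1) assms by simp
    qed
  qed
qed

lemma tz_iff:
  assumes "C > 0"
  shows "fst (tz C w) = Some 0 \<and> ari 1 (snd (tz C w)) \<longleftrightarrow> (\<exists>\<phi>. is_fm C \<phi> \<and> w = word_of \<phi>)"
proof
  assume "fst (tz C w) = Some 0 \<and> ari 1 (snd (tz C w))"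
  then obtain \<phi>s where "length \<phi>s = 1" "w = concat (map word_of \<phi>s)" "\<forall>\<phi>\<in>set \<phi>s. is_fm C \<phi>"
    using tz_parse[OF assms, of w "snd (tz C w)" 1] by (metis prod.collapse)
  then show "\<exists>\<phi>. is_fm C \<phi> \<and> w = word_of \<phi>" by (cases \<phi>s) auto
next
  assume "\<exists>\<phi>. is_fm C \<phi> \<and> w = word_of \<phi>"
  then obtain \<phi> where "is_fm C \<phi>" "w = word_of \<phi>" by blast
  then show "fst (tz C w) = Some 0 \<and> ari 1 (snd (tz C w))"
    using tz_word_of[OF assms, of \<phi> "[]" "[]"] ari_toks[of 1 \<phi> "[]"] by simp
qed

section \<open>Unique readability of the words of formulas\<close>

definition no_bit :: "sym list \<Rightarrow> bool" where
  "no_bit u \<longleftrightarrow> u = [] \<or> (hd u \<noteq> S0 \<and> hd u \<noteq> S1)"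

lemma bits_append_inj:
  "bits m @ u = bits n @ v \<Longrightarrow> no_bit u \<Longrightarrow> no_bit v \<Longrightarrow> m = n \<and> u = v"
proof (induction m arbitrary: n rule: less_induct)
  case (less m)
  show ?case
  proof (cases "m = 0 \<or> n = 0")
    case True
    then show ?thesis using less.prems
      by (cases "m = 0"; cases "n = 0") (auto simp: bits.simps[of m] bits.simps[of n] no_bit_def split: if_splits)
  next
    case False
    then have e: "bits (m div 2) @ u = bits (n div 2) @ v" "even m = even n"
      using less.prems by (auto simp: bits.simps[of m] bits.simps[of n] split: if_splits)
    then have "m div 2 = n div 2 \<and> u = v" using less.IH[of "m div 2"] less.prems False by simp
    then show ?thesis using e(2) by (metis dvd_mult_div_cancel odd_two_times_div_two_succ)
  qed
qed

lemma no_bit_word_of: "no_bit (word_of \<phi> @ u)"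
  by (cases \<phi>) (auto simp: no_bit_def)

text \<open>A number ends at the first symbol that is no bit, so splitting off a formula needs
  \<open>no_bit\<close> of the remainder; the word of any formula provides it for what stands
  before.\<close>

lemma word_of_append_inj:
  "word_of \<phi> @ u = word_of \<psi> @ v \<Longrightarrow> no_bit u \<Longrightarrow> no_bit v \<Longrightarrow> \<phi> = \<psi> \<and> u = v"
proof (induction \<phi> arbitrary: \<psi> u v)
  case (Var n)
  then show ?case by (cases \<psi>) (auto dest: bits_append_inj)
next
  case Bot
  then show ?case by (cases \<psi>) auto
next
  case (Imp \<phi>1 \<phi>2)
  from Imp.prems(1) obtain \<psi>1 \<psi>2 where \<psi>: "\<psi> = Imp \<psi>1 \<psi>2" by (cases \<psi>) simp_all
  have "word_of \<phi>1 @ (word_of \<phi>2 @ u) = word_of \<psi>1 @ (word_of \<psi>2 @ v)" using Imp.prems(1) \<psi> by simp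
  then have "\<phi>1 = \<psi>1 \<and> word_of \<phi>2 @ u = word_of \<psi>2 @ v" using Imp.IH(1)[OF _ no_bit_word_of no_bit_word_of] by simp
  then show ?case using Imp.IH(2)[OF _ Imp.prems(2,3)] \<psi> by simp
next
  case (Dia b \<phi>)
  from Dia.prems(1) obtain c \<psi>' where \<psi>: "\<psi> = Dia c \<psi>'" by (cases \<psi>) simp_all
  have "bits b @ (word_of \<phi> @ u) = bits c @ (word_of \<psi>' @ v)" using Dia.prems(1) \<psi> by simp
  then have "b = c \<and> word_of \<phi> @ u = word_of \<psi>' @ v"
    by (rule bits_append_inj[OF _ no_bit_word_of no_bit_word_of])
  then show ?case using Dia.IH[OF _ Dia.prems(2,3)] \<psi> by simp
qed

text \<open>Turns an oracle answer about a word into one about the formula.\<close>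

lemma word_of_inj: "word_of \<phi> = word_of \<psi> \<longleftrightarrow> \<phi> = \<psi>"
  using word_of_append_inj[of \<phi> "[]" \<psi> "[]"] by (auto simp: no_bit_def)

section \<open>Rows\<close>

text \<open>The kind tells what is chosen on the last track of the row: \<open>T\<close>, or \<open>Y\<close>, or \<open>Z\<close>.\<close>

datatype kind = KT | KP | KD

text \<open>A token with one bit for each set of the game. The kind is repeated in every cell, so
  that a sweep learns it from the last one; \<open>fM\<close> marks the modality whose argument is
  being copied.\<close>

datatype rcell = RC (tk: tok) (kd: kind) (fT: bool) (fX: bool) (fY: bool) (fZ: bool) (fM: bool)

primrec rows :: "(nat \<Rightarrow> tok \<Rightarrow> rcell) \<Rightarrow> nat \<Rightarrow> tok list \<Rightarrow> rcell list" where
  "rows F k [] = []"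
| "rows F k (t # ts) = F k t # rows F (Suc k) ts"

lemma rows_append: "rows F k (xs @ ys) = rows F k xs @ rows F (k + length xs) ys"
  by (induction xs arbitrary: k) auto

lemma length_rows [simp]: "length (rows F k ts) = length ts"
  by (induction ts arbitrary: k) auto

definition mkc :: "kind \<Rightarrow> nat set \<Rightarrow> nat set \<Rightarrow> nat set \<Rightarrow> nat set \<Rightarrow> nat \<Rightarrow> tok \<Rightarrow> rcell" where
  "mkc kn T X Y Z k t = RC t kn (k \<in> T) (k \<in> X) (k \<in> Y) (k \<in> Z) False"

lemma mkc_sel [simp]:
  "tk (mkc kn T X Y Z k t) = t" "kd (mkc kn T X Y Z k t) = kn"
  "fT (mkc kn T X Y Z k t) \<longleftrightarrow> k \<in> T" "fX (mkc kn T X Y Z k t) \<longleftrightarrow> k \<in> X"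
  "fY (mkc kn T X Y Z k t) \<longleftrightarrow> k \<in> Y" "fZ (mkc kn T X Y Z k t) \<longleftrightarrow> k \<in> Z"
  "fM (mkc kn T X Y Z k t) \<longleftrightarrow> False"
  by (simp_all add: mkc_def)

definition row :: "tok list \<Rightarrow> kind \<Rightarrow> nat set \<Rightarrow> nat set \<Rightarrow> nat set \<Rightarrow> nat set \<Rightarrow> rcell list" where
  "row ts kn T X Y Z = rows (mkc kn T X Y Z) 0 ts"

text \<open>The block of a modality breaks off after \<open>SVar\<close>: the bit tokens that follow
  in the row complete the index of this variable. So the translated word is the image of the row
  under a map from cells to words.\<close>

definition emit :: "nat \<Rightarrow> nat \<Rightarrow> rcell \<Rightarrow> sym list" where
  "emit s a c = (case tk c of TRoot \<Rightarrow> [] | TVar l \<Rightarrow> [SVar] | TBit b l \<Rightarrow> [if b then S1 else S0]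
     | TBot \<Rightarrow> [SBot] | TImp \<Rightarrow> [SImp]
     | TDia b \<Rightarrow> SImp # (if (b + s = 0 \<and> fT c) \<or> (b + s = Suc a \<and> fZ c) then [SBot] else [SImp, SBot, SBot])
         @ [SDia] @ bits (b + s) @ [SImp, SImp, SBot, SVar])"

abbreviation emits where "emits s a cs \<equiv> concat (map (emit s a) cs)"

fun is_mod :: "tok \<Rightarrow> bool" where
  "is_mod TRoot = True" | "is_mod (TDia b) = True" | "is_mod _ = False"

text \<open>The first \<open>k\<close> Polish terms of a row, found with the counter of
  \<open>ari\<close>. After a modality, with \<open>k\<close> its arity, these are its index and its
  argument.\<close>

fun tf :: "nat \<Rightarrow> rcell list \<Rightarrow> rcell list" where
  "tf 0 cs = []"
| "tf (Suc k) [] = []"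
| "tf (Suc k) (c # cs) = c # tf (k + ar (tk c)) cs"

text \<open>The word of \<open>some_real\<close> in one pass over the row. After \<open>SDia\<close>
  there are no bits, as the universal modality has index 0; the prefix again ends with
  \<open>SVar\<close> so that the bits in the row follow it.\<close>

primrec echain :: "nat \<Rightarrow> nat \<Rightarrow> (rcell \<Rightarrow> bool) \<Rightarrow> rcell list \<Rightarrow> sym list" where
  "echain s a S [] = [SBot]"
| "echain s a S (c # cs) = (if is_mod (tk c) \<and> S c
     then [SImp, SImp, SDia, SImp, SImp, SBot, SVar] @ emits s a (tf (ar (tk c)) cs) @ [SBot] else []) @ echain s a S cs"

section \<open>The words emitted from rows are the words of queries\<close>

lemma tf_append: "ari k (map tk p) \<Longrightarrow> tf k (p @ r) = p"
proof (induction p arbitrary: k)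
  case (Cons c p)
  then show ?case by (cases k) auto
qed simp

lemma map_tk_rows [simp]: "map tk (rows (mkc kn T X Y Z) k ts) = ts"
  by (induction ts arbitrary: k) (auto simp:)

lemma emits_tbits: "emits s a (rows (mkc kn T X Y Z) k (tbits n)) = bits n"
proof (induction n arbitrary: k rule: less_induct)
  case (less n)
  then show ?case
    by (cases "n = 0") (simp_all add: bits.simps[of n] tbits.simps[of n] emit_def)
qed

lemma emits_toks:
  "emits s a (rows (mkc kn T X Y Z) k (toks \<phi>)) = word_of (tr s a T Z k \<phi>)"
  by (induction \<phi> arbitrary: k) (auto simp: emits_tbits rows_append emit_def)

definition entry :: "nat \<Rightarrow> nat \<Rightarrow> nat set \<Rightarrow> nat set \<Rightarrow> nat set \<Rightarrow> nat \<times> nat \<times> fm \<Rightarrow> sym list" where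
  "entry s a T Z S = (\<lambda>(q, b, \<psi>). if q \<in> S then [SImp, SImp, SDia, SImp, SImp, SBot, SVar] @ bits b @
     word_of (tr s a T Z (Suc q + length (bits b)) \<psi>) @ [SBot] else [])"

lemma word_of_some_real:
  "word_of (some_real s a T Z S ps) = concat (map (entry s a T Z S) ps) @ [SBot]"
  by (induction ps) (auto simp: some_real_def entry_def split: prod.splits)

lemma echain_tbits:
  "echain s a P (rows (mkc kn T X Y Z) k (tbits n) @ r) = echain s a P r"
proof (induction n arbitrary: k rule: less_induct)
  case (less n)
  then show ?case by (cases "n = 0") (simp_all add: tbits.simps[of n])
qed

lemma echain_mod:
  assumes "\<And>k t. P (mkc kn T X Y Z k t) \<longleftrightarrow> k \<in> S"
  shows "echain s a P (mkc kn T X Y Z k (TDia b) # rows (mkc kn T X Y Z) (Suc k) (tbits b @ toks \<phi>) @ r) =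
    entry s a T Z S (k, b, \<phi>) @ echain s a P (rows (mkc kn T X Y Z) (Suc k) (tbits b @ toks \<phi>) @ r)"
proof -
  have "ari (if b = 0 then 1 else 2) (tbits b @ toks \<phi>)"
    using ari_toks[of 1 \<phi> "[]"] by (cases "b = 0") (auto simp: ari_tbits)
  then have "tf (if b = 0 then 1 else 2) (rows (mkc kn T X Y Z) (Suc k) (tbits b @ toks \<phi>) @ r) =
     rows (mkc kn T X Y Z) (Suc k) (tbits b @ toks \<phi>)"
    by (intro tf_append) simp
  moreover have tkm: "tk (mkc kn T X Y Z k (TDia b)) = TDia b" by simp
  moreover have "emits s a (rows (mkc kn T X Y Z) (Suc k) (tbits b @ toks \<phi>)) =
     bits b @ word_of (tr s a T Z (Suc k + length (bits b)) \<phi>)"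
    by (simp add: rows_append emits_tbits emits_toks)
  ultimately show ?thesis using assms by (simp add: entry_def)
qed

lemma echain_toks:
  assumes P: "\<And>k t. P (mkc kn T X Y Z k t) \<longleftrightarrow> k \<in> S"
  shows "echain s a P (rows (mkc kn T X Y Z) k (toks \<phi>) @ r) =
    concat (map (entry s a T Z S) (dias_ix k \<phi>)) @ echain s a P r"
proof (induction \<phi> arbitrary: k r)
  case (Var n)
  then show ?case by (simp add: echain_tbits)
next
  case Bot
  then show ?case by simp
next
  case (Imp \<phi> \<psi>)
  have "is_mod (tk (mkc kn T X Y Z k TImp)) = False" by simp
  then show ?case using Imp by (simp add: rows_append)
next
  case (Dia b \<phi>)
  have "echain s a P (rows (mkc kn T X Y Z) k (toks (Dia b \<phi>)) @ r) =
    echain s a P (mkc kn T X Y Z k (TDia b) # rows (mkc kn T X Y Z) (Suc k) (tbits b @ toks \<phi>) @ r)"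
    by simp
  also have "\<dots> = entry s a T Z S (k, b, \<phi>) @ echain s a P (rows (mkc kn T X Y Z) (Suc k) (tbits b @ toks \<phi>) @ r)"
    using echain_mod[OF P] by blast
  finally show ?case using Dia by (simp add: rows_append echain_tbits)
qed

abbreviation selY where "selY \<equiv> fY"
abbreviation selX where "selX \<equiv> (\<lambda>c. \<not> fX c)"

definition qword :: "nat \<Rightarrow> nat \<Rightarrow> rcell list \<Rightarrow> sym list" where
  "qword s a r = [SImp, SImp] @ echain s a selY r @ echain s a selX r @ [SBot]"

lemma echain_row:
  assumes P: "\<And>k t. P (mkc kn T X Y Z k t) \<longleftrightarrow> k \<in> S"
  shows "echain s a P (row (TRoot # toks \<phi>) kn T X Y Z) = word_of (some_real s a T Z S (args_ix \<phi>))"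
proof -
  have "ari 1 (toks \<phi>)" using ari_toks[of 1 \<phi> "[]"] by simp
  then have "tf 1 (rows (mkc kn T X Y Z) 1 (toks \<phi>) @ []) = rows (mkc kn T X Y Z) 1 (toks \<phi>)"
    by (intro tf_append) simp
  then show ?thesis using echain_toks[OF P, where r = "[]" and k = 1] P
    by (simp add: row_def word_of_some_real args_ix_def entry_def emits_toks)
qed

text \<open>Valid for rows of every kind, so the machine can write a query in each round.\<close>

lemma qword_row:
  "qword s a (row (TRoot # toks \<phi>) kn T X Y Z) = word_of (query s a \<phi> T X Y Z)"
proof -
  have "echain s a selY (row (TRoot # toks \<phi>) kn T X Y Z) = word_of (some_real s a T Z Y (args_ix \<phi>))"
    by (rule echain_row) simp
  moreover have "echain s a selX (row (TRoot # toks \<phi>) kn T X Y Z) = word_of (some_real s a T Z (- X) (args_ix \<phi>))"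
    by (rule echain_row) simp
  ultimately show ?thesis by (simp add: qword_def query_def)
qed

text \<open>Ensures that the copying of an argument ends because the counter is back at 0 and not
  because the row is exhausted.\<close>

fun complete :: "rcell list \<Rightarrow> bool" where
  "complete [] = True"
| "complete (c # cs) \<longleftrightarrow> (is_mod (tk c) \<longrightarrow> ari (ar (tk c)) (map tk (tf (ar (tk c)) cs))) \<and> complete cs"

lemma complete_tbits: "complete (rows (mkc kn T X Y Z) k (tbits n) @ r) = complete r"
proof (induction n arbitrary: k rule: less_induct)
  case (less n)
  then show ?case by (cases "n = 0") (simp_all add: tbits.simps[of n])
qed

lemma complete_toks: "complete r \<Longrightarrow> complete (rows (mkc kn T X Y Z) k (toks \<phi>) @ r)"
proof (induction \<phi> arbitrary: k r)
  case (Var n)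
  then show ?case by (simp add: complete_tbits)
next
  case Bot
  then show ?case by simp
next
  case (Imp \<phi> \<psi>)
  have "is_mod (tk (mkc kn T X Y Z k TImp)) = False" by simp
  then show ?case using Imp by (simp add: rows_append)
next
  case (Dia b \<phi>)
  let ?p = "rows (mkc kn T X Y Z) (Suc k) (tbits b @ toks \<phi>)"
  have ar: "ari (if b = 0 then 1 else 2) (tbits b @ toks \<phi>)"
    using ari_toks[of 1 \<phi> "[]"] by (cases "b = 0") (auto simp: ari_tbits)
  then have "tf (if b = 0 then 1 else 2) (?p @ r) = ?p" by (intro tf_append) simp
  moreover have "tk (mkc kn T X Y Z k (TDia b)) = TDia b" by simp
  moreover have "complete (?p @ r)" using Dia by (simp add: rows_append complete_tbits)
  ultimately have "complete (mkc kn T X Y Z k (TDia b) # ?p @ r)" using ar by simp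
  then show ?case by simp
qed

lemma complete_row: "complete (row (TRoot # toks \<phi>) kn T X Y Z)"
proof -
  have a: "ari 1 (toks \<phi>)" using ari_toks[of 1 \<phi> "[]"] by simp
  then have "tf 1 (rows (mkc kn T X Y Z) 1 (toks \<phi>) @ []) = rows (mkc kn T X Y Z) 1 (toks \<phi>)"
    by (intro tf_append) simp
  moreover have "complete (rows (mkc kn T X Y Z) 1 (toks \<phi>))"
    using complete_toks[of "[]"] by simp
  moreover have "tk (mkc kn T X Y Z 0 TRoot) = TRoot" by simp
  ultimately show ?thesis using a by (simp add: row_def)
qed

section \<open>Structured oracle machines\<close>

type_synonym acts = "(sym cell \<times> move) list"
type_synonym tapes = "sym tape list"

datatype com =
    Skip
  | Do "sym cell list \<Rightarrow> acts"
  | Seq com com (infixr ";;" 60)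
  | Cond "sym cell list \<Rightarrow> bool" com com
  | Loop "sym cell list \<Rightarrow> bool" com

abbreviation keep :: "sym cell list \<Rightarrow> acts" where
  "keep cs \<equiv> map (\<lambda>c. (c, Stay)) cs"

primrec cstep :: "com \<Rightarrow> sym cell list \<Rightarrow> com \<times> acts" where
  "cstep Skip cs = (Skip, keep cs)"
| "cstep (Do f) cs = (Skip, f cs)"
| "cstep (c1 ;; c2) cs = (if c1 = Skip then (c2, keep cs) else (fst (cstep c1 cs) ;; c2, snd (cstep c1 cs)))"
| "cstep (Cond b c1 c2) cs = (if b cs then c1 else c2, keep cs)"
| "cstep (Loop b c) cs = (if b cs then c ;; Loop b c else Skip, keep cs)"

text \<open>These commands are the states of the machine of a command.\<close>

primrec residuals :: "com \<Rightarrow> com set" where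
  "residuals Skip = {Skip}"
| "residuals (Do f) = {Do f, Skip}"
| "residuals (c1 ;; c2) = (\<lambda>c. c ;; c2) ` residuals c1 \<union> residuals c2"
| "residuals (Cond b c1 c2) = {Cond b c1 c2} \<union> residuals c1 \<union> residuals c2"
| "residuals (Loop b c) = {Loop b c, Skip} \<union> (\<lambda>d. d ;; Loop b c) ` residuals c"

lemma finite_residuals: "finite (residuals c)" by (induction c) auto

lemma residuals_refl: "c \<in> residuals c" by (induction c) auto

lemma residuals_cstep: "d \<in> residuals c \<Longrightarrow> fst (cstep d cs) \<in> residuals c"
  by (induction c arbitrary: d) (auto simp: residuals_refl split: if_splits)

definition sstep :: "com \<times> tapes \<Rightarrow> com \<times> tapes" where
  "sstep = (\<lambda>(c, ts). (fst (cstep c (map read ts)), map2 act (snd (cstep c (map read ts))) ts))"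

text \<open>\<open>P\<close> is demanded at every configuration passed, as the space bound concerns
  all times.\<close>

inductive reach :: "('x \<Rightarrow> 'x) \<Rightarrow> ('x \<Rightarrow> bool) \<Rightarrow> 'x \<Rightarrow> 'x \<Rightarrow> bool" for f P where
  reach_refl: "P x \<Longrightarrow> reach f P x x"
| reach_step: "P x \<Longrightarrow> reach f P (f x) y \<Longrightarrow> reach f P x y"

lemma reach_trans: "reach f P x y \<Longrightarrow> reach f P y z \<Longrightarrow> reach f P x z"
  by (induction rule: reach.induct) (auto intro: reach.intros)

lemma reach_funpow: "reach f P x y \<Longrightarrow> \<exists>k. (f ^^ k) x = y \<and> (\<forall>j\<le>k. P ((f ^^ j) x))"
proof (induction rule: reach.induct)
  case (reach_refl x)
  then show ?case by (intro exI[of _ 0]) simp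
next
  case (reach_step x y)
  then obtain k where k: "(f ^^ k) (f x) = y" "\<forall>j\<le>k. P ((f ^^ j) (f x))" by blast
  have "P ((f ^^ j) x)" if "j \<le> Suc k" for j
    using that k(2) reach_step(1) by (cases j) (auto simp: funpow_swap1)
  then show ?case using k(1) by (intro exI[of _ "Suc k"]) (auto simp: funpow_swap1)
qed

text \<open>Big-step semantics that demands \<open>ok\<close> of all tapes before and after each
  action, so that one derivation gives both termination and the space bound.\<close>

inductive bs :: "(sym tape \<Rightarrow> bool) \<Rightarrow> com \<Rightarrow> tapes \<Rightarrow> tapes \<Rightarrow> bool" for ok where
  bs_Skip: "list_all ok ts \<Longrightarrow> bs ok Skip ts ts"
| bs_Do: "list_all ok ts \<Longrightarrow> length (f (map read ts)) = length ts \<Longrightarrow> ts' = map2 act (f (map read ts)) ts \<Longrightarrow>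
    list_all ok ts' \<Longrightarrow> bs ok (Do f) ts ts'"
| bs_Seq: "bs ok c1 ts ts1 \<Longrightarrow> bs ok c2 ts1 ts2 \<Longrightarrow> bs ok (c1 ;; c2) ts ts2"
| bs_Cond: "list_all ok ts \<Longrightarrow> bs ok (if b (map read ts) then c1 else c2) ts ts' \<Longrightarrow> bs ok (Cond b c1 c2) ts ts'"
| bs_Loop_end: "list_all ok ts \<Longrightarrow> \<not> b (map read ts) \<Longrightarrow> bs ok (Loop b c) ts ts"
| bs_Loop: "b (map read ts) \<Longrightarrow> bs ok c ts ts1 \<Longrightarrow> bs ok (Loop b c) ts1 ts2 \<Longrightarrow> bs ok (Loop b c) ts ts2"

definition good :: "(sym tape \<Rightarrow> bool) \<Rightarrow> com \<times> tapes \<Rightarrow> bool" where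
  "good ok = (\<lambda>(c, ts). list_all ok ts \<and> length (snd (cstep c (map read ts))) = length ts)"

definition okc :: "(sym tape \<Rightarrow> bool) \<Rightarrow> 'q \<times> tapes \<Rightarrow> bool" where
  "okc ok x \<longleftrightarrow> list_all ok (snd x)"

lemma okc_pair [simp]: "okc ok (q, ts) \<longleftrightarrow> list_all ok ts"
  by (simp add: okc_def)

lemma good_pair: "good ok (c, ts) \<longleftrightarrow> list_all ok ts \<and> length (snd (cstep c (map read ts))) = length ts"
  and sstep_pair: "sstep (c, ts) = (fst (cstep c (map read ts)), map2 act (snd (cstep c (map read ts))) ts)"
  by (simp_all add: good_def sstep_def)

lemma act_keep [simp]: "map2 act (keep (map read ts)) ts = ts"
proof (induction ts)
  case (Cons t ts)
  then show ?case by (cases t) simp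
qed simp

lemma act_keep_comp [simp]:
  "map2 act (map ((\<lambda>c. (c, Stay)) \<circ> read) ts) ts = (ts :: tapes)"
  using act_keep[of ts] by simp

lemma reach_Seq:
  assumes "reach sstep (good ok) (c1, ts) (Skip, ts1)"
  shows "reach sstep (good ok) (c1 ;; c2, ts) (Skip ;; c2, ts1)"
proof -
  have "reach sstep (good ok) x y \<Longrightarrow> fst y = Skip \<Longrightarrow>
     reach sstep (good ok) (fst x ;; c2, snd x) (Skip ;; c2, snd y)" for x y
  proof (induction rule: reach.induct)
    case (reach_refl x)
    then obtain ts where "x = (Skip, ts)" by (cases x) simp
    then show ?case using reach_refl by (auto intro!: reach.reach_refl simp: good_pair)
  next
    case (reach_step x y)
    obtain c ts where x: "x = (c, ts)" by (cases x)
    show ?case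
    proof (cases "c = Skip")
      case True
      \<comment> \<open>A finished component would idle, while the sequence passes on to
        \<open>c2\<close>; such idle steps are skipped.\<close>
      then have "sstep x = x" by (simp add: sstep_pair x)
      then show ?thesis using reach_step by simp
    next
      case False
      have "good ok (c ;; c2, ts)" using reach_step(1) False by (simp add: good_pair x)
      moreover have "sstep (c ;; c2, ts) = (fst (sstep x) ;; c2, snd (sstep x))"
        using False by (simp add: sstep_pair x)
      ultimately show ?thesis using reach_step x by (auto intro: reach.reach_step)
    qed
  qed
  from this[OF assms] show ?thesis by simp
qed

lemma bs_ok: "bs ok c ts ts' \<Longrightarrow> list_all ok ts \<and> list_all ok ts' \<and> length ts' = length ts"
  by (induction rule: bs.induct) auto

lemma bs_reach: "bs ok c ts ts' \<Longrightarrow> reach sstep (good ok) (c, ts) (Skip, ts')"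
proof (induction rule: bs.induct)
  case (bs_Skip ts)
  then show ?case by (intro reach_refl) (simp add: good_def)
next
  case (bs_Do ts f ts')
  then show ?case by (intro reach_step[of _ "(Do f, ts)"]) (auto simp: good_pair sstep_pair intro!: reach_refl)
next
  case (bs_Seq c1 ts ts1 c2 ts2)
  have "reach sstep (good ok) (Skip ;; c2, ts1) (Skip, ts2)"
    using bs_Seq bs_ok[OF bs_Seq(1)] by (intro reach_step[of _ "(Skip ;; c2, ts1)"]) (auto simp: good_pair sstep_pair)
  then show ?case by (rule reach_trans[OF reach_Seq[OF bs_Seq(3)]])
next
  case (bs_Cond ts b c1 c2 ts')
  then show ?case by (intro reach_step[of _ "(Cond b c1 c2, ts)"]) (auto simp: good_pair sstep_pair)
next
  case (bs_Loop_end ts b c)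
  then show ?case by (intro reach_step[of _ "(Loop b c, ts)"]) (auto simp: good_pair sstep_pair intro!: reach_refl)
next
  case (bs_Loop b ts c ts1 ts2)
  have ok: "list_all ok ts" "list_all ok ts1" using bs_ok[OF bs_Loop(2)] by auto
  have "reach sstep (good ok) (Skip ;; Loop b c, ts1) (Skip, ts2)"
    using bs_Loop ok by (intro reach_step[of _ "(Skip ;; Loop b c, ts1)"]) (auto simp: good_pair sstep_pair)
  then have "reach sstep (good ok) (c ;; Loop b c, ts) (Skip, ts2)"
    by (rule reach_trans[OF reach_Seq[OF bs_Loop(4)]])
  then show ?case using bs_Loop(1) ok by (intro reach_step[of _ "(Loop b c, ts)"]) (auto simp: good_pair sstep_pair)
qed

subsection \<open>Compilation\<close>

definition symb :: "nat \<Rightarrow> sym cell set" where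
  "symb NA = {Blank} \<union> range Inp \<union> Aux ` {..<NA}"

definition enc :: "com \<Rightarrow> com \<Rightarrow> nat" where
  "enc c = (SOME e. bij_betw e (residuals c) {0..<card (residuals c)})"

lemma enc: "bij_betw (enc c) (residuals c) {0..<card (residuals c)}"
  using someI_ex[OF ex_bij_betw_finite_nat[OF finite_residuals]] unfolding enc_def .

text \<open>The table of a machine must be well formed for all combinations of symbols, also for
  those that no run meets; there a malformed action list is replaced by doing nothing.\<close>

definition sanitize :: "nat \<Rightarrow> sym cell list \<Rightarrow> acts \<Rightarrow> acts" where
  "sanitize NA cs ac = (if length ac = length cs \<and> fst ` set ac \<subseteq> symb NA then ac else keep cs)"

text \<open>The command is run again and again: when it is finished, \<open>tst\<close> chooses
  between halting and a query, and \<open>ans\<close> passes the answer on to the tapes before the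
  next round.\<close>

definition mach :: "nat \<Rightarrow> nat \<Rightarrow> com \<Rightarrow> (bool \<Rightarrow> sym cell list \<Rightarrow> acts) \<Rightarrow> (sym cell list \<Rightarrow> bool option) \<Rightarrow> sym otm" where
  "mach nt NA c ans tst = \<lparr>n_tapes = nt, n_aux = NA, n_states = card (residuals c),
     delta = (\<lambda>q cs. case q of
         Start \<Rightarrow> (Internal (enc c c), keep cs)
       | Yes \<Rightarrow> (Internal (enc c c), sanitize NA cs (ans True cs))
       | No \<Rightarrow> (Internal (enc c c), sanitize NA cs (ans False cs))
       | Internal k \<Rightarrow> (let d = inv_into (residuals c) (enc c) k in
           if d = Skip then (case tst cs of Some b \<Rightarrow> (if b then Accept else Reject) | None \<Rightarrow> Query, keep cs)
           else (Internal (enc c (fst (cstep d cs))), sanitize NA cs (snd (cstep d cs))))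
       | _ \<Rightarrow> (Reject, keep cs))\<rparr>"

lemma delta_mach:
  "delta (mach nt NA c ans tst) Start cs = (Internal (enc c c), keep cs)"
  "delta (mach nt NA c ans tst) Yes cs = (Internal (enc c c), sanitize NA cs (ans True cs))"
  "delta (mach nt NA c ans tst) No cs = (Internal (enc c c), sanitize NA cs (ans False cs))"
  "delta (mach nt NA c ans tst) Query cs = (Reject, keep cs)"
  "delta (mach nt NA c ans tst) Accept cs = (Reject, keep cs)"
  "delta (mach nt NA c ans tst) Reject cs = (Reject, keep cs)"
  "delta (mach nt NA c ans tst) (Internal k) cs = (let d = inv_into (residuals c) (enc c) k in
     if d = Skip then (case tst cs of Some b \<Rightarrow> (if b then Accept else Reject) | None \<Rightarrow> Query, keep cs)
     else (Internal (enc c (fst (cstep d cs))), sanitize NA cs (snd (cstep d cs))))"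
  by (simp_all add: mach_def)

lemma sanitize: "set cs \<subseteq> symb NA \<Longrightarrow>
    length (sanitize NA cs ac) = length cs \<and> fst ` set (sanitize NA cs ac) \<subseteq> symb NA"
  by (auto simp: sanitize_def)

lemma enc_less: "d \<in> residuals c \<Longrightarrow> enc c d < card (residuals c)"
  using bij_betwE[OF enc] by fastforce

lemma is_otm_mach:
  assumes "nt \<ge> 2"
  shows "is_otm (mach nt NA c ans tst)"
proof -
  let ?M = "mach nt NA c ans tst"
  have S: "symbols ?M = symb NA" by (simp add: symbols_def symb_def mach_def)
  have Q: "states ?M = {Start, Accept, Reject, Query, Yes, No} \<union> Internal ` {..<card (residuals c)}"
    by (simp add: states_def mach_def)
  have nt: "n_tapes ?M = nt" by (simp add: mach_def)
  show ?thesis unfolding is_otm_def S nt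
  proof (intro conjI ballI allI impI)
    fix q cs assume q: "q \<in> states ?M" and cs: "length cs = nt \<and> set cs \<subseteq> symb NA"
    have k: "length (keep cs) = nt \<and> fst ` set (keep cs) \<subseteq> symb NA" using cs by auto
    have cc: "Internal (enc c c) \<in> states ?M" using enc_less residuals_refl by (auto simp: Q)
    have s: "length (sanitize NA cs ac) = nt \<and> fst ` set (sanitize NA cs ac) \<subseteq> symb NA" for ac
      using sanitize cs by auto
    show "case delta ?M q cs of (q', acts) \<Rightarrow>
        q' \<in> states ?M \<and> length acts = nt \<and> fst ` set acts \<subseteq> symb NA"
    proof (cases q)
      case (Internal i)
      then have "i \<in> {0..<card (residuals c)}" using q by (auto simp: Q)
      then have d: "inv_into (residuals c) (enc c) i \<in> residuals c"
        using bij_betwE[OF bij_betw_inv_into[OF enc]] by blast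
      have "Internal (enc c (fst (cstep (inv_into (residuals c) (enc c) i) cs))) \<in> states ?M"
        using enc_less[OF residuals_cstep[OF d]] by (auto simp: Q)
      moreover have "{Accept, Reject, Query} \<subseteq> states ?M" by (simp add: Q)
      ultimately show ?thesis using Internal k s by (auto simp: delta_mach Let_def split: option.splits)
    next
      case Query
      then show ?thesis using k by (simp add: delta_mach) (simp add: Q)
    next
      case Accept
      then show ?thesis using k by (simp add: delta_mach) (simp add: Q)
    next
      case Reject
      then show ?thesis using k by (simp add: delta_mach) (simp add: Q)
    qed (use k s cc in \<open>auto simp: delta_mach\<close>)
  qed (use assms in auto)
qed

inductive mrun :: "(sym tape \<Rightarrow> bool) \<Rightarrow> com \<Rightarrow> (bool \<Rightarrow> sym cell list \<Rightarrow> acts) \<Rightarrow>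
    (sym cell list \<Rightarrow> bool option) \<Rightarrow> sym list set \<Rightarrow> tapes \<Rightarrow> bool \<Rightarrow> bool" for ok c ans tst Q where
  mrun_halt: "bs ok c ts ts1 \<Longrightarrow> tst (map read ts1) = Some b \<Longrightarrow> mrun ok c ans tst Q ts b"
| mrun_ask: "bs ok c ts ts1 \<Longrightarrow> tst (map read ts1) = None \<Longrightarrow>
    length (ans (query_word (ts1 ! 1) \<in> Q) (map read ts1)) = length ts1 \<Longrightarrow>
    ts2 = map2 act (ans (query_word (ts1 ! 1) \<in> Q) (map read ts1)) ts1 \<Longrightarrow>
    list_all ok ts2 \<Longrightarrow> mrun ok c ans tst Q ts2 b \<Longrightarrow> mrun ok c ans tst Q ts b"

text \<open>A symbol just written occurs on the resulting tape, whose symbols all belong to the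
  alphabet.\<close>

lemma sanitize_ok:
  assumes "length ac = length ts" "list_all ok (map2 act ac ts)" "\<And>t. ok t \<Longrightarrow> range (fst t) \<subseteq> symb NA"
  shows "sanitize NA (map read ts) ac = ac"
proof -
  have "fst p \<in> symb NA" if p: "p \<in> set ac" for p
  proof -
    from p obtain i where i: "i < length ac" "ac ! i = p" unfolding in_set_conv_nth by auto
    then have "ok (act p (ts ! i))" using assms(1,2) by (auto simp: list_all_length)
    then have "range (fst (act p (ts ! i))) \<subseteq> symb NA" using assms(3) by blast
    moreover have "fst p \<in> range (fst (act p (ts ! i)))"
      by (cases p; cases "ts ! i") (auto intro: range_eqI[of _ _ "snd (ts ! i)"])
    ultimately show ?thesis by blast
  qed
  then show ?thesis using assms(1) by (auto simp: sanitize_def)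
qed

lemma reach_mach:
  fixes Q nt NA c ans tst
  defines "M \<equiv> mach nt NA c ans tst"
  assumes ok: "\<And>t. ok t \<Longrightarrow> range (fst t) \<subseteq> symb NA"
    and r: "reach sstep (good ok) (d, ts) (Skip, ts')" and d: "d \<in> residuals c"
  shows "reach (step Q M) (okc ok) (Internal (enc c d), ts) (Internal (enc c Skip), ts')"
proof -
  have "reach sstep (good ok) x y \<Longrightarrow> fst y = Skip \<Longrightarrow> fst x \<in> residuals c \<Longrightarrow>
     reach (step Q M) (okc ok) (Internal (enc c (fst x)), snd x) (Internal (enc c Skip), snd y)" for x y
  proof (induction rule: reach.induct)
    case (reach_refl x)
    then show ?case by (cases x) (auto simp: good_def intro: reach.reach_refl)
  next
    case (reach_step x y)
    obtain d ts where x: "x = (d, ts)" by (cases x)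
    show ?case
    proof (cases "d = Skip")
      case True
      then have "sstep x = x" by (simp add: sstep_pair x)
      then show ?thesis using reach_step by simp
    next
      case False
      have inv: "inv_into (residuals c) (enc c) (enc c d) = d"
        using enc reach_step.prems x by (auto simp: bij_betw_def)
      have g: "list_all ok ts" "length (snd (cstep d (map read ts))) = length ts"
        using reach_step(1) by (auto simp: good_pair x)
      have "good ok (sstep x)" using reach_step(2) by (cases rule: reach.cases) auto
      then have "list_all ok (map2 act (snd (cstep d (map read ts))) ts)"
        by (auto simp: good_pair sstep_pair x)
      then have "step Q M (Internal (enc c d), ts) = (Internal (enc c (fst (sstep x))), snd (sstep x))"
        using False sanitize_ok[OF g(2)] ok by (simp add: step_def M_def delta_mach Let_def inv sstep_pair x)
      moreover have "reach (step Q M) (okc ok) (Internal (enc c (fst (sstep x))), snd (sstep x))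
          (Internal (enc c Skip), snd y)"
        using reach_step residuals_cstep by (auto simp: sstep_pair x)
      moreover have "okc ok (Internal (enc c d), ts)" using g(1) by simp
      ultimately show ?thesis unfolding x fst_conv snd_conv
        using reach.reach_step[of "okc ok" "(Internal (enc c d), ts)" "step Q M"] by simp
    qed
  qed
  from this[OF r] d show ?thesis by simp
qed

lemma reach_Skip_in: "reach sstep P x y \<Longrightarrow> fst x \<in> residuals c \<Longrightarrow> fst y \<in> residuals c"
  by (induction rule: reach.induct) (auto simp: sstep_def residuals_cstep split: prod.splits)

lemma mrun_reach:
  fixes Q nt NA c ans tst
  defines "M \<equiv> mach nt NA c ans tst"
  assumes ok: "\<And>t. ok t \<Longrightarrow> range (fst t) \<subseteq> symb NA"
  shows "mrun ok c ans tst Q ts b \<Longrightarrow> \<exists>ts'. reach (step Q M) (okc ok) (Internal (enc c c), ts)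
    (if b then Accept else Reject, ts')"
proof (induction rule: mrun.induct)
  case (mrun_halt ts ts1 b)
  have r: "reach (step Q M) (okc ok) (Internal (enc c c), ts) (Internal (enc c Skip), ts1)"
    unfolding M_def by (rule reach_mach[OF ok bs_reach[OF mrun_halt(1)] residuals_refl])
  have "Skip \<in> residuals c" using reach_Skip_in[OF bs_reach[OF mrun_halt(1)]] residuals_refl by simp
  then have inv: "inv_into (residuals c) (enc c) (enc c Skip) = Skip" using enc by (auto simp: bij_betw_def)
  have "step Q M (Internal (enc c Skip), ts1) = (if b then Accept else Reject, ts1)"
    using mrun_halt(2) by (simp add: step_def M_def delta_mach Let_def inv)
  then have "reach (step Q M) (okc ok) (Internal (enc c Skip), ts1) (if b then Accept else Reject, ts1)"
    using bs_ok[OF mrun_halt(1)] by (intro reach_step[of _ "(Internal (enc c Skip), ts1)"]) (auto intro!: reach_refl)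
  then show ?case using reach_trans[OF r] by blast
next
  case (mrun_ask ts ts1 ts2 b)
  have r: "reach (step Q M) (okc ok) (Internal (enc c c), ts) (Internal (enc c Skip), ts1)"
    unfolding M_def by (rule reach_mach[OF ok bs_reach[OF mrun_ask(1)] residuals_refl])
  have "Skip \<in> residuals c" using reach_Skip_in[OF bs_reach[OF mrun_ask(1)]] residuals_refl by simp
  then have inv: "inv_into (residuals c) (enc c) (enc c Skip) = Skip" using enc by (auto simp: bij_betw_def)
  let ?q = "if query_word (ts1 ! 1) \<in> Q then Yes else No"
  have 1: "step Q M (Internal (enc c Skip), ts1) = (Query, ts1)"
    using mrun_ask(2) by (simp add: step_def M_def delta_mach Let_def inv)
  have 2: "step Q M (Query, ts1) = (?q, ts1)" by (simp add: step_def)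
  have 3: "step Q M (?q, ts1) = (Internal (enc c c), ts2)"
    using sanitize_ok[OF mrun_ask(3), of ok NA] mrun_ask(4,5) ok
    by (auto simp: step_def M_def delta_mach)
  obtain ts' where "reach (step Q M) (okc ok) (Internal (enc c c), ts2) (if b then Accept else Reject, ts')"
    using mrun_ask.IH by blast
  then have "reach (step Q M) (okc ok) (?q, ts1) (if b then Accept else Reject, ts')"
    using bs_ok[OF mrun_ask(1)] 3 by (intro reach_step[of _ "(?q, ts1)"]) auto
  then have "reach (step Q M) (okc ok) (Query, ts1) (if b then Accept else Reject, ts')"
    using bs_ok[OF mrun_ask(1)] 2 by (intro reach_step[of _ "(Query, ts1)"]) auto
  then have "reach (step Q M) (okc ok) (Internal (enc c Skip), ts1) (if b then Accept else Reject, ts')"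
    using bs_ok[OF mrun_ask(1)] 1 by (intro reach_step[of _ "(Internal (enc c Skip), ts1)"]) auto
  then show ?case using reach_trans[OF r] by blast
qed

text \<open>Besides bounding the head it confines the contents to the alphabet, so that along a run
  \<open>sanitize\<close> is the identity.\<close>

definition okt :: "nat \<Rightarrow> nat \<Rightarrow> sym tape \<Rightarrow> bool" where
  "okt NA B t \<longleftrightarrow> snd t < B \<and> range (fst t) \<subseteq> symb NA"

theorem pspace_reducibleI:
  fixes P Q :: "sym list set" and p :: "nat poly"
  assumes nt: "nt \<ge> 2" and run: "\<And>w. mrun (okt NA (poly p (length w))) c ans tst Q
     (((\<lambda>i. if i < length w then Inp (w ! i) else Blank), 0) # replicate (nt - 1) (\<lambda>_. Blank, 0)) (w \<in> P)"
  shows "P \<le>\<^sub>T\<^sub>P\<^sub>S\<^sub>P\<^sub>A\<^sub>C\<^sub>E Q"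
  unfolding pspace_turing_reducible_def
proof (rule exI[of _ "mach nt NA c ans tst"], rule exI[of _ p], intro conjI allI)
  let ?M = "mach nt NA c ans tst"
  show "is_otm ?M" by (rule is_otm_mach[OF nt])
  fix w :: "sym list"
  let ?ok = "okt NA (poly p (length w))"
  let ?ts = "((\<lambda>i. if i < length w then Inp (w ! i) else Blank), 0) # replicate (nt - 1) (\<lambda>_. Blank, 0)"
  have i: "init ?M w = (Start, ?ts)" by (simp add: init_def mach_def)
  obtain ts' where r: "reach (step Q ?M) (okc ?ok) (Internal (enc c c), ?ts)
    (if w \<in> P then Accept else Reject, ts')"
    using mrun_reach[of ?ok NA, OF _ run[of w], of nt] by (auto simp: okt_def)
  have okts: "list_all ?ok ?ts" using run[of w] by (cases rule: mrun.cases) (auto dest: bs_ok)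
  have s: "step Q ?M (Start, ?ts) = (Internal (enc c c), ?ts)"
    using act_keep[of ?ts] by (simp add: step_def delta_mach del: act_keep)
  have "reach (step Q ?M) (okc ?ok) (Start, ?ts) (if w \<in> P then Accept else Reject, ts')"
    by (rule reach_step) (use okts s r in auto)
  from reach_funpow[OF this] obtain k where
    k: "(step Q ?M ^^ k) (init ?M w) = (if w \<in> P then Accept else Reject, ts')"
    "\<forall>j\<le>k. list_all ?ok (snd ((step Q ?M ^^ j) (init ?M w)))" by (auto simp: i okc_def)
  show "\<exists>t. fst (run Q ?M w t) = (if w \<in> P then Accept else Reject)"
    using k(1) by (intro exI[of _ k]) (auto simp: run_def)
  \<comment> \<open>Halting configurations are fixed points, so a bound up to the time of halting is
    a bound for all times.\<close>
  have stay: "(step Q ?M ^^ (k + j)) (init ?M w) = (step Q ?M ^^ k) (init ?M w)" for j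
  proof (induction j)
    case (Suc j)
    then show ?case using k(1) by (simp add: step_def)
  qed simp
  fix t
  have "list_all ?ok (snd (run Q ?M w t))"
  proof (cases "t \<le> k")
    case False
    then show ?thesis using stay[of "t - k"] k(2) by (simp add: run_def)
  qed (use k(2) in \<open>simp add: run_def\<close>)
  then show "\<forall>(f, h)\<in>set (snd (run Q ?M w t)). h < poly p (length w)"
    by (auto simp: list_all_iff okt_def okc_def)
qed

section \<open>Tapes\<close>

definition cont :: "sym cell list \<Rightarrow> nat \<Rightarrow> sym cell" where
  "cont xs = (\<lambda>i. if i < length xs then xs ! i else Blank)"

text \<open>The cells left of the head, nearest first, and the cells from the head on.\<close>

definition tp :: "sym cell list \<Rightarrow> sym cell list \<Rightarrow> sym tape" where
  "tp l r = (cont (rev l @ r), length l)"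

lemma cont_Blank: "cont (xs @ [Blank]) = cont xs"
  by (auto simp: cont_def nth_append fun_eq_iff)

lemma cont_upd: "(cont (xs @ x # ys))(length xs := y) = cont (xs @ y # ys)"
  and cont_upd_end: "(cont xs)(length xs := y) = cont (xs @ [y])"
  by (auto simp: cont_def nth_append nth_Cons fun_eq_iff split: nat.splits)

lemma range_cont: "range (cont xs) = insert Blank (set xs)"
proof
  show "range (cont xs) \<subseteq> insert Blank (set xs)" by (auto simp: cont_def)
  have "Blank = cont xs (length xs)" by (simp add: cont_def)
  moreover have "x \<in> range (cont xs)" if "x \<in> set xs" for x
    using that unfolding in_set_conv_nth by (auto simp: cont_def intro!: range_eqI)
  ultimately show "insert Blank (set xs) \<subseteq> range (cont xs)" by auto
qed

lemma tp_Blank [simp]: "tp l [Blank] = tp l []" "tp l [x, Blank] = tp l [x]"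
  using cont_Blank[of "rev l"] cont_Blank[of "rev l @ [x]"] by (simp_all add: tp_def)

lemma read_tp [simp]: "read (tp l []) = Blank" "read (tp l (x # r)) = x"
  by (simp_all add: tp_def cont_def nth_append)

lemma act_tp [simp]:
  "act (y, Go_Right) (tp l (x # r)) = tp (y # l) r"
  "act (y, Go_Right) (tp l []) = tp (y # l) []"
  "act (y, Stay) (tp l (x # r)) = tp l (y # r)"
  "act (y, Stay) (tp l []) = tp l [y]"
  "act (y, Go_Left) (tp (z # l) (x # r)) = tp l (z # y # r)"
  "act (y, Go_Left) (tp (z # l) []) = tp l [z, y]"
  "act (y, Go_Left) (tp [] (x # r)) = tp [] (y # r)"
  "act (y, Go_Left) (tp [] []) = tp [] [y]"
  using cont_upd[of "rev l" x r y] cont_upd_end[of "rev l" y] cont_upd[of "rev (z # l)" x r y]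
    cont_upd_end[of "rev (z # l)" y] cont_upd[of "[]" x r y] cont_upd_end[of "[]" y]
  by (simp_all add: tp_def)

lemma act_read [simp]: "act (read t, Stay) t = t"
  by (cases t) simp

lemma Blank_symb [simp]: "Blank \<in> symb NA" and Inp_symb [simp]: "Inp x \<in> symb NA"
  and Aux_symb [simp]: "Aux k \<in> symb NA \<longleftrightarrow> k < NA"
  by (auto simp: symb_def)

lemma okt_tp: "okt NA B (tp l r) \<longleftrightarrow> length l < B \<and> set l \<subseteq> symb NA \<and> set r \<subseteq> symb NA"
  by (auto simp: okt_def tp_def range_cont)

subsection \<open>Encodings\<close>

instance tok :: countable by countable_datatype
instance kind :: countable by countable_datatype
instance rcell :: countable by countable_datatype

datatype mode = Try | Push | Next | Lose | PopL | PopN | Acc | Rej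
instance mode :: countable by countable_datatype

text \<open>The register holds the state of the tokenization, or the mode of the search with the kind
  of the last cell read, the last answer of the oracle and two Booleans that are
  accumulated in a sweep.\<close>

datatype reg = RV "nat option" | RG (md: mode) (rk: kind) (rans: bool) (rb1: bool) (rb2: bool)
instance reg :: countable by countable_datatype

text \<open>Row cells and registers become single tape symbols through their codes; by
  \<open>finite_codes\<close> finitely many codes are in use.\<close>

definition rw :: "rcell \<Rightarrow> sym cell" where "rw c = Aux (to_nat c)"
definition dr :: "sym cell \<Rightarrow> rcell" where "dr x = (case x of Aux k \<Rightarrow> from_nat k | _ \<Rightarrow> undefined)"
definition rg :: "reg \<Rightarrow> sym cell" where "rg g = Aux (to_nat g)"
definition dg :: "sym cell \<Rightarrow> reg" where "dg x = (case x of Aux k \<Rightarrow> from_nat k | _ \<Rightarrow> undefined)"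

lemma dr_rw [simp]: "dr (rw c) = c" and rw_Blank [simp]: "rw c \<noteq> Blank" "Blank \<noteq> rw c"
  and dg_rg [simp]: "dg (rg g) = g" and rg_Blank [simp]: "rg g \<noteq> Blank" "Blank \<noteq> rg g"
  by (simp_all add: dr_def rw_def dg_def rg_def)

text \<open>On the row tape the head moves left to read the row forward. In \<open>rowt u v\<close>
  the cells \<open>u\<close>, the first of which is scanned, are still to be read and \<open>v\<close>, in reverse order,
  have been read; \<open>bk u v\<close> is the state of a backward sweep that has passed \<open>u\<close>;
  \<open>hm u\<close> is the state between two sweeps.\<close>

definition rowt :: "rcell list \<Rightarrow> rcell list \<Rightarrow> sym tape" where
  "rowt u v = (case u of [] \<Rightarrow> tp [] (Blank # map rw v)
     | c # u' \<Rightarrow> tp (map rw u' @ [Blank]) (rw c # map rw v))"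

definition hm :: "rcell list \<Rightarrow> sym tape" where "hm u = tp (map rw u @ [Blank]) []"

definition bk :: "rcell list \<Rightarrow> rcell list \<Rightarrow> sym tape" where
  "bk u v = (case v of [] \<Rightarrow> hm u | d # v' \<Rightarrow> rowt (d # u) v')"

lemma bk_simps [simp]: "bk u [] = hm u" "bk u (d # v) = rowt (d # u) v"
  by (simp_all add: bk_def)

lemma read_rowt [simp]: "read (rowt [] v) = Blank" "read (rowt (c # u) v) = rw c" "read (hm u) = Blank"
  by (simp_all add: rowt_def hm_def)

lemma act_hm [simp]: "act (Blank, Go_Left) (hm u) = rowt u []" "act (Blank, Stay) (hm u) = hm u"
  by (cases u; simp add: rowt_def hm_def)+

lemma act_rowt [simp]:
  "act (rw d, Go_Left) (rowt (c # u) v) = rowt u (d # v)"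
  "act (rw d, Stay) (rowt (c # u) v) = rowt (d # u) v"
  "act (Blank, Stay) (rowt [] v) = rowt [] v"
  "act (rw d, Go_Right) (rowt (c # u) v) = bk (d # u) v"
  "act (Blank, Go_Right) (rowt [] v) = bk [] v"
  by (cases u; cases v; simp add: rowt_def hm_def bk_def)+

definition orc :: "sym list \<Rightarrow> sym tape" where "orc w = tp (rev (map Inp w)) []"

lemma read_orc [simp]: "read (orc w) = Blank" by (simp add: orc_def)

lemma act_orc [simp]: "act (Inp x, Go_Right) (orc w) = orc (w @ [x])" "act (Blank, Stay) (orc w) = orc w"
  by (simp_all add: orc_def)

text \<open>Everything behind the word is blank here; this is why \<open>clear\<close> erases the
  preceding query before a new one is written.\<close>

lemma query_word_orc [simp]: "query_word (orc w) = w"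
proof -
  have f: "fst (orc w) = cont (map Inp w)" by (simp add: orc_def tp_def)
  have "(LEAST n. \<not> is_Inp (cont (map Inp w) n)) = length w"
  proof (rule Least_equality)
    show "\<not> is_Inp (cont (map Inp w) (length w))" by (simp add: cont_def)
    fix y assume "\<not> is_Inp (cont (map Inp w) y)"
    then show "length w \<le> y" by (auto simp: cont_def intro: leI)
  qed
  then show ?thesis unfolding query_word_def f
    by (intro nth_equalityI) (simp_all add: cont_def)
qed

text \<open>A counter is the position of the head on a tape whose cell 0 is marked.\<close>

definition ct :: "nat \<Rightarrow> sym tape" where "ct k = (\<lambda>i. if i = 0 then Aux 0 else Blank, k)"

lemma read_ct [simp]: "read (ct k) = (if k = 0 then Aux 0 else Blank)"
  by (simp add: ct_def)

lemma act_ct: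
  "x = read (ct k) \<Longrightarrow> act (x, m) (ct k) = ct (case m of Go_Left \<Rightarrow> k - 1 | Stay \<Rightarrow> k | Go_Right \<Rightarrow> k + 1)"
  by (auto simp: ct_def fun_eq_iff)

lemma act_ct_simps [simp]:
  "act (Aux 0, Stay) (ct 0) = ct 0" "act (Aux 0, Go_Right) (ct 0) = ct 1"
  "act (Blank, Stay) (ct (Suc k)) = ct (Suc k)" "act (Blank, Go_Right) (ct (Suc k)) = ct (Suc (Suc k))"
  "act (Blank, Go_Left) (ct (Suc k)) = ct k"
  using act_ct[of "Aux 0" 0] act_ct[of Blank "Suc k"]
  by simp_all

definition rgt :: "reg \<Rightarrow> sym tape" where "rgt g = tp [] [rg g]"

lemma read_rgt [simp]: "read (rgt g) = rg g" and act_rgt [simp]: "act (rg h, Stay) (rgt g) = rgt h"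
  by (simp_all add: rgt_def)

lemma okt_simps:
  "okt NA B (orc w) \<longleftrightarrow> length w < B"
  "okt NA B (rowt u v) \<longleftrightarrow> length u < B \<and> (\<forall>c\<in>set u \<union> set v. to_nat c < NA)"
  "okt NA B (hm u) \<longleftrightarrow> Suc (length u) < B \<and> (\<forall>c\<in>set u. to_nat c < NA)"
  "okt NA B (rgt g) \<longleftrightarrow> 0 < B \<and> to_nat g < NA"
  "0 < NA \<Longrightarrow> okt NA B (ct k) \<longleftrightarrow> k < B"
proof -
  show "0 < NA \<Longrightarrow> okt NA B (ct k) \<longleftrightarrow> k < B" by (auto simp: okt_def ct_def)
qed (auto simp: orc_def rowt_def hm_def rgt_def rg_def rw_def okt_tp split: list.splits)

section \<open>Program fragments\<close>

definition L6 :: "(sym cell \<Rightarrow> sym cell \<Rightarrow> sym cell \<Rightarrow> sym cell \<Rightarrow> sym cell \<Rightarrow> sym cell \<Rightarrow> 'x) \<Rightarrow>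
    sym cell list \<Rightarrow> 'x" where
  "L6 f cs = f (cs ! 0) (cs ! 1) (cs ! 2) (cs ! 3) (cs ! 4) (cs ! 5)"

lemma L6_simp [simp]: "L6 f [a, b, c, d, e, g] = f a b c d e g"
  by (simp add: L6_def)

text \<open>The six tapes are the input, oracle, row, stack, counter and register tapes; they are
  named \<open>i\<close>, \<open>q\<close>, \<open>r\<close>, \<open>s\<close>, \<open>n\<close>, \<open>g\<close> throughout.\<close>

abbreviation Do5 where
  "Do5 f \<equiv> Do (L6 (\<lambda>i q r s n g. (i, Stay) # f q r s n g))"

lemma bs_DoI:
  "list_all ok ts \<Longrightarrow> f (map read ts) = acs \<Longrightarrow> length acs = length ts \<Longrightarrow> map2 act acs ts = ts' \<Longrightarrow>
    list_all ok ts' \<Longrightarrow> bs ok (Do f) ts ts'"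
  by (rule bs_Do) auto

lemma bs_CondT: "b (map read ts) \<Longrightarrow> bs ok c1 ts ts' \<Longrightarrow> bs ok (Cond b c1 c2) ts ts'"
  and bs_CondF: "\<not> b (map read ts) \<Longrightarrow> bs ok c2 ts ts' \<Longrightarrow> bs ok (Cond b c1 c2) ts ts'"
  using bs_ok by (auto intro!: bs_Cond)

definition row_left :: com where
  "row_left = Do5 (\<lambda>q r s n g. [(q, Stay), (r, Go_Left), (s, Stay), (n, Stay), (g, Stay)])"

definition row_right :: com where
  "row_right = Do5 (\<lambda>q r s n g. [(q, Stay), (r, Go_Right), (s, Stay), (n, Stay), (g, Stay)])"

abbreviation at_cell :: "sym cell list \<Rightarrow> bool" where
  "at_cell \<equiv> L6 (\<lambda>i q r s n g. r \<noteq> Blank)"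

text \<open>One symbol is written per step, with the loop over the word unrolled into the finite
  control; all of \<open>f\<close> is written once \<open>k\<close> reaches its length.\<close>

primrec emitw :: "nat \<Rightarrow> (rcell \<Rightarrow> sym list) \<Rightarrow> com" where
  "emitw 0 f = Skip"
| "emitw (Suc k) f = emitw k f ;; Do5 (\<lambda>q r s n g.
     [if k < length (f (dr r)) then (Inp (f (dr r) ! k), Go_Right) else (q, Stay),
      (r, Stay), (s, Stay), (n, Stay), (g, Stay)])"

abbreviation count_step :: "com" where
  "count_step \<equiv> 
     Do5 (\<lambda>q r s n g. [(q, Stay), (r, Go_Left), (s, Stay),
       (n, case ar (tk (dr r)) of 0 \<Rightarrow> Go_Left | Suc 0 \<Rightarrow> Stay | _ \<Rightarrow> Go_Right), (g, Stay)])"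

definition emitf :: "nat \<Rightarrow> (rcell \<Rightarrow> sym list) \<Rightarrow> com" where
  "emitf K f = Loop (L6 (\<lambda>i q r s n g. n \<noteq> Aux 0 \<and> r \<noteq> Blank))
     (emitw K f ;; count_step)"

text \<open>The counter when \<open>tf\<close> stops; it is nonzero exactly if the row ended with
  terms still missing.\<close>

fun fin :: "nat \<Rightarrow> rcell list \<Rightarrow> nat" where
  "fin 0 cs = 0"
| "fin (Suc k) [] = Suc k"
| "fin (Suc k) (c # cs) = fin (k + ar (tk c)) cs"

lemma fin_le: "fin k cs \<le> k + length cs"
proof (induction k cs rule: fin.induct)
  case (3 k c cs)
  have "ar (tk c) \<le> 2" by (cases "tk c") auto
  then show ?case using 3 by simp
qed auto

lemma ari_fin: "ari k (map tk cs) \<longleftrightarrow> tf k cs = cs \<and> fin k cs = 0"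
proof (induction k cs rule: fin.induct)
  case (1 cs)
  then show ?case by (cases cs) auto
qed auto

lemma fin_tf: "ari k (map tk (tf k cs)) \<Longrightarrow> fin k cs = 0"
  by (induction k cs rule: fin.induct) auto

lemma tf_prefix: "\<exists>r. cs = tf k cs @ r"
  by (induction k cs rule: tf.induct) auto

locale space =
  fixes NA B :: nat
  assumes NA: "0 < NA"
begin

abbreviation ok where "ok \<equiv> okt NA B"
abbreviation vc :: "rcell \<Rightarrow> bool" where "vc c \<equiv> to_nat c < NA"

lemmas oks = okt_simps(1-4) okt_simps(5)[OF NA]

lemma row_left:
  assumes "ok i" "ok q" "ok s" "ok n" "ok g" "Suc (length u) < B" "\<forall>c\<in>set u. vc c"
  shows "bs ok row_left [i, q, hm u, s, n, g] [i, q, rowt u [], s, n, g]"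
  unfolding row_left_def using assms by (intro bs_DoI) (auto simp: oks)

lemma row_left':
  assumes "ok i" "ok q" "ok s" "ok n" "ok g" "Suc (length u) < B" "\<forall>c\<in>set u \<union> set v. vc c" "vc c"
  shows "bs ok row_left [i, q, rowt (c # u) v, s, n, g] [i, q, rowt u (c # v), s, n, g]"
  unfolding row_left_def using assms by (intro bs_DoI) (auto simp: oks)

lemma ok_bk: "ok (bk u v) \<longleftrightarrow> Suc (length u) < B \<and> (\<forall>c\<in>set u \<union> set v. vc c)"
  by (cases v) (auto simp: oks)

lemma row_right:
  assumes "ok i" "ok q" "ok s" "ok n" "ok g" "Suc (Suc (length u)) < B" "\<forall>c\<in>set u \<union> set v. vc c" "vc c"
  shows "bs ok row_right [i, q, rowt (c # u) v, s, n, g] [i, q, bk (c # u) v, s, n, g]"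
  unfolding row_right_def using assms by (intro bs_DoI) (auto simp: oks ok_bk)

lemma row_right':
  assumes "ok i" "ok q" "ok s" "ok n" "ok g" "1 < B" "\<forall>c\<in>set v. vc c"
  shows "bs ok row_right [i, q, rowt [] v, s, n, g] [i, q, bk [] v, s, n, g]"
  unfolding row_right_def using assms by (intro bs_DoI) (auto simp: oks ok_bk)

lemma emitw:
  assumes "ok i" "ok r" "ok s" "ok n" "ok g" "length (o' @ take k (f (dr (read r)))) < B"
  shows "bs ok (emitw k f) [i, orc o', r, s, n, g] [i, orc (o' @ take k (f (dr (read r)))), r, s, n, g]"
  using assms(6)
proof (induction k)
  case 0
  then show ?case using assms by (auto intro!: bs_Skip simp: oks)
next
  case (Suc k)
  let ?w = "f (dr (read r))"
  have l: "length (o' @ take k ?w) \<le> length (o' @ take (Suc k) ?w)" by simp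
  then have IH: "bs ok (emitw k f) [i, orc o', r, s, n, g] [i, orc (o' @ take k ?w), r, s, n, g]"
    using Suc by simp
  show ?case unfolding emitw.simps
  proof (rule bs_Seq[OF IH], rule bs_DoI)
    show "list_all ok [i, orc (o' @ take (Suc k) ?w), r, s, n, g]" using assms Suc.prems by (simp add: oks)
    show "list_all ok [i, orc (o' @ take k ?w), r, s, n, g]" using assms Suc.prems l by (simp add: oks)
  qed (auto simp: take_Suc_conv_app_nth)
qed

lemma emitf:
  assumes "ok i" "ok s" "ok g" "\<forall>c\<in>set u \<union> set v. vc c" "\<forall>c\<in>set u. length (f c) \<le> K"
    "length (o' @ concat (map f (tf k u))) < B" "k + length u < B"
  shows "bs ok (emitf K f) [i, orc o', rowt u v, s, ct k, g]
    [i, orc (o' @ concat (map f (tf k u))), rowt (drop (length (tf k u)) u) (rev (tf k u) @ v), s, ct (fin k u), g]"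
  using assms
proof (induction k u arbitrary: o' v rule: tf.induct)
  case (1 cs)
  then show ?case unfolding emitf_def by (auto intro!: bs_Loop_end simp: oks)
next
  case (2 k)
  then show ?case unfolding emitf_def by (auto intro!: bs_Loop_end simp: oks)
next
  case (3 k c cs)
  have ar: "ar (tk c) \<le> 2" by (cases "tk c") auto
  let ?o = "o' @ f c"
  have 1: "bs ok (emitw K f) [i, orc o', rowt (c # cs) v, s, ct (Suc k), g] [i, orc ?o, rowt (c # cs) v, s, ct (Suc k), g]"
    using emitw[of i "rowt (c # cs) v" s "ct (Suc k)" g o' K f] 3 by (simp add: oks)
  have 2: "bs ok count_step
     [i, orc ?o, rowt (c # cs) v, s, ct (Suc k), g] [i, orc ?o, rowt cs (c # v), s, ct (k + ar (tk c)), g]"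
  proof (rule bs_DoI)
    show "list_all ok [i, orc ?o, rowt (c # cs) v, s, ct (Suc k), g]" using 3 by (auto simp: oks)
    show "list_all ok [i, orc ?o, rowt cs (c # v), s, ct (k + ar (tk c)), g]" using 3 ar by (auto simp: oks)
    have "act (Blank, case ar (tk c) of 0 \<Rightarrow> Go_Left | Suc 0 \<Rightarrow> Stay | _ \<Rightarrow> Go_Right) (ct (Suc k)) = ct (k + ar (tk c))"
      using ar by (auto split: nat.splits simp: le_Suc_eq numeral_2_eq_2)
    then show "map2 act [(read i, Stay), (Blank, Stay), (rw c, Go_Left), (read s, Stay),
        (Blank, case ar (tk c) of 0 \<Rightarrow> Go_Left | Suc 0 \<Rightarrow> Stay | _ \<Rightarrow> Go_Right), (read g, Stay)]
      [i, orc ?o, rowt (c # cs) v, s, ct (Suc k), g] = [i, orc ?o, rowt cs (c # v), s, ct (k + ar (tk c)), g]"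
      by simp
  qed simp_all
  have 4: "bs ok (emitf K f) [i, orc ?o, rowt cs (c # v), s, ct (k + ar (tk c)), g]
    [i, orc (?o @ concat (map f (tf (k + ar (tk c)) cs))),
     rowt (drop (length (tf (k + ar (tk c)) cs)) cs) (rev (tf (k + ar (tk c)) cs) @ c # v), s, ct (fin (k + ar (tk c)) cs), g]"
    by (rule 3(1)) (use 3(2-) ar in auto)
  show ?case using bs_Loop[OF _ bs_Seq[OF 1 2] 4[unfolded emitf_def]] unfolding emitf_def by simp
qed

end

subsection \<open>Writing the query\<close>

definition mark :: "bool \<Rightarrow> rcell \<Rightarrow> rcell" where
  "mark m c = RC (tk c) (kd c) (fT c) (fX c) (fY c) (fZ c) m"

lemma mark_sel [simp]: "tk (mark m c) = tk c" "fM (mark m c) = m" "mark m (mark l c) = mark m c"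
  "\<not> fM c \<Longrightarrow> mark False c = c"
  by (cases c; simp add: mark_def)+

abbreviation arg_prefix :: "sym list" where
  "arg_prefix \<equiv> [SImp, SImp, SDia, SImp, SImp, SBot, SVar]"

abbreviation unmarked :: "sym cell list \<Rightarrow> bool" where
  "unmarked \<equiv> L6 (\<lambda>i q r s n g. \<not> fM (dr r))"

text \<open>The mark lets the head find its way back after copying. The counter is set to the arity,
  1 or 2, in two actions because a head moves by one cell at a time.\<close>

definition emit_arg :: "nat \<Rightarrow> (rcell \<Rightarrow> sym list) \<Rightarrow> com" where
  "emit_arg K f = emitw 7 (\<lambda>_. arg_prefix) ;;
     Do5 (\<lambda>q r s n g. [(q, Stay), (r, Stay), (s, Stay), (n, Go_Right), (g, Stay)]) ;;
     Do5 (\<lambda>q r s n g. [(q, Stay), (rw (mark True (dr r)), Go_Left), (s, Stay),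
       (n, if ar (tk (dr r)) = 2 then Go_Right else Stay), (g, Stay)]) ;;
     emitf K f ;; emitw 1 (\<lambda>_. [SBot]) ;;
     row_right ;; Loop unmarked row_right ;;
     Do5 (\<lambda>q r s n g. [(q, Stay), (rw (mark False (dr r)), Stay), (s, Stay), (n, Stay), (g, Stay)])"

definition home :: com where
  "home = row_right ;; Loop at_cell row_right"

abbreviation chain_step :: "nat \<Rightarrow> (rcell \<Rightarrow> sym list) \<Rightarrow> (rcell \<Rightarrow> bool) \<Rightarrow> com" where
  "chain_step K f S \<equiv> 
     Cond (L6 (\<lambda>i q r s n g. is_mod (tk (dr r)) \<and> S (dr r))) (emit_arg K f) Skip ;; row_left"

definition chain :: "nat \<Rightarrow> (rcell \<Rightarrow> sym list) \<Rightarrow> (rcell \<Rightarrow> bool) \<Rightarrow> com" where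
  "chain K f S = row_left ;;
     Loop at_cell (chain_step K f S) ;;
     emitw 1 (\<lambda>_. [SBot]) ;; home"

abbreviation clear_step :: "com" where
  "clear_step \<equiv> Do5 (\<lambda>q r s n g. [(Blank, Go_Left), (r, Stay), (s, Stay), (n, Stay), (g, Stay)])"

definition clear :: com where
  "clear = Do5 (\<lambda>q r s n g. [(q, Go_Left), (r, Stay), (s, Stay), (n, Stay), (g, Stay)]) ;;
     Loop (L6 (\<lambda>i q r s n g. q \<noteq> Blank))
       clear_step"

definition build_query :: "nat \<Rightarrow> (rcell \<Rightarrow> sym list) \<Rightarrow> com" where
  "build_query K f = clear ;; emitw 2 (\<lambda>_. [SImp, SImp]) ;; chain K f fY ;; chain K f (\<lambda>c. \<not> fX c) ;;
     emitw 1 (\<lambda>_. [SBot])"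

locale space_tok = space NA B for NA B +
  fixes C :: nat
  assumes vt: "(\<And>b. tk c = TDia b \<Longrightarrow> b < C) \<Longrightarrow> to_nat c < NA"
begin

definition ct_ok :: "rcell \<Rightarrow> bool" where
  "ct_ok c \<longleftrightarrow> (\<forall>b. tk c = TDia b \<longrightarrow> b < C)"

lemma ct_ok_vc: "ct_ok c \<Longrightarrow> vc c"
  using vt unfolding ct_ok_def by blast

lemma ct_ok_mark [simp]: "ct_ok (mark m c) \<longleftrightarrow> ct_ok c"
  by (simp add: ct_ok_def)

lemma row_right_any:
  assumes "ok i" "ok q" "ok s" "ok n" "ok g" "Suc (Suc (length u)) < B" "\<forall>c\<in>set u \<union> set v. ct_ok c"
  shows "bs ok row_right [i, q, rowt u v, s, n, g] [i, q, bk u v, s, n, g]"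
proof (cases u)
  case Nil
  then show ?thesis using row_right'[of i q s n g v] assms ct_ok_vc by auto
next
  case (Cons c u')
  then show ?thesis using row_right[of i q s n g u' v c] assms ct_ok_vc by auto
qed

lemma back_mark:
  assumes "ok i" "ok q" "ok s" "ok n" "ok g"
    "\<forall>c\<in>set xs. \<not> fM c" "fM m" "length u + length xs + 2 < B" "\<forall>c\<in>set u \<union> set xs \<union> set v. ct_ok c" "ct_ok m"
  shows "bs ok (Loop unmarked row_right)
    [i, q, bk u (xs @ m # v), s, n, g] [i, q, rowt (m # rev xs @ u) v, s, n, g]"
  using assms(6-)
proof (induction xs arbitrary: u)
  case Nil
  then show ?case using assms(1-5) ct_ok_vc by (auto intro!: bs_Loop_end simp: oks)
next
  case (Cons x xs)
  have 1: "bs ok row_right [i, q, rowt (x # u) (xs @ m # v), s, n, g] [i, q, bk (x # u) (xs @ m # v), s, n, g]"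
    using assms(1-5) Cons.prems by (intro row_right_any) auto
  have 2: "bs ok (Loop unmarked row_right)
    [i, q, bk (x # u) (xs @ m # v), s, n, g] [i, q, rowt (m # rev xs @ x # u) v, s, n, g]"
    by (rule Cons.IH) (use Cons.prems in auto)
  show ?case using bs_Loop[OF _ 1 2] Cons.prems(1) by simp
qed

lemma back_home:
  assumes "ok i" "ok q" "ok s" "ok n" "ok g"
    "length u + length v + 2 < B" "\<forall>c\<in>set u \<union> set v. ct_ok c"
  shows "bs ok (Loop at_cell row_right) [i, q, bk u v, s, n, g] [i, q, hm (rev v @ u), s, n, g]"
  using assms(6-)
proof (induction v arbitrary: u)
  case Nil
  then show ?case using assms(1-5) ct_ok_vc by (auto intro!: bs_Loop_end simp: oks)
next
  case (Cons x v)
  have 1: "bs ok row_right [i, q, rowt (x # u) v, s, n, g] [i, q, bk (x # u) v, s, n, g]"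
    using assms(1-5) Cons.prems by (intro row_right_any) auto
  have 2: "bs ok (Loop at_cell row_right) [i, q, bk (x # u) v, s, n, g] [i, q, hm (rev v @ x # u), s, n, g]"
    by (rule Cons.IH) (use Cons.prems in auto)
  show ?case using bs_Loop[OF _ 1 2] by simp
qed

lemma home:
  assumes "ok i" "ok q" "ok s" "ok n" "ok g" "length u + length v + 2 < B" "\<forall>c\<in>set u \<union> set v. ct_ok c"
  shows "bs ok home [i, q, rowt u v, s, n, g] [i, q, hm (rev v @ u), s, n, g]"
  unfolding home_def
  by (rule bs_Seq[OF row_right_any back_home]) (use assms in auto)

lemma emit_arg:
  assumes "ok i" "ok s" "ok g" and c: "is_mod (tk c)" "\<not> fM c" and u: "\<forall>c\<in>set u. \<not> fM c"
    and cmp: "ari (ar (tk c)) (map tk (tf (ar (tk c)) u))"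
    and K: "\<forall>c\<in>set u. length (f c) \<le> K" and v: "\<forall>c\<in>set u \<union> set v. ct_ok c" "ct_ok c"
    and B: "length (o' @ arg_prefix @ concat (map f (tf (ar (tk c)) u)) @ [SBot]) < B" "length u + length v + 4 < B"
  shows "bs ok (emit_arg K f) [i, orc o', rowt (c # u) v, s, ct 0, g]
    [i, orc (o' @ arg_prefix @ concat (map f (tf (ar (tk c)) u)) @ [SBot]), rowt (c # u) v, s, ct 0, g]"
proof -
  let ?p = "tf (ar (tk c)) u" and ?k = "ar (tk c)"
  obtain r where r: "u = ?p @ r" using tf_prefix by blast
  have dr: "drop (length ?p) u = r" by (subst (2) r) simp
  have lu: "length u = length ?p + length r" by (subst r) simp
  have su: "set u = set ?p \<union> set r" by (subst r) simp
  have k: "?k = 1 \<or> ?k = 2" using c(1) by (cases "tk c") auto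
  note vcs = ct_ok_vc[OF v(2)] ct_ok_vc
  let ?o1 = "o' @ arg_prefix" and ?o2 = "(o' @ arg_prefix) @ concat (map f ?p)"
  have 1: "bs ok (emitw 7 (\<lambda>_. arg_prefix)) [i, orc o', rowt (c # u) v, s, ct 0, g] [i, orc ?o1, rowt (c # u) v, s, ct 0, g]"
    using emitw[of i "rowt (c # u) v" s "ct 0" g o' 7 "\<lambda>_. arg_prefix"] assms vcs by (simp add: oks)
  have 2: "bs ok (Do5 (\<lambda>q r s n g. [(q, Stay), (r, Stay), (s, Stay), (n, Go_Right), (g, Stay)]))
     [i, orc ?o1, rowt (c # u) v, s, ct 0, g] [i, orc ?o1, rowt (c # u) v, s, ct 1, g]"
    by (rule bs_DoI) (use assms vcs in \<open>auto simp: oks\<close>)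
  have 3: "bs ok (Do5 (\<lambda>q r s n g. [(q, Stay), (rw (mark True (dr r)), Go_Left), (s, Stay),
       (n, if ar (tk (dr r)) = 2 then Go_Right else Stay), (g, Stay)]))
     [i, orc ?o1, rowt (c # u) v, s, ct 1, g] [i, orc ?o1, rowt u (mark True c # v), s, ct ?k, g]"
    by (rule bs_DoI) (use assms vcs k ct_ok_vc[of "mark True c"] in \<open>auto simp: oks numeral_2_eq_2\<close>)
  have f0: "fin ?k u = 0" using fin_tf[OF cmp] .
  have 4: "bs ok (emitf K f) [i, orc ?o1, rowt u (mark True c # v), s, ct ?k, g]
     [i, orc ?o2, rowt r (rev ?p @ mark True c # v), s, ct 0, g]"
    using emitf[of i s g u "mark True c # v" f K ?o1 ?k] assms vcs k ct_ok_vc[of "mark True c"] unfolding f0 dr by auto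
  have ok4: "ok (rowt r (rev ?p @ mark True c # v))"
    using v vcs B(2) lu ct_ok_vc[of "mark True c"] by (auto simp: oks su)
  have 5: "bs ok (emitw 1 (\<lambda>_. [SBot])) [i, orc ?o2, rowt r (rev ?p @ mark True c # v), s, ct 0, g]
     [i, orc (?o2 @ [SBot]), rowt r (rev ?p @ mark True c # v), s, ct 0, g]"
    using emitw[of i "rowt r (rev ?p @ mark True c # v)" s "ct 0" g ?o2 1 "\<lambda>_. [SBot]"] assms ok4 by (simp add: oks)
  have 6: "bs ok row_right [i, orc (?o2 @ [SBot]), rowt r (rev ?p @ mark True c # v), s, ct 0, g]
     [i, orc (?o2 @ [SBot]), bk r (rev ?p @ mark True c # v), s, ct 0, g]"
    by (rule row_right_any) (use assms lu in \<open>auto simp: oks su\<close>)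
  have 7: "bs ok (Loop unmarked row_right)
     [i, orc (?o2 @ [SBot]), bk r (rev ?p @ mark True c # v), s, ct 0, g]
     [i, orc (?o2 @ [SBot]), rowt (mark True c # rev (rev ?p) @ r) v, s, ct 0, g]"
    by (rule back_mark) (use assms lu in \<open>auto simp: oks su\<close>)
  have e: "rev (rev ?p) @ r = u" using r by simp
  have 8: "bs ok (Do5 (\<lambda>q r s n g. [(q, Stay), (rw (mark False (dr r)), Stay), (s, Stay), (n, Stay), (g, Stay)]))
     [i, orc (?o2 @ [SBot]), rowt (mark True c # u) v, s, ct 0, g]
     [i, orc (?o2 @ [SBot]), rowt (c # u) v, s, ct 0, g]"
    by (rule bs_DoI) (use assms vcs ct_ok_vc[of "mark True c"] in \<open>auto simp: oks\<close>)
  show ?thesis unfolding emit_arg_def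
    using bs_Seq[OF 1 bs_Seq[OF 2 bs_Seq[OF 3 bs_Seq[OF 4 bs_Seq[OF 5 bs_Seq[OF 6 bs_Seq[OF 7[unfolded e] 8]]]]]]]
    by simp
qed

lemma echain_ne: "echain s' a S u \<noteq> []"
  by (induction u) auto

text \<open>The loop writes all but the closing \<open>Bot\<close> of the disjunction, which
  \<open>chain\<close> adds afterwards; hence \<open>butlast\<close>.\<close>

lemma chain_loop:
  fixes s' a :: nat
  assumes "ok i" "ok s" "ok g" "\<forall>c\<in>set u. \<not> fM c" "complete u" "\<forall>c\<in>set u. length (emit s' a c) \<le> K"
    "\<forall>c\<in>set u \<union> set v. ct_ok c" "length (o' @ echain s' a S u) < B" "length u + length v + 4 < B"
  shows "bs ok (Loop at_cell (chain_step K (emit s' a) S))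
    [i, orc o', rowt u v, s, ct 0, g] [i, orc (o' @ butlast (echain s' a S u)), rowt [] (rev u @ v), s, ct 0, g]"
  using assms
proof (induction u arbitrary: o' v)
  case Nil
  then show ?case using ct_ok_vc by (auto intro!: bs_Loop_end simp: oks)
next
  case (Cons c u)
  let ?w = "if is_mod (tk c) \<and> S c then arg_prefix @ emits s' a (tf (ar (tk c)) u) @ [SBot] else []"
  have ne: "echain s' a S u \<noteq> []" by (rule echain_ne)
  have e: "echain s' a S (c # u) = ?w @ echain s' a S u" by simp
  have bl: "butlast (echain s' a S (c # u)) = ?w @ butlast (echain s' a S u)"
    unfolding e using ne by (simp add: butlast_append)
  have len: "length (o' @ ?w @ echain s' a S u) < B" using Cons.prems(8) unfolding e .
  let ?rc = "rowt (c # u) v"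
  have okr: "ok ?rc" using Cons.prems ct_ok_vc by (auto simp: oks)
  have 1: "bs ok (Cond (L6 (\<lambda>i q r s n g. is_mod (tk (dr r)) \<and> S (dr r))) (emit_arg K (emit s' a)) Skip)
     [i, orc o', ?rc, s, ct 0, g] [i, orc (o' @ ?w), ?rc, s, ct 0, g]"
  proof (cases "is_mod (tk c) \<and> S c")
    case True
    have "bs ok (emit_arg K (emit s' a)) [i, orc o', ?rc, s, ct 0, g]
       [i, orc (o' @ arg_prefix @ emits s' a (tf (ar (tk c)) u) @ [SBot]), ?rc, s, ct 0, g]"
      by (rule emit_arg) (use Cons.prems True len in auto)
    then show ?thesis using True by (intro bs_CondT) auto
  next
    case False
    then have "bs ok Skip [i, orc o', ?rc, s, ct 0, g] [i, orc (o' @ ?w), ?rc, s, ct 0, g]"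
      using Cons.prems okr len by (auto intro!: bs_Skip simp: oks)
    then show ?thesis using False by (intro bs_CondF) auto
  qed
  have 2: "bs ok row_left [i, orc (o' @ ?w), ?rc, s, ct 0, g] [i, orc (o' @ ?w), rowt u (c # v), s, ct 0, g]"
    by (rule row_left') (use Cons.prems ct_ok_vc len in \<open>auto simp: oks\<close>)
  have 3: "bs ok (Loop at_cell (chain_step K (emit s' a) S))
    [i, orc (o' @ ?w), rowt u (c # v), s, ct 0, g]
    [i, orc ((o' @ ?w) @ butlast (echain s' a S u)), rowt [] (rev u @ c # v), s, ct 0, g]"
    by (rule Cons.IH) (use Cons.prems len in auto)
  have "bs ok (Loop at_cell (chain_step K (emit s' a) S))
    [i, orc o', ?rc, s, ct 0, g]
    [i, orc ((o' @ ?w) @ butlast (echain s' a S u)), rowt [] (rev u @ c # v), s, ct 0, g]"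
    by (rule bs_Loop[OF _ bs_Seq[OF 1 2] 3]) simp
  then show ?case unfolding bl by simp
qed

lemma echain_snoc: "butlast (echain s' a S u) @ [SBot] = echain s' a S u"
proof (induction u)
  case (Cons c u)
  have "echain s' a S u \<noteq> []" by (rule echain_ne)
  then show ?case using Cons by (simp add: butlast_append)
qed simp

lemma chain:
  fixes s' a :: nat
  assumes "ok i" "ok s" "ok g" "\<forall>c\<in>set u. \<not> fM c" "complete u" "\<forall>c\<in>set u. length (emit s' a c) \<le> K"
    "\<forall>c\<in>set u. ct_ok c" "length (o' @ echain s' a S u) < B" "length u + 4 < B"
  shows "bs ok (chain K (emit s' a) S) [i, orc o', hm u, s, ct 0, g] [i, orc (o' @ echain s' a S u), hm u, s, ct 0, g]"
proof -
  let ?o = "o' @ butlast (echain s' a S u)"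
  have l: "length (?o @ [SBot]) < B" using assms(8) by (simp add: echain_snoc)
  have 1: "bs ok row_left [i, orc o', hm u, s, ct 0, g] [i, orc o', rowt u [], s, ct 0, g]"
    by (rule row_left) (use assms ct_ok_vc in \<open>auto simp: oks\<close>)
  have 2: "bs ok (Loop at_cell (chain_step K (emit s' a) S))
    [i, orc o', rowt u [], s, ct 0, g] [i, orc ?o, rowt [] (rev u @ []), s, ct 0, g]"
    by (rule chain_loop) (use assms in auto)
  have 3: "bs ok (emitw 1 (\<lambda>_. [SBot])) [i, orc ?o, rowt [] (rev u @ []), s, ct 0, g]
     [i, orc (?o @ [SBot]), rowt [] (rev u @ []), s, ct 0, g]"
    using emitw[of i "rowt [] (rev u @ [])" s "ct 0" g ?o 1 "\<lambda>_. [SBot]"] assms l ct_ok_vc by (simp add: oks)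
  have 4: "bs ok home [i, orc (?o @ [SBot]), rowt [] (rev u @ []), s, ct 0, g]
     [i, orc (?o @ [SBot]), hm (rev (rev u @ []) @ []), s, ct 0, g]"
    by (rule home) (use assms l in \<open>auto simp: oks\<close>)
  show ?thesis unfolding chain_def using bs_Seq[OF 1 bs_Seq[OF 2 bs_Seq[OF 3 4]]] by (simp add: echain_snoc)
qed

lemma clear:
  assumes "ok i" "ok r" "ok s" "ok n" "ok g" "length w < B"
  shows "bs ok clear [i, orc w, r, s, n, g] [i, orc [], r, s, n, g]"
proof -
  define tq where "tq xs = (case xs of [] \<Rightarrow> tp [] [] | x # xs' \<Rightarrow> tp (map Inp xs') [Inp x])" for xs :: "sym list"
  have oktq: "ok (tq xs) \<longleftrightarrow> length xs < Suc B \<and> 0 < B" for xs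
    by (cases xs) (auto simp: tq_def okt_tp)
  have act1: "act (Blank, Go_Left) (orc w) = tq (rev w)"
    by (cases "rev w") (auto simp: orc_def tq_def simp flip: rev_map)
  have loop: "bs ok (Loop (L6 (\<lambda>i q r s n g. q \<noteq> Blank))
       clear_step)
     [i, tq xs, r, s, n, g] [i, tp [] [], r, s, n, g]" if "length xs < B" for xs
    using that
  proof (induction xs)
    case Nil
    then show ?case using assms by (auto intro!: bs_Loop_end simp: tq_def okt_tp)
  next
    case (Cons x xs)
    have a: "act (Blank, Go_Left) (tq (x # xs)) = tq xs" by (cases xs) (auto simp: tq_def)
    have 1: "bs ok clear_step
       [i, tq (x # xs), r, s, n, g] [i, tq xs, r, s, n, g]"
      by (rule bs_DoI) (use assms Cons.prems a in \<open>auto simp: oktq\<close>)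
    have 2: "bs ok (Loop (L6 (\<lambda>i q r s n g. q \<noteq> Blank))
       clear_step)
       [i, tq xs, r, s, n, g] [i, tp [] [], r, s, n, g]" using Cons by simp
    have "read (tq (x # xs)) = Inp x" by (simp add: tq_def)
    then show ?case using bs_Loop[OF _ 1 2] by simp
  qed
  have 1: "bs ok (Do5 (\<lambda>q r s n g. [(q, Go_Left), (r, Stay), (s, Stay), (n, Stay), (g, Stay)]))
     [i, orc w, r, s, n, g] [i, tq (rev w), r, s, n, g]"
    by (rule bs_DoI) (use assms act1 in \<open>auto simp: oktq oks\<close>)
  show ?thesis unfolding clear_def using bs_Seq[OF 1 loop[of "rev w"]] assms by (simp add: orc_def)
qed

lemma build_query:
  fixes s' a :: nat
  assumes "ok i" "ok s" "ok g" "\<forall>c\<in>set u. \<not> fM c" "complete u" "\<forall>c\<in>set u. length (emit s' a c) \<le> K"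
    "\<forall>c\<in>set u. ct_ok c" "length w < B" "length (qword s' a u) < B" "length u + 4 < B"
  shows "bs ok (build_query K (emit s' a)) [i, orc w, hm u, s, ct 0, g] [i, orc (qword s' a u), hm u, s, ct 0, g]"
proof -
  let ?o1 = "[SImp, SImp] @ echain s' a fY u" let ?o2 = "?o1 @ echain s' a (\<lambda>c. \<not> fX c) u"
  have l: "length (?o2 @ [SBot]) < B" using assms(9) by (simp add: qword_def)
  have okh: "ok (hm u)" using assms ct_ok_vc by (auto simp: oks)
  have B: "0 < B" using assms(10) by simp
  have 1: "bs ok clear [i, orc w, hm u, s, ct 0, g] [i, orc [], hm u, s, ct 0, g]"
    by (rule clear) (use assms okh B in \<open>auto simp: oks\<close>)
  have 2: "bs ok (emitw 2 (\<lambda>_. [SImp, SImp])) [i, orc [], hm u, s, ct 0, g] [i, orc [SImp, SImp], hm u, s, ct 0, g]"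
    using emitw[of i "hm u" s "ct 0" g "[]" 2 "\<lambda>_. [SImp, SImp]"] assms okh B by (simp add: oks)
  have 3: "bs ok (chain K (emit s' a) fY) [i, orc [SImp, SImp], hm u, s, ct 0, g] [i, orc ?o1, hm u, s, ct 0, g]"
    by (rule chain) (use assms l in auto)
  have 4: "bs ok (chain K (emit s' a) (\<lambda>c. \<not> fX c)) [i, orc ?o1, hm u, s, ct 0, g] [i, orc ?o2, hm u, s, ct 0, g]"
    by (rule chain) (use assms l in auto)
  have 5: "bs ok (emitw 1 (\<lambda>_. [SBot])) [i, orc ?o2, hm u, s, ct 0, g] [i, orc (?o2 @ [SBot]), hm u, s, ct 0, g]"
    using emitw[of i "hm u" s "ct 0" g ?o2 1 "\<lambda>_. [SBot]"] assms okh B l by (simp add: oks)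
  show ?thesis unfolding build_query_def
    using bs_Seq[OF 1 bs_Seq[OF 2 bs_Seq[OF 3 bs_Seq[OF 4 5]]]] by (simp add: qword_def)
qed

end

subsection \<open>Sweeps\<close>

primrec mealy :: "('g \<Rightarrow> 'c \<Rightarrow> 'g \<times> 'c) \<Rightarrow> 'g \<Rightarrow> 'c list \<Rightarrow> 'g \<times> 'c list" where
  "mealy f g [] = (g, [])"
| "mealy f g (c # u) = (fst (mealy f (fst (f g c)) u), snd (f g c) # snd (mealy f (fst (f g c)) u))"

lemma length_mealy [simp]: "length (snd (mealy f g u)) = length u"
  by (induction u arbitrary: g) auto

definition stk :: "rcell list \<Rightarrow> sym tape" where "stk st = tp (map rw st) []"

abbreviation pop_step :: "(reg \<Rightarrow> bool) \<Rightarrow> com" where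
  "pop_step pop \<equiv> 
     Do5 (\<lambda>q r s n g. [(q, Stay), (r, Stay), (s, if pop (dg g) then Go_Left else Stay), (n, Stay), (g, Stay)])"

abbreviation mealy_step :: "(reg \<Rightarrow> bool) \<Rightarrow> (reg \<Rightarrow> rcell \<Rightarrow> reg \<times> rcell) \<Rightarrow> com" where
  "mealy_step pop f \<equiv> 
     Do5 (\<lambda>q r s n g. [(q, Stay),
       (if pop (dg g) then s else rw (snd (f (dg g) (dr r))), Go_Left),
       (if pop (dg g) then Blank else s, Stay), (n, Stay), (rg (fst (f (dg g) (dr r))), Stay)])"

text \<open>The forward half of a sweep runs a Mealy machine on the row or, in a popping state,
  replaces the row by the top of the stack; the backward half may push the row.\<close>

definition forward :: "(reg \<Rightarrow> bool) \<Rightarrow> (reg \<Rightarrow> rcell \<Rightarrow> reg \<times> rcell) \<Rightarrow> com" where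
  "forward pop f = Loop at_cell
     (pop_step pop ;;
      mealy_step pop f)"

definition backward :: "(reg \<Rightarrow> bool) \<Rightarrow> (rcell \<Rightarrow> rcell) \<Rightarrow> com" where
  "backward psh ch = Loop at_cell
     (Do5 (\<lambda>q r s n g. [(q, Stay), (if psh (dg g) then rw (ch (dr r)) else r, Go_Right),
        (if psh (dg g) then (r, Go_Right) else (s, Stay)), (n, Stay), (g, Stay)]))"

definition sweep where
  "sweep pop f mid psh ch = row_left ;; forward pop f ;;
     Do5 (\<lambda>q r s n g. [(q, Stay), (r, Go_Right), (s, Stay), (n, Stay), (rg (mid (dg g)), Stay)]) ;;
     backward psh ch"

subsection \<open>Initialization\<close>

abbreviation cell0 :: "tok \<Rightarrow> rcell" where
  "cell0 t \<equiv> RC t KT False False False False False"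

fun rv :: "reg \<Rightarrow> nat option" where
  "rv (RV x) = x"
| "rv _ = None"

abbreviation copy_step :: "com" where
  "copy_step \<equiv> 
     Do (L6 (\<lambda>i q r s n g. [(i, Go_Right), (q, Stay), (r, Stay), (i, Go_Right), (n, Stay), (g, Stay)]))"

abbreviation token_step :: "nat \<Rightarrow> com" where
  "token_step C \<equiv> 
     Do5 (\<lambda>q r s n g. [(q, Stay), (rw (cell0 (snd (tstep C (the_Inp s) (rv (dg g))))), Go_Right),
       (Blank, Go_Left), (n, Stay), (rg (RV (fst (tstep C (the_Inp s) (rv (dg g))))), Stay)])"

text \<open>The input is copied to the stack tape and consumed from its end, as \<open>tz\<close>
  reads from right to left. Tokens are written towards the right, so the first one ends up next to
  the head. The blank cell 0 of the row tape and that of the stack tape serve as end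
  markers.\<close>

definition tokenize :: "nat \<Rightarrow> com" where
  "tokenize C = Do5 (\<lambda>q r s n g. [(q, Stay), (Blank, Go_Right), (Blank, Go_Right), (Aux 0, Stay), (rg (RV (Some 0)), Stay)]) ;;
     Loop (L6 (\<lambda>i q r s n g. i \<noteq> Blank))
       copy_step ;;
     Do5 (\<lambda>q r s n g. [(q, Stay), (r, Stay), (s, Go_Left), (n, Stay), (g, Stay)]) ;;
     Loop (L6 (\<lambda>i q r s n g. s \<noteq> Blank))
       (token_step C) ;;
     Do5 (\<lambda>q r s n g. [(q, Stay), (rw (cell0 TRoot), Go_Right), (s, Stay), (n, Stay), (g, Stay)])"

definition reg_start :: reg where "reg_start = RG Try KT False True False"
definition reg_fail :: reg where "reg_fail = RG Rej KT False True False"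

text \<open>Emitting nothing with the counter started at 1 is the test \<open>ari 1\<close>: it
  succeeds if the row is used up and the counter is 0. The register must also show that no binary
  digits are left over.\<close>

definition check :: com where
  "check = Do5 (\<lambda>q r s n g. [(q, Stay), (r, Stay), (s, Stay), (n, Go_Right), (g, Stay)]) ;;
     row_left ;; emitf 0 (\<lambda>_. []) ;;
     Do5 (\<lambda>q r s n g. [(q, Stay), (r, Stay), (s, Stay), (n, Stay),
       (if r = Blank \<and> n = Aux 0 \<and> dg g = RV (Some 0) then rg reg_start else rg reg_fail, Stay)]) ;;
     Cond (L6 (\<lambda>i q r s n g. g = rg reg_start)) home Skip"

definition initialize :: "nat \<Rightarrow> com" where "initialize C = tokenize C ;; check"

context space_tok
begin

lemma ok_stk: "ok (stk st) \<longleftrightarrow> length st < B \<and> (\<forall>c\<in>set st. vc c)"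
  by (auto simp: stk_def okt_tp rw_def)

lemma read_stk [simp]: "read (stk st) = Blank"
  and act_stk [simp]: "act (Blank, Stay) (stk st) = stk st" "act (rw c, Go_Right) (stk st) = stk (c # st)"
  by (simp_all add: stk_def)

lemma forward:
  assumes "ok i" "ok q" "ok n" "ok (stk st)" "\<not> pop g" "length u < B" "\<forall>c\<in>set u \<union> set v. ct_ok c" "to_nat g < NA"
    and f: "\<And>g c. \<not> pop g \<Longrightarrow> \<not> pop (fst (f g c))" "\<And>g c. to_nat g < NA \<Longrightarrow> to_nat (fst (f g c)) < NA"
      "\<And>g c. ct_ok c \<Longrightarrow> ct_ok (snd (f g c))"
  shows "bs ok (forward pop f) [i, q, rowt u v, stk st, n, rgt g]
    [i, q, rowt [] (rev (snd (mealy f g u)) @ v), stk st, n, rgt (fst (mealy f g u))]"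
  using assms(5-8)
proof (induction u arbitrary: v g)
  case Nil
  then show ?case using assms(1-4) ct_ok_vc unfolding forward_def by (auto intro!: bs_Loop_end simp: oks)
next
  case (Cons c u)
  let ?g = "fst (f g c)" and ?c = "snd (f g c)"
  have okr: "ok (rowt (c # u) v)" "ok (rgt g)" "ok (rgt ?g)" "ok (rowt u (?c # v))"
    using Cons.prems f ct_ok_vc by (auto simp: oks)
  have 1: "bs ok (pop_step pop)
     [i, q, rowt (c # u) v, stk st, n, rgt g] [i, q, rowt (c # u) v, stk st, n, rgt g]"
    by (rule bs_DoI) (use assms(1-4) Cons.prems okr in auto)
  have 2: "bs ok (mealy_step pop f)
     [i, q, rowt (c # u) v, stk st, n, rgt g] [i, q, rowt u (?c # v), stk st, n, rgt ?g]"
    by (rule bs_DoI) (use assms(1-4) Cons.prems okr in auto)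
  have 3: "bs ok (forward pop f) [i, q, rowt u (?c # v), stk st, n, rgt ?g]
     [i, q, rowt [] (rev (snd (mealy f ?g u)) @ ?c # v), stk st, n, rgt (fst (mealy f ?g u))]"
    by (rule Cons.IH) (use Cons.prems f in auto)
  show ?case using bs_Loop[OF _ bs_Seq[OF 1 2] 3[unfolded forward_def]] unfolding forward_def by simp
qed

lemma forward_pop:
  assumes "ok i" "ok q" "ok n" "length (w @ st) < B" "\<forall>c\<in>set (w @ st). ct_ok c"
    "pop g" "length w = length u" "length u < B" "\<forall>c\<in>set u \<union> set v. ct_ok c" "to_nat g < NA"
    and f: "\<And>g c. pop g \<Longrightarrow> fst (f g c) = g"
  shows "bs ok (forward pop f) [i, q, rowt u v, stk (w @ st), n, rgt g]
    [i, q, rowt [] (rev w @ v), stk st, n, rgt g]"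
  using assms(4-10)
proof (induction u arbitrary: v w)
  case Nil
  then show ?case using assms(1-3) ct_ok_vc unfolding forward_def
    by (auto intro!: bs_Loop_end simp: oks ok_stk)
next
  case (Cons c u)
  obtain d w' where w: "w = d # w'" using Cons.prems by (cases w) auto
  let ?s = "tp (map rw (w' @ st)) [rw d]"
  have oks1: "ok ?s" using Cons.prems ct_ok_vc by (auto simp: okt_tp w rw_def)
  have okr: "ok (rowt (c # u) v)" "ok (rgt g)" "ok (rowt u (d # v))" "ok (stk (w @ st))" "ok (stk (w' @ st))"
    using Cons.prems ct_ok_vc by (auto simp: oks ok_stk w)
  have 1: "bs ok (pop_step pop)
     [i, q, rowt (c # u) v, stk (w @ st), n, rgt g] [i, q, rowt (c # u) v, ?s, n, rgt g]"
    by (rule bs_DoI) (use assms(1-3) Cons.prems okr oks1 in \<open>auto simp: w stk_def\<close>)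
  have 2: "bs ok (mealy_step pop f)
     [i, q, rowt (c # u) v, ?s, n, rgt g] [i, q, rowt u (d # v), stk (w' @ st), n, rgt g]"
    by (rule bs_DoI) (use assms(1-3) Cons.prems okr oks1 f in \<open>auto simp: stk_def\<close>)
  have 3: "bs ok (forward pop f) [i, q, rowt u (d # v), stk (w' @ st), n, rgt g]
     [i, q, rowt [] (rev w' @ d # v), stk st, n, rgt g]"
    by (rule Cons.IH) (use Cons.prems in \<open>auto simp: w\<close>)
  show ?case using bs_Loop[OF _ bs_Seq[OF 1 2] 3[unfolded forward_def]] unfolding forward_def w by simp
qed

text \<open>Rows are pushed on the way back, last cell first, so that the first cell lies on top and
  a forward sweep pops a row in its order.\<close>

lemma backward:
  assumes "ok i" "ok q" "ok n" "ok (rgt g)" "length (v @ st) < B" "length u + length v + 2 < B"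
    "\<forall>c\<in>set u \<union> set v \<union> set st. ct_ok c" and ch: "\<And>c. tk (ch c) = tk c"
  shows "bs ok (backward psh ch) [i, q, bk u v, stk st, n, rgt g]
    [i, q, hm (if psh g then rev (map ch v) @ u else rev v @ u),
     stk (if psh g then rev v @ st else st), n, rgt g]"
  using assms(5-7)
proof (induction v arbitrary: u st)
  case Nil
  then show ?case using assms(1-4) ct_ok_vc unfolding backward_def
    by (auto intro!: bs_Loop_end simp: oks ok_stk)
next
  case (Cons c v)
  let ?c = "if psh g then ch c else c" and ?st = "if psh g then c # st else st"
  have co: "ct_ok ?c" using Cons.prems ch by (auto simp: ct_ok_def)
  have okr: "ok (rowt (c # u) v)" "ok (bk (?c # u) v)" "ok (stk st)" "ok (stk ?st)"
    using Cons.prems ct_ok_vc co by (auto simp: oks ok_stk ok_bk)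
  have 1: "bs ok (Do5 (\<lambda>q r s n g. [(q, Stay), (if psh (dg g) then rw (ch (dr r)) else r, Go_Right),
        (if psh (dg g) then (r, Go_Right) else (s, Stay)), (n, Stay), (g, Stay)]))
     [i, q, rowt (c # u) v, stk st, n, rgt g] [i, q, bk (?c # u) v, stk ?st, n, rgt g]"
    by (rule bs_DoI) (use assms(1-4) okr in auto)
  have 2: "bs ok (backward psh ch) [i, q, bk (?c # u) v, stk ?st, n, rgt g]
     [i, q, hm (if psh g then rev (map ch v) @ ?c # u else rev v @ ?c # u),
     stk (if psh g then rev v @ ?st else ?st), n, rgt g]"
    by (rule Cons.IH) (use Cons.prems co in auto)
  show ?case using bs_Loop[OF _ 1 2[unfolded backward_def]] unfolding backward_def
    by (cases "psh g") simp_all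
qed

lemma sweep:
  assumes i: "ok i" "ok q" "ok n" and B: "length (u @ st) < B" "length u + 2 < B"
    and c: "\<forall>c\<in>set u \<union> set st. ct_ok c" and g: "to_nat g < NA" and ch: "\<And>c. tk (ch c) = tk c"
    and mid: "to_nat (mid g') < NA"
    and F: "bs ok (forward pop f) [i, q, rowt u [], stk st, n, rgt g] [i, q, rowt [] (rev u'), stk st', n, rgt g']"
    and u': "length u' = length u" "\<forall>c\<in>set u' \<union> set st'. ct_ok c" and st': "length (u' @ st') < B" 
  shows "bs ok (sweep pop f mid psh ch) [i, q, hm u, stk st, n, rgt g]
    [i, q, hm (if psh (mid g') then map ch u' else u'),
     stk (if psh (mid g') then u' @ st' else st'), n, rgt (mid g')]"
proof -
  have B0: "0 < B" using B by simp
  have o: "ok (stk st)" "ok (rgt g)" "ok (rgt (mid g'))" "ok (stk st')"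
    using assms ct_ok_vc by (auto simp: oks ok_stk)
  have 1: "bs ok row_left [i, q, hm u, stk st, n, rgt g] [i, q, rowt u [], stk st, n, rgt g]"
    by (rule row_left) (use assms o ct_ok_vc in auto)
  have okm: "list_all ok [i, q, rowt [] (rev u'), stk st', n, rgt g']" using bs_ok[OF F] by blast
  have 2: "bs ok (Do5 (\<lambda>q r s n g. [(q, Stay), (r, Go_Right), (s, Stay), (n, Stay), (rg (mid (dg g)), Stay)]))
     [i, q, rowt [] (rev u'), stk st', n, rgt g'] [i, q, bk [] (rev u'), stk st', n, rgt (mid g')]"
    by (rule bs_DoI) (use okm o B u' ct_ok_vc in \<open>auto simp: ok_bk\<close>)
  have 3: "bs ok (backward psh ch) [i, q, bk [] (rev u'), stk st', n, rgt (mid g')]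
     [i, q, hm (if psh (mid g') then rev (map ch (rev u')) @ [] else rev (rev u') @ []),
     stk (if psh (mid g') then rev (rev u') @ st' else st'), n, rgt (mid g')]"
    by (rule backward) (use assms o in auto)
  have e: "rev (map ch (rev u')) = map ch u'" by (simp add: rev_map)
  show ?thesis unfolding sweep_def using bs_Seq[OF 1 bs_Seq[OF F bs_Seq[OF 2 3]]]
    unfolding append_Nil2 rev_rev_ident e .
qed

lemma copy_input:
  assumes "ok q" "ok r" "ok n" "ok g" "length l + length w < B" "length S + length w < B"
    "set l \<subseteq> symb NA" "set S \<subseteq> symb NA"
  shows "bs ok (Loop (L6 (\<lambda>i q r s n g. i \<noteq> Blank))
       copy_step)
    [tp l (map Inp w), q, r, tp S [], n, g] [tp (rev (map Inp w) @ l) [], q, r, tp (rev (map Inp w) @ S) [], n, g]"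
  using assms(5-)
proof (induction w arbitrary: l S)
  case Nil
  then show ?case using assms(1-4) by (auto intro!: bs_Loop_end simp: okt_tp)
next
  case (Cons x w)
  let ?b = "copy_step"
  have 1: "bs ok ?b [tp l (map Inp (x # w)), q, r, tp S [], n, g] [tp (Inp x # l) (map Inp w), q, r, tp (Inp x # S) [], n, g]"
    by (rule bs_DoI) (use assms(1-4) Cons.prems in \<open>auto simp: okt_tp\<close>)
  have 2: "bs ok (Loop (L6 (\<lambda>i q r s n g. i \<noteq> Blank)) ?b) [tp (Inp x # l) (map Inp w), q, r, tp (Inp x # S) [], n, g]
     [tp (rev (map Inp w) @ Inp x # l) [], q, r, tp (rev (map Inp w) @ Inp x # S) [], n, g]"
    by (rule Cons.IH) (use Cons.prems in auto)
  show ?case using bs_Loop[OF _ 1 2] by simp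
qed

definition inp_stack :: "sym list \<Rightarrow> sym tape" where
  "inp_stack xs = (case xs of [] \<Rightarrow> tp [] [] | x # xs' \<Rightarrow> tp (map Inp xs' @ [Blank]) [Inp x])"

lemma tz_ct_ok: "C > 0 \<Longrightarrow> \<forall>t\<in>set (snd (tz C w)). ct_ok (cell0 t)"
proof (induction w)
  case (Cons x w)
  have "ct_ok (cell0 (snd (tstep C x v)))" for v
    by (cases "(C, x, v)" rule: tstep.cases) (auto simp: ct_ok_def)
  then show ?case using Cons by simp
qed simp

lemma tz_le: "C > 0 \<Longrightarrow> fst (tz C w) = Some v \<Longrightarrow> v \<le> C"
proof (induction w arbitrary: v)
  case (Cons x w)
  have "fst (tstep C x y) = Some v \<Longrightarrow> v \<le> C" for y v
    by (cases "(C, x, y)" rule: tstep.cases) (auto split: if_splits)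
  then show ?case using Cons by simp
qed simp

lemma tokens_loop:
  assumes "ok i" "ok q" "ok n" "C > 0" "\<And>v. (\<And>x. v = Some x \<Longrightarrow> x \<le> C) \<Longrightarrow> to_nat (RV v) < NA"
    "length w1 + length w2 + 2 < B"
  shows "bs ok (Loop (L6 (\<lambda>i q r s n g. s \<noteq> Blank))
       (token_step C))
    [i, q, hm (map cell0 (snd (tz C w2))), inp_stack (rev w1), n, rgt (RV (fst (tz C w2)))]
    [i, q, hm (map cell0 (snd (tz C (w1 @ w2)))), tp [] [], n, rgt (RV (fst (tz C (w1 @ w2))))]"
proof -
  have len: "length (snd (tz C w)) = length w" for w by (induction w) auto
  have okt1: "ok (hm (map cell0 (snd (tz C w))))" if "length w + 1 < B" for w
    using that tz_ct_ok[OF assms(4), of w] ct_ok_vc by (auto simp: oks len)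
  have okg: "ok (rgt (RV (fst (tz C w))))" for w
    using assms(5)[of "fst (tz C w)"] tz_le[OF assms(4), of w] assms(6) by (auto simp: oks)
  have oki: "ok (inp_stack xs)" if "length xs < B" for xs
    using that by (cases xs) (auto simp: inp_stack_def okt_tp)
  let ?b = "token_step C"
  show ?thesis using assms(6)
  proof (induction w1 arbitrary: w2 rule: rev_induct)
    case Nil
    then have "list_all ok [i, q, hm (map cell0 (snd (tz C w2))), inp_stack [], n, rgt (RV (fst (tz C w2)))]"
      using assms(1-3) okt1[of w2] okg oki[of "[]"] by simp
    from bs_Loop_end[OF this] show ?case by (simp add: inp_stack_def)
  next
    case (snoc x w1)
    have a: "act (Blank, Go_Left) (inp_stack (x # rev w1)) = inp_stack (rev w1)"
      by (cases "rev w1") (auto simp: inp_stack_def)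
    have r: "read (inp_stack (x # rev w1)) = Inp x" by (simp add: inp_stack_def)
    have h: "act (rw c, Go_Right) (hm u) = hm (c # u)" for c u by (simp add: hm_def)
    have 1: "bs ok ?b [i, q, hm (map cell0 (snd (tz C w2))), inp_stack (x # rev w1), n, rgt (RV (fst (tz C w2)))]
       [i, q, hm (map cell0 (snd (tz C (x # w2)))), inp_stack (rev w1), n, rgt (RV (fst (tz C (x # w2))))]"
    proof (rule bs_DoI)
      show "list_all ok [i, q, hm (map cell0 (snd (tz C w2))), inp_stack (x # rev w1), n, rgt (RV (fst (tz C w2)))]"
        using assms(1-3) snoc.prems okt1[of w2] okg[of w2] oki[of "x # rev w1"] by simp
      show "list_all ok [i, q, hm (map cell0 (snd (tz C (x # w2)))), inp_stack (rev w1), n, rgt (RV (fst (tz C (x # w2))))]"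
        using assms(1-3) snoc.prems okt1[of "x # w2"] okg[of "x # w2"] oki[of "rev w1"] by simp
    qed (simp add: r a h)+
    have 2: "bs ok (Loop (L6 (\<lambda>i q r s n g. s \<noteq> Blank)) ?b)
       [i, q, hm (map cell0 (snd (tz C (x # w2)))), inp_stack (rev w1), n, rgt (RV (fst (tz C (x # w2))))]
       [i, q, hm (map cell0 (snd (tz C (w1 @ x # w2)))), tp [] [], n, rgt (RV (fst (tz C (w1 @ x # w2))))]"
      by (rule snoc.IH) (use snoc.prems in simp)
    show ?case using bs_Loop[OF _ 1 2] r by simp
  qed
qed

lemma tokenize:
  assumes "C > 0" "\<And>v. (\<And>x. v = Some x \<Longrightarrow> x \<le> C) \<Longrightarrow> to_nat (RV v) < NA" "length w + 3 < B"
  shows "bs ok (tokenize C) [tp [] (map Inp w), orc [], tp [] [], tp [] [], tp [] [], tp [] []]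
    [tp (rev (map Inp w)) [], orc [], hm (map cell0 (TRoot # snd (tz C w))), stk [], ct 0, rgt (RV (fst (tz C w)))]"
proof -
  let ?i = "tp (rev (map Inp w)) []" and ?g = "rgt (RV (Some 0))"
  have oi: "ok (tp [] (map Inp w))" "ok ?i" "ok (orc [])" "ok (hm [])" "ok (ct 0)" "ok ?g" "ok (tp [] [])" "ok (tp [Blank] [])"
    "ok (tp (rev (map Inp w) @ [Blank]) [])"
    using assms(2)[of "Some 0"] assms(3) NA by (auto simp: okt_tp oks)
  have e0: "tp [Blank] [] = hm []" by (simp add: hm_def)
  have c0: "tp [] [Aux 0] = ct 0" by (simp add: ct_def tp_def cont_def fun_eq_iff)
  have r0: "act (rg (RV (Some 0)), Stay) (tp [] []) = ?g" by (simp add: rgt_def)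
  have 1: "bs ok (Do5 (\<lambda>q r s n g. [(q, Stay), (Blank, Go_Right), (Blank, Go_Right), (Aux 0, Stay), (rg (RV (Some 0)), Stay)]))
     [tp [] (map Inp w), orc [], tp [] [], tp [] [], tp [] [], tp [] []] [tp [] (map Inp w), orc [], hm [], tp [Blank] [], ct 0, ?g]"
    by (rule bs_DoI) (use oi r0 c0 in \<open>auto simp: e0\<close>)
  have 2: "bs ok (Loop (L6 (\<lambda>i q r s n g. i \<noteq> Blank))
       copy_step)
     [tp [] (map Inp w), orc [], hm [], tp [Blank] [], ct 0, ?g]
     [tp (rev (map Inp w) @ []) [], orc [], hm [], tp (rev (map Inp w) @ [Blank]) [], ct 0, ?g]"
    by (rule copy_input) (use oi assms(3) in auto)
  have ois: "ok (inp_stack (rev w))" using assms(3) by (cases "rev w") (auto simp: inp_stack_def okt_tp)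
  have a: "act (Blank, Go_Left) (tp (rev (map Inp w) @ [Blank]) []) = inp_stack (rev w)"
    by (cases "rev w") (auto simp: inp_stack_def simp flip: rev_map)
  have 3: "bs ok (Do5 (\<lambda>q r s n g. [(q, Stay), (r, Stay), (s, Go_Left), (n, Stay), (g, Stay)]))
     [tp (rev (map Inp w) @ []) [], orc [], hm [], tp (rev (map Inp w) @ [Blank]) [], ct 0, ?g]
     [?i, orc [], hm (map cell0 (snd (tz C []))), inp_stack (rev w), ct 0, rgt (RV (fst (tz C [])))]"
    by (rule bs_DoI) (use oi ois a in auto)
  have 4: "bs ok (Loop (L6 (\<lambda>i q r s n g. s \<noteq> Blank))
       (token_step C))
    [?i, orc [], hm (map cell0 (snd (tz C []))), inp_stack (rev w), ct 0, rgt (RV (fst (tz C [])))]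
    [?i, orc [], hm (map cell0 (snd (tz C (w @ [])))), tp [] [], ct 0, rgt (RV (fst (tz C (w @ []))))]"
    by (rule tokens_loop) (use oi assms in auto)
  have len: "length (snd (tz C w)) = length w" for w by (induction w) auto
  have hh: "act (rw c, Go_Right) (hm u) = hm (c # u)" for c u by (simp add: hm_def)
  have okm: "list_all ok [?i, orc [], hm (map cell0 (snd (tz C (w @ [])))), tp [] [], ct 0, rgt (RV (fst (tz C (w @ []))))]"
    using bs_ok[OF 4] by blast
  have okn: "ok (hm (map cell0 (TRoot # snd (tz C w))))"
    using assms(3) tz_ct_ok[OF assms(1), of w] ct_ok_vc ct_ok_vc[of "cell0 TRoot"] by (auto simp: oks len ct_ok_def)
  have s0: "tp [] [] = stk []" by (simp add: stk_def)
  have 5: "bs ok (Do5 (\<lambda>q r s n g. [(q, Stay), (rw (cell0 TRoot), Go_Right), (s, Stay), (n, Stay), (g, Stay)]))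
     [?i, orc [], hm (map cell0 (snd (tz C (w @ [])))), tp [] [], ct 0, rgt (RV (fst (tz C (w @ []))))]
     [?i, orc [], hm (map cell0 (TRoot # snd (tz C w))), stk [], ct 0, rgt (RV (fst (tz C w)))]"
    by (rule bs_DoI) (use okm okn in \<open>auto simp: hh s0\<close>)
  show ?thesis unfolding tokenize_def using bs_Seq[OF 1 bs_Seq[OF 2 bs_Seq[OF 3 bs_Seq[OF 4 5]]]] .
qed

text \<open>If the test fails the row head and the counter stop anywhere, hence the existential; the
  machine rejects from there.\<close>

lemma check:
  fixes cs :: "rcell list" and parses :: bool
  assumes "ok i" "ok (orc w)" "ok (stk [])" "to_nat g < NA" "to_nat reg_start < NA" "to_nat reg_fail < NA"
    "length cs + 3 < B" "\<forall>c\<in>set cs. ct_ok c"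
  defines "parses \<equiv> ari 1 (map tk cs) \<and> g = RV (Some 0)"
  shows "\<exists>r k. bs ok check [i, orc w, hm cs, stk [], ct 0, rgt g]
    [i, orc w, r, stk [], ct k, rgt (if parses then reg_start else reg_fail)] \<and> (parses \<longrightarrow> r = hm cs \<and> k = 0)"
proof -
  have o: "ok (rgt g)" "ok (rgt reg_start)" "ok (rgt reg_fail)" using assms by (auto simp: oks)
  have vcs: "\<forall>c\<in>set cs. vc c" using assms ct_ok_vc by blast
  obtain r where r: "cs = tf 1 cs @ r" using tf_prefix by blast
  have dr: "drop (length (tf 1 cs)) cs = r" by (subst (2) r) simp
  have lu: "length cs = length (tf 1 cs) + length r" by (subst r) simp
  have su: "set cs = set (tf 1 cs) \<union> set r" by (subst r) simp
  have f: "fin 1 cs < B" using fin_le[of 1 cs] assms by simp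
  let ?r = "rowt r (rev (tf 1 cs))" and ?k = "fin 1 cs"
  let ?g = "rgt (if parses then reg_start else reg_fail)"
  have okr: "ok ?r" using lu assms(7) vcs by (auto simp: oks su)
  have gd: "parses \<longleftrightarrow> r = [] \<and> ?k = 0 \<and> g = RV (Some 0)"
  proof -
    have "tf 1 cs = cs \<longleftrightarrow> r = []"
    proof
      assume "tf 1 cs = cs"
      then show "r = []" using lu by simp
    next
      assume "r = []"
      then show "tf 1 cs = cs" using r by simp
    qed
    then show ?thesis unfolding parses_def ari_fin by blast
  qed
  have 1: "bs ok (Do5 (\<lambda>q r s n g. [(q, Stay), (r, Stay), (s, Stay), (n, Go_Right), (g, Stay)]))
     [i, orc w, hm cs, stk [], ct 0, rgt g] [i, orc w, hm cs, stk [], ct 1, rgt g]"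
    by (rule bs_DoI) (use assms(1-8) o vcs in \<open>auto simp: oks\<close>)
  have 2: "bs ok row_left [i, orc w, hm cs, stk [], ct 1, rgt g] [i, orc w, rowt cs [], stk [], ct 1, rgt g]"
    by (rule row_left) (use assms(1-8) o vcs in \<open>auto simp: oks\<close>)
  have e0: "concat (map (\<lambda>_. []) xs) = ([] :: sym list)" for xs :: "rcell list" by (induction xs) auto
  have 3: "bs ok (emitf 0 (\<lambda>_. [])) [i, orc w, rowt cs [], stk [], ct 1, rgt g] [i, orc w, ?r, stk [], ct ?k, rgt g]"
    using emitf[of i "stk []" "rgt g" cs "[]" "\<lambda>_. []" 0 w 1] assms(1-8) o vcs
    unfolding dr by (simp add: oks e0)
  have 4: "bs ok (Do5 (\<lambda>q r s n g. [(q, Stay), (r, Stay), (s, Stay), (n, Stay),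
       (if r = Blank \<and> n = Aux 0 \<and> dg g = RV (Some 0) then rg reg_start else rg reg_fail, Stay)]))
     [i, orc w, ?r, stk [], ct ?k, rgt g] [i, orc w, ?r, stk [], ct ?k, ?g]"
  proof (rule bs_DoI)
    show "list_all ok [i, orc w, ?r, stk [], ct ?k, rgt g]" "list_all ok [i, orc w, ?r, stk [], ct ?k, ?g]"
      using assms(1-8) o okr f by (auto simp: oks)
    have rb: "read ?r = Blank \<longleftrightarrow> r = []" by (cases r) auto
    have nb: "read (ct ?k) = Aux 0 \<longleftrightarrow> ?k = 0" by simp
    let ?G = "if parses then reg_start else reg_fail"
    have G: "rg ?G = (if read ?r = Blank \<and> read (ct ?k) = Aux 0 \<and> dg (rg g) = RV (Some 0) then rg reg_start else rg reg_fail)"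
      unfolding rb nb gd by simp
    show "map2 act [(read i, Stay), (read (orc w), Stay), (read ?r, Stay), (read (stk []), Stay), (read (ct ?k), Stay), (rg ?G, Stay)]
       [i, orc w, ?r, stk [], ct ?k, rgt g] = [i, orc w, ?r, stk [], ct ?k, ?g]"
      by (simp only: map2_map_map act_read list.map zip_Cons_Cons prod.case zip_Nil act_rgt)
    show "L6 (\<lambda>i q r s n g. (i, Stay) # [(q, Stay), (r, Stay), (s, Stay), (n, Stay),
       (if r = Blank \<and> n = Aux 0 \<and> dg g = RV (Some 0) then rg reg_start else rg reg_fail, Stay)])
       (map read [i, orc w, ?r, stk [], ct ?k, rgt g]) =
       [(read i, Stay), (read (orc w), Stay), (read ?r, Stay), (read (stk []), Stay), (read (ct ?k), Stay), (rg ?G, Stay)]"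
      unfolding G by (simp only: list.map L6_simp read_rgt)
  qed simp
  have "dg (rg reg_fail) \<noteq> dg (rg reg_start)" by (simp add: reg_fail_def reg_start_def)
  then have ne: "rg reg_fail \<noteq> rg reg_start" by metis
  show ?thesis
  proof (cases parses)
    case True
    then have k: "r = []" "?k = 0" using gd by auto
    then have e: "rev (rev (tf 1 cs)) @ r = cs" using r by simp
    have "bs ok home [i, orc w, ?r, stk [], ct ?k, ?g] [i, orc w, hm (rev (rev (tf 1 cs)) @ r), stk [], ct ?k, ?g]"
      by (rule home) (use assms(1-8) o f lu in \<open>auto simp: oks su\<close>)
    then have 5: "bs ok (Cond (L6 (\<lambda>i q r s n g. g = rg reg_start)) home Skip)
       [i, orc w, ?r, stk [], ct ?k, ?g] [i, orc w, hm cs, stk [], ct ?k, ?g]"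
      unfolding e using True by (intro bs_CondT) auto
    show ?thesis unfolding check_def using bs_Seq[OF 1 bs_Seq[OF 2 bs_Seq[OF 3 bs_Seq[OF 4 5]]]] k
      by (intro exI[of _ "hm cs"] exI[of _ 0]) simp
  next
    case False
    have "bs ok Skip [i, orc w, ?r, stk [], ct ?k, ?g] [i, orc w, ?r, stk [], ct ?k, ?g]"
      using bs_ok[OF 4] by (auto intro!: bs_Skip)
    then have 5: "bs ok (Cond (L6 (\<lambda>i q r s n g. g = rg reg_start)) home Skip)
       [i, orc w, ?r, stk [], ct ?k, ?g] [i, orc w, ?r, stk [], ct ?k, ?g]"
      using False ne by (intro bs_CondF) auto
    show ?thesis unfolding check_def using bs_Seq[OF 1 bs_Seq[OF 2 bs_Seq[OF 3 bs_Seq[OF 4 5]]]] False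
      by (intro exI[of _ ?r] exI[of _ ?k] conjI impI) simp_all
  qed
qed

end

section \<open>The search\<close>

text \<open>Legality of a choice is a condition on single cells, apart from the nonemptiness of
  \<open>Y\<close>, for which \<open>wit\<close> looks for one cell. Two Booleans thus decide it in
  one sweep; the oracle answer enters for \<open>KD\<close>.\<close>

fun fits :: "bool \<Rightarrow> rcell \<Rightarrow> bool" where
  "fits b (RC t KT T X Y Z M) \<longleftrightarrow> (t = TRoot \<longrightarrow> Z) \<and> (Z \<longrightarrow> is_mod t)"
| "fits b (RC t KP T X Y Z M) \<longleftrightarrow> (Z \<longrightarrow> X)"
| "fits b (RC t KD T X Y Z M) \<longleftrightarrow> (Z \<longrightarrow> X \<and> \<not> Y) \<and> b"

definition wit :: "rcell \<Rightarrow> bool" where "wit c \<longleftrightarrow> (kd c = KP \<longrightarrow> fZ c)"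

text \<open>The chosen track moves to its role in the next position: \<open>T\<close> and
  \<open>X\<close> after \<open>KT\<close>, \<open>Y\<close> after \<open>KP\<close>, the new
  \<open>X\<close> after \<open>KD\<close>. The new last track is empty, where the enumeration
  starts.\<close>

fun ch :: "rcell \<Rightarrow> rcell" where
  "ch (RC t KT T X Y Z M) = RC t KP Z Z False False False"
| "ch (RC t KP T X Y Z M) = RC t KD T X Z False False"
| "ch (RC t KD T X Y Z M) = RC t KP T Z False False False"

definition setZ :: "bool \<Rightarrow> rcell \<Rightarrow> rcell" where
  "setZ z c = RC (tk c) (kd c) (fT c) (fX c) (fY c) z (fM c)"

fun pop :: "reg \<Rightarrow> bool" where
  "pop (RG m k a b1 b2) \<longleftrightarrow> m = PopL \<or> m = PopN"
| "pop (RV x) = False"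

text \<open>In mode \<open>Next\<close> the first Boolean is the carry of a binary increment of the
  last track, least significant cell first; in mode \<open>Try\<close> the two Booleans accumulate
  legality.\<close>

fun fs :: "reg \<Rightarrow> rcell \<Rightarrow> reg \<times> rcell" where
  "fs (RG Try k a b1 b2) c = (RG Try (kd c) a (b1 \<and> fits a c) (b2 \<or> wit c), c)"
| "fs (RG Next k a b1 b2) c = (RG Next (kd c) a (b1 \<and> fZ c) b2, setZ (fZ c \<noteq> b1) c)"
| "fs (RG Lose k a b1 b2) c = (RG Lose (kd c) a b1 b2, c)"
| "fs g c = (g, c)"

text \<open>Depth-first evaluation: when the choices on a row are exhausted, the choice on the row
  below it on the stack was good (\<open>PopL\<close>); a good choice refutes the one before it,
  whose successor is tried (\<open>PopN\<close>). For the choice of \<open>T\<close> these outcomes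
  are \<open>Rej\<close> and \<open>Acc\<close>.\<close>

fun mid :: "reg \<Rightarrow> reg" where
  "mid (RG Try k a b1 b2) = RG (if b1 \<and> b2 then Push else Next) k a b1 b2"
| "mid (RG Next k a b1 b2) = RG (if b1 then if k = KT then Rej else PopL else Try) k a b1 b2"
| "mid (RG Lose k a b1 b2) = RG (if k = KT then Acc else PopN) k a b1 b2"
| "mid (RG PopL k a b1 b2) = RG Lose k a b1 b2"
| "mid (RG PopN k a b1 b2) = RG Next k a b1 b2"
| "mid g = g"

fun psh :: "reg \<Rightarrow> bool" where
  "psh (RG m k a b1 b2) \<longleftrightarrow> m = Push"
| "psh (RV x) = False"

text \<open>Stores the answer and resets the accumulators to the neutral elements of \<and> and
  \<or>, \<open>True\<close> being also the initial carry. \<open>Push\<close> has had its effect in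
  the backward half of the sweep.\<close>

fun nrm :: "bool \<Rightarrow> reg \<Rightarrow> reg" where
  "nrm b (RG m k a b1 b2) = RG (if m = Push then Try else m) k b True False"
| "nrm b (RV x) = RV x"

fun verdict :: "reg \<Rightarrow> bool option" where
  "verdict (RG Acc k a b1 b2) = Some True"
| "verdict (RG Rej k a b1 b2) = Some False"
| "verdict g = None"

abbreviation decided :: "sym cell list \<Rightarrow> bool" where
  "decided \<equiv> L6 (\<lambda>i q r s n g. verdict (dg g) \<noteq> None)"

text \<open>A blank register identifies the first round, since register codes are never
  blank.\<close>

definition prog :: "nat \<Rightarrow> nat \<Rightarrow> nat \<Rightarrow> nat \<Rightarrow> com" where
  "prog C K s a = Cond (L6 (\<lambda>i q r s n g. g = Blank)) (initialize C) (sweep pop fs mid psh ch) ;;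
     Cond decided Skip (build_query K (emit s a))"

definition ans :: "bool \<Rightarrow> sym cell list \<Rightarrow> acts" where
  "ans b = L6 (\<lambda>i q r s n g. [(i, Stay), (q, Stay), (r, Stay), (s, Stay), (n, Stay), (rg (nrm b (dg g)), Stay)])"

definition tst :: "sym cell list \<Rightarrow> bool option" where
  "tst = L6 (\<lambda>i q r s n g. verdict (dg g))"

section \<open>The search as an abstract machine on rows and stacks\<close>

primrec inc :: "bool \<Rightarrow> rcell list \<Rightarrow> bool \<times> rcell list" where
  "inc b [] = (b, [])"
| "inc b (c # u) = (fst (inc (b \<and> fZ c) u), setZ (fZ c \<noteq> b) c # snd (inc (b \<and> fZ c) u))"

lemma length_inc [simp]: "length (snd (inc b u)) = length u"
  by (induction u arbitrary: b) auto

definition legal :: "bool \<Rightarrow> rcell list \<Rightarrow> bool" where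
  "legal b u \<longleftrightarrow> (\<forall>c\<in>set u. fits b c) \<and> (\<exists>c\<in>set u. wit c)"

abbreviation kdr :: "rcell list \<Rightarrow> kind" where "kdr u \<equiv> kd (last u)"

text \<open>The oracle answer for the current row is available as \<open>q u\<close>, because a
  round that does not halt ends with the query of the row left on the tape.\<close>

fun dstep :: "(rcell list \<Rightarrow> bool) \<Rightarrow> mode \<times> rcell list \<times> rcell list list \<Rightarrow> mode \<times> rcell list \<times> rcell list list" where
  "dstep q (Try, u, st) = (if legal (q u) u then (Try, map ch u, u # st) else (Next, u, st))"
| "dstep q (Next, u, st) = (if fst (inc True u) then if kdr u = KT then Rej else PopL else Try, snd (inc True u), st)"
| "dstep q (Lose, u, st) = (if kdr u = KT then Acc else PopN, u, st)"
| "dstep q (PopL, u, st) = (Lose, hd st, tl st)"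
| "dstep q (PopN, u, st) = (Next, hd st, tl st)"
| "dstep q x = x"

lemma mealy_Try: "mealy fs (RG Try k a b1 b2) u =
   (RG Try (if u = [] then k else kdr u) a (b1 \<and> (\<forall>c\<in>set u. fits a c)) (b2 \<or> (\<exists>c\<in>set u. wit c)), u)"
  by (induction u arbitrary: k b1 b2) auto

lemma mealy_Next: "mealy fs (RG Next k a b1 b2) u =
   (RG Next (if u = [] then k else kdr u) a (fst (inc b1 u)) b2, snd (inc b1 u))"
  by (induction u arbitrary: k b1) auto

lemma mealy_Lose: "mealy fs (RG Lose k a b1 b2) u = (RG Lose (if u = [] then k else kdr u) a b1 b2, u)"
  by (induction u arbitrary: k) auto

lemma tk_setZ [simp]: "tk (setZ z c) = tk c" by (simp add: setZ_def)
lemma tk_ch [simp]: "tk (ch c) = tk c" by (cases c rule: ch.cases) auto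

inductive arun :: "(rcell list \<Rightarrow> bool) \<Rightarrow> (rcell list \<Rightarrow> bool) \<Rightarrow> nat \<Rightarrow> mode \<times> rcell list \<times> rcell list list \<Rightarrow> bool \<Rightarrow> bool"
  for ro q lim where
  arun_Acc: "arun ro q lim (Acc, x) True"
| arun_Rej: "arun ro q lim (Rej, x) False"
| arun_step: "m \<in> {Try, Next, Lose, PopL, PopN} \<Longrightarrow> ro u \<Longrightarrow> \<forall>x\<in>set st. ro x \<Longrightarrow> length st \<le> lim \<Longrightarrow>
    m \<in> {PopL, PopN} \<longrightarrow> st \<noteq> [] \<Longrightarrow>
    arun ro q lim (dstep q (m, u, st)) b \<Longrightarrow> arun ro q lim (m, u, st) b"

locale prog_space = space_tok NA B C for NA B C +
  fixes s a K n lim :: nat and ro :: "rcell list \<Rightarrow> bool" and Q :: "sym list set"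
  assumes C: "0 < C"
    and regs: "to_nat (RG m k b b1 b2) < NA"
    and rvs: "(\<And>x. v = Some x \<Longrightarrow> x \<le> C) \<Longrightarrow> to_nat (RV v) < NA"
    and ro_len: "ro u \<Longrightarrow> length u = n"
    and ro_ct: "ro u \<Longrightarrow> \<forall>c\<in>set u. ct_ok c"
    and ro_unmarked: "ro u \<Longrightarrow> \<forall>c\<in>set u. \<not> fM c"
    and ro_complete: "ro u \<Longrightarrow> complete u"
    and ro_emit: "ro u \<Longrightarrow> \<forall>c\<in>set u. length (emit s a c) \<le> K"
    and ro_q: "ro u \<Longrightarrow> length (qword s a u) < B"
    and ro_ch: "ro u \<Longrightarrow> ro (map ch u)"
    and ro_inc: "ro u \<Longrightarrow> ro (snd (inc True u))"
    and n: "0 < n" and B1: "n + 4 < B" and B2: "n * (lim + 2) < B"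
begin

abbreviation q where "q u \<equiv> qword s a u \<in> Q"

lemma length_concat_ro: "\<forall>x\<in>set st. ro x \<Longrightarrow> length (concat st) = n * length st"
  by (induction st) (auto simp: ro_len)

text \<open>The register shows \<open>Push\<close> where the abstract machine is already in mode
  \<open>Try\<close> on the new row; \<open>nrm\<close> removes the difference after the
  query.\<close>

lemma round_sweep:
  assumes i: "ok i" and w: "ok (orc w)" and m: "m \<in> {Try, Next, Lose, PopL, PopN}" and u: "ro u" "\<forall>x\<in>set st. ro x"
    and l: "length st \<le> lim" and st: "m \<in> {PopL, PopN} \<longrightarrow> st \<noteq> []"
    and d: "dstep q (m, u, st) = (m', u', st')"
  shows "\<exists>k' b1 b2. bs ok (sweep pop fs mid psh ch)
     [i, orc w, hm u, stk (concat st), ct 0, rgt (RG m k (q u) True False)]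
     [i, orc w, hm u', stk (concat st'), ct 0, rgt (RG (if m = Try \<and> m' = Try then Push else m') k' (q u) b1 b2)]
     \<and> ro u' \<and> (\<forall>x\<in>set st'. ro x)"
proof -
  let ?g = "RG m k (q u) True False"
  have ne: "u \<noteq> []" using ro_len[OF u(1)] n by auto
  have B0: "0 < B" using B1 by simp
  have o: "ok (ct 0)" using B0 by (simp add: oks)
  have ls: "length (concat st) = n * length st" using length_concat_ro u by blast
  have "n * length st \<le> n * lim" using l by simp
  then have lb: "n * length st + n < B" using B2 unfolding distrib_left by linarith
  have cu: "\<forall>c\<in>set u \<union> set (concat st). ct_ok c" using u ro_ct by auto
  have vs: "ok (stk (concat st))" using lb ls cu ct_ok_vc by (auto simp: ok_stk)
  have fsg: "to_nat (fst (fs g c)) < NA" if "to_nat g < NA" for g c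
    using that by (cases "(g, c)" rule: fs.cases) (auto simp: regs)
  have fsc: "ct_ok (snd (fs g c))" if "ct_ok c" for g c
    using that by (cases "(g, c)" rule: fs.cases) (auto simp: ct_ok_def)
  have fsp: "\<not> pop (fst (fs g c))" if "\<not> pop g" for g c
    using that by (cases "(g, c)" rule: fs.cases) auto
  have fspp: "fst (fs g c) = g" if "pop g" for g c
    using that by (cases "(g, c)" rule: fs.cases) auto
  have midg: "to_nat (mid g) < NA" if "to_nat g < NA" for g
    using that by (cases g rule: mid.cases) (auto simp: regs)
  have fwd: "bs ok (forward pop fs) [i, orc w, rowt u [], stk (concat st), ct 0, rgt ?g]
    [i, orc w, rowt [] (rev (snd (mealy fs ?g u))), stk (concat st), ct 0, rgt (fst (mealy fs ?g u))]"
    if "\<not> pop ?g"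
    using forward[of i "orc w" "ct 0" "concat st" pop ?g u "[]" fs] i w o vs that ro_len[OF u(1)] B1 cu fsg fsc fsp regs
    by auto
  have sw: "bs ok (sweep pop fs mid psh ch) [i, orc w, hm u, stk (concat st), ct 0, rgt ?g]
    [i, orc w, hm (if psh (mid g') then map ch v' else v'),
     stk (if psh (mid g') then v' @ S' else S'), ct 0, rgt (mid g')]"
    if "bs ok (forward pop fs) [i, orc w, rowt u [], stk (concat st), ct 0, rgt ?g]
       [i, orc w, rowt [] (rev v'), stk S', ct 0, rgt g']" "length v' = n" "\<forall>c\<in>set v' \<union> set S'. ct_ok c"
      "length (v' @ S') < B" "to_nat g' < NA" for v' S' g'
    by (rule sweep) (use that i w o lb ls cu regs midg ro_len[OF u(1)] B1 in auto)
  from m consider "m = Try" | "m = Next" | "m = Lose" | "m = PopL \<or> m = PopN" by blast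
  then show ?thesis
  proof cases
    case 1
    let ?g' = "fst (mealy fs ?g u)"
    have g': "?g' = RG Try (kdr u) (q u) (\<forall>c\<in>set u. fits (q u) c) (\<exists>c\<in>set u. wit c)" and e: "snd (mealy fs ?g u) = u"
      using ne 1 by (simp_all add: mealy_Try)
    have "bs ok (sweep pop fs mid psh ch) [i, orc w, hm u, stk (concat st), ct 0, rgt ?g]
      [i, orc w, hm (if psh (mid ?g') then map ch u else u),
       stk (if psh (mid ?g') then u @ concat st else concat st), ct 0, rgt (mid ?g')]"
      by (rule sw) (use fwd[unfolded e] 1 ro_len[OF u(1)] cu lb ls regs g' in auto)
    moreover have "mid ?g' = RG (if legal (q u) u then Push else Next) (kdr u) (q u)
        (\<forall>c\<in>set u. fits (q u) c) (\<exists>c\<in>set u. wit c)" unfolding g' by (auto simp: legal_def)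
    ultimately have "bs ok (sweep pop fs mid psh ch)
     [i, orc w, hm u, stk (concat st), ct 0, rgt (RG m k (q u) True False)]
     [i, orc w, hm u', stk (concat st'), ct 0, rgt (RG (if m = Try \<and> m' = Try then Push else m') (kdr u) (q u) (\<forall>c\<in>set u. fits (q u) c) (\<exists>c\<in>set u. wit c))]
     \<and> ro u' \<and> (\<forall>x\<in>set st'. ro x)"
      using d 1 u ro_ch by (cases "legal (q u) u") auto
    then show ?thesis by (intro exI)
  next
    case 2
    let ?g' = "fst (mealy fs ?g u)" and ?u = "snd (inc True u)"
    have g': "?g' = RG Next (kdr u) (q u) (fst (inc True u)) False" and e: "snd (mealy fs ?g u) = ?u"
      using ne 2 by (simp_all add: mealy_Next)
    have r: "ro ?u" using ro_inc u by blast
    have "bs ok (sweep pop fs mid psh ch) [i, orc w, hm u, stk (concat st), ct 0, rgt ?g]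
      [i, orc w, hm (if psh (mid ?g') then map ch ?u else ?u),
       stk (if psh (mid ?g') then ?u @ concat st else concat st), ct 0, rgt (mid ?g')]"
      by (rule sw) (use fwd[unfolded e] 2 ro_len[OF u(1)] cu lb ls regs g' r ro_ct in auto)
    moreover have "mid ?g' = RG m' (kdr u) (q u) (fst (inc True u)) False" using d 2 unfolding g' by auto
    moreover have "m' \<noteq> Push" using d 2 by (auto split: if_splits)
    ultimately have "bs ok (sweep pop fs mid psh ch)
     [i, orc w, hm u, stk (concat st), ct 0, rgt (RG m k (q u) True False)]
     [i, orc w, hm u', stk (concat st'), ct 0, rgt (RG (if m = Try \<and> m' = Try then Push else m') (kdr u) (q u) (fst (inc True u)) (False))]
     \<and> ro u' \<and> (\<forall>x\<in>set st'. ro x)"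
      using d 2 u r by auto
    then show ?thesis by (intro exI)
  next
    case 3
    let ?g' = "fst (mealy fs ?g u)"
    have g': "?g' = RG Lose (kdr u) (q u) True False" and e: "snd (mealy fs ?g u) = u"
      using ne 3 by (simp_all add: mealy_Lose)
    have "bs ok (sweep pop fs mid psh ch) [i, orc w, hm u, stk (concat st), ct 0, rgt ?g]
      [i, orc w, hm (if psh (mid ?g') then map ch u else u),
       stk (if psh (mid ?g') then u @ concat st else concat st), ct 0, rgt (mid ?g')]"
      by (rule sw) (use fwd[unfolded e] 3 ro_len[OF u(1)] cu lb ls regs g' in auto)
    moreover have "mid ?g' = RG m' (kdr u) (q u) True False" using d 3 unfolding g' by auto
    moreover have "m' \<noteq> Push" using d 3 by (auto split: if_splits)
    ultimately have "bs ok (sweep pop fs mid psh ch)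
     [i, orc w, hm u, stk (concat st), ct 0, rgt (RG m k (q u) True False)]
     [i, orc w, hm u', stk (concat st'), ct 0, rgt (RG (if m = Try \<and> m' = Try then Push else m') (kdr u) (q u) (True) (False))]
     \<and> ro u' \<and> (\<forall>x\<in>set st'. ro x)"
      using d 3 u by auto
    then show ?thesis by (intro exI)
  next
    case 4
    then obtain x st1 where x: "st = x # st1" using st by (cases st) auto
    have "bs ok (forward pop fs) [i, orc w, rowt u [], stk (x @ concat st1), ct 0, rgt ?g]
      [i, orc w, rowt [] (rev x @ []), stk (concat st1), ct 0, rgt ?g]"
      by (rule forward_pop) (use 4 i w o lb ls cu regs fspp ro_len[OF u(1)] ro_len[of x] u(2) x B1 in auto)
    then have F: "bs ok (forward pop fs) [i, orc w, rowt u [], stk (concat st), ct 0, rgt ?g]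
      [i, orc w, rowt [] (rev x), stk (concat st1), ct 0, rgt ?g]" by (simp add: x)
    have "bs ok (sweep pop fs mid psh ch) [i, orc w, hm u, stk (concat st), ct 0, rgt ?g]
      [i, orc w, hm (if psh (mid ?g) then map ch x else x),
       stk (if psh (mid ?g) then x @ concat st1 else concat st1), ct 0, rgt (mid ?g)]"
      by (rule sw[OF F]) (use cu lb ls regs ro_len[of x] u(2) x in auto)
    moreover have "mid ?g = RG m' k (q u) True False" using d 4 by auto
    moreover have "m' \<noteq> Push" using d 4 by (auto split: if_splits)
    ultimately have "bs ok (sweep pop fs mid psh ch)
     [i, orc w, hm u, stk (concat st), ct 0, rgt (RG m k (q u) True False)]
     [i, orc w, hm u', stk (concat st'), ct 0, rgt (RG (if m = Try \<and> m' = Try then Push else m') (k) (q u) (True) (False))]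
     \<and> ro u' \<and> (\<forall>x\<in>set st'. ro x)"
      using d 4 u x by auto
    then show ?thesis by (intro exI)
  qed
qed

lemma arun_mrun:
  assumes i: "ok i"
  shows "arun ro q lim x b \<Longrightarrow> (case x of (m, u, st) \<Rightarrow> m \<in> {Try, Next, Lose, PopL, PopN} \<longrightarrow>
    (\<forall>w k. ok (orc w) \<longrightarrow> mrun ok (prog C K s a) ans tst Q
      [i, orc w, hm u, stk (concat st), ct 0, rgt (RG m k (q u) True False)] b))"
proof (induction rule: arun.induct)
  case (arun_step m u st b)
  obtain m' u' st' where d: "dstep q (m, u, st) = (m', u', st')" by (cases "dstep q (m, u, st)")
  show ?case unfolding prod.case
  proof (intro impI allI)
    fix w k assume w: "ok (orc w)"
    from round_sweep[OF i w arun_step(1-5) d, of k] obtain k' b1 b2 where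
      1: "bs ok (sweep pop fs mid psh ch)
       [i, orc w, hm u, stk (concat st), ct 0, rgt (RG m k (q u) True False)]
       [i, orc w, hm u', stk (concat st'), ct 0, rgt (RG (if m = Try \<and> m' = Try then Push else m') k' (q u) b1 b2)]"
      and r: "ro u'" "\<forall>x\<in>set st'. ro x" by blast
    let ?g = "RG (if m = Try \<and> m' = Try then Push else m') k' (q u) b1 b2"
    have ok1: "list_all ok [i, orc w, hm u', stk (concat st'), ct 0, rgt ?g]" using bs_ok[OF 1] by blast
    have 2: "bs ok (Cond (L6 (\<lambda>i q r s n g. g = Blank)) (initialize C) (sweep pop fs mid psh ch))
       [i, orc w, hm u, stk (concat st), ct 0, rgt (RG m k (q u) True False)]
       [i, orc w, hm u', stk (concat st'), ct 0, rgt ?g]"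
      by (rule bs_CondF[OF _ 1]) simp
    have mm: "m' \<in> {Try, Next, Lose, PopL, PopN, Acc, Rej}" using d arun_step(1) by (auto split: if_splits)
    show "mrun ok (prog C K s a) ans tst Q [i, orc w, hm u, stk (concat st), ct 0, rgt (RG m k (q u) True False)] b"
    proof (cases "m' \<in> {Acc, Rej}")
      case True
      then have v: "verdict ?g = Some b"
        using arun_step(6) d by (auto elim: arun.cases)
      have 3: "bs ok (Cond decided Skip (build_query K (emit s a)))
         [i, orc w, hm u', stk (concat st'), ct 0, rgt ?g] [i, orc w, hm u', stk (concat st'), ct 0, rgt ?g]"
        by (rule bs_CondT[OF _ bs_Skip[OF ok1]]) (use v in simp)
      show ?thesis
        by (rule mrun_halt[OF bs_Seq[OF 2 3, folded prog_def]]) (use v in \<open>simp add: tst_def\<close>)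
    next
      case False
      then have m': "m' \<in> {Try, Next, Lose, PopL, PopN}" using mm by blast
      have v: "verdict ?g = None" using m' by auto
      let ?w = "qword s a u'"
      have q3: "bs ok (build_query K (emit s a)) [i, orc w, hm u', stk (concat st'), ct 0, rgt ?g]
         [i, orc ?w, hm u', stk (concat st'), ct 0, rgt ?g]"
        by (rule build_query) (use i w ok1 r ro_unmarked ro_complete ro_emit ro_ct ro_q ro_len B1 in \<open>auto simp: oks\<close>)
      have 3: "bs ok (Cond decided Skip (build_query K (emit s a)))
         [i, orc w, hm u', stk (concat st'), ct 0, rgt ?g] [i, orc ?w, hm u', stk (concat st'), ct 0, rgt ?g]"
        by (rule bs_CondF[OF _ q3]) (use v in simp)
      let ?ts = "[i, orc ?w, hm u', stk (concat st'), ct 0, rgt ?g]"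
      have ok3: "list_all ok ?ts" using bs_ok[OF 3] by blast
      let ?g2 = "RG m' k' (q u') True False"
      have n2: "nrm (q u') ?g = ?g2" using m' by auto
      have an: "ans b' (map read ?ts) = [(read i, Stay), (Blank, Stay), (Blank, Stay), (Blank, Stay),
          (Aux 0, Stay), (rg (nrm b' ?g), Stay)]" for b'
        by (simp add: ans_def del: nrm.simps)
      have qw: "query_word (?ts ! 1) = ?w" by simp
      have okg2: "ok (rgt ?g2)" using ok3 regs by (simp add: oks)
      show ?thesis
      proof (rule mrun_ask[OF bs_Seq[OF 2 3, folded prog_def]])
        show "tst (map read ?ts) = None" using v by (simp add: tst_def)
        show "length (ans (query_word (?ts ! 1) \<in> Q) (map read ?ts)) = length ?ts" by (simp add: ans_def)
        show "list_all ok [i, orc ?w, hm u', stk (concat st'), ct 0, rgt ?g2]" using ok3 okg2 by simp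
        show "[i, orc ?w, hm u', stk (concat st'), ct 0, rgt ?g2] =
          map2 act (ans (query_word (?ts ! 1) \<in> Q) (map read ?ts)) ?ts"
          unfolding qw an n2 by simp
        show "mrun ok (prog C K s a) ans tst Q [i, orc ?w, hm u', stk (concat st'), ct 0, rgt ?g2] b"
          by (rule arun_step.IH[unfolded d prod.case, rule_format, OF m']) (use ok3 in simp)
      qed
    qed
  qed
qed simp_all

end

subsection \<open>Enumeration of the subsets of the row\<close>

lemma rows_cong: "(\<And>i t. k \<le> i \<Longrightarrow> F i t = G i t) \<Longrightarrow> rows F k ts = rows G k ts"
  by (induction ts arbitrary: k) auto

text \<open>Covers the overflow too: the track has been overwritten when the carry is noticed at the
  end of the row.\<close>

lemma inc_some: "\<exists>Z'. snd (inc b (rows (mkc kn T X Y Z) k ts)) = rows (mkc kn T X Y Z') k ts"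
proof (induction ts arbitrary: b k)
  case (Cons t ts)
  let ?b = "b \<and> k \<in> Z"
  obtain Z' where Z': "snd (inc ?b (rows (mkc kn T X Y Z) (Suc k) ts)) = rows (mkc kn T X Y Z') (Suc k) ts"
    using Cons by blast
  let ?Z = "{i. if i = k then (k \<in> Z) \<noteq> b else i \<in> Z'}"
  have "rows (mkc kn T X Y Z') (Suc k) ts = rows (mkc kn T X Y ?Z) (Suc k) ts"
    by (rule rows_cong) (auto simp: mkc_def)
  moreover have "setZ ((k \<in> Z) \<noteq> b) (mkc kn T X Y Z k t) = mkc kn T X Y ?Z k t"
    by (simp add: setZ_def mkc_def)
  ultimately have "snd (inc b (rows (mkc kn T X Y Z) k (t # ts))) = rows (mkc kn T X Y ?Z) k (t # ts)"
    using Z' by simp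
  then show ?case by blast
qed simp

lemma Suc_eq_double: "Suc z = 2 * p \<longleftrightarrow> odd z \<and> Suc (z div 2) = p" for p :: nat
  by presburger

lemma add_of_bool_div: "(z + of_bool b) div 2 = z div 2 + of_bool (b \<and> odd z)" for z :: nat
proof (cases b)
  case True
  have "Suc z div 2 = z div 2 + (if odd z then 1 else 0)" by presburger
  then show ?thesis using True by simp
qed simp

text \<open>The last track of a row, read as a binary number, is incremented.\<close>

lemma inc_rows:
  "z < 2 ^ length ts \<Longrightarrow>
    (fst (inc b (rows (mkc kn T X Y {i. bit z (i - k)}) k ts)) \<longleftrightarrow> b \<and> Suc z = 2 ^ length ts) \<and>
    (\<not> (b \<and> Suc z = 2 ^ length ts) \<longrightarrow> snd (inc b (rows (mkc kn T X Y {i. bit z (i - k)}) k ts)) =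
      rows (mkc kn T X Y {i. bit (z + of_bool b) (i - k)}) k ts)"
proof (induction ts arbitrary: b k z)
  case Nil
  then show ?case by simp
next
  case (Cons t ts)
  let ?z = "z div 2" and ?b = "b \<and> odd z"
  have e: "rows (mkc kn T X Y {i. bit z (i - k)}) (Suc k) ts =
      rows (mkc kn T X Y {i. bit (z div 2) (i - Suc k)}) (Suc k) ts" for z :: nat
  proof (rule rows_cong)
    fix i t assume i: "Suc k \<le> i"
    then have "i - k = Suc (i - Suc k)" by simp
    then have "bit z (i - k) \<longleftrightarrow> bit (z div 2) (i - Suc k)" by (simp add: bit_Suc)
    then show "mkc kn T X Y {i. bit z (i - k)} i t = mkc kn T X Y {i. bit (z div 2) (i - Suc k)} i t"
      by (simp add: mkc_def)
  qed
  have b0: "k \<in> {i. bit z (i - k)} \<longleftrightarrow> odd z" for z :: nat by (simp add: bit_0)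
  have l: "?z < 2 ^ length ts" using Cons.prems by (intro less_mult_imp_div_less) (simp add: mult.commute)
  have d: "b \<and> Suc z = 2 ^ length (t # ts) \<longleftrightarrow> ?b \<and> Suc ?z = 2 ^ length ts"
    using Suc_eq_double[of z "2 ^ length ts"] by auto
  note IH = Cons.IH[OF l, of ?b "Suc k"]
  have s: "setZ (odd z \<noteq> b) (mkc kn T X Y {i. bit z (i - k)} k t) = mkc kn T X Y {i. bit (z + of_bool b) (i - k)} k t"
    by (cases b) (auto simp: setZ_def mkc_def bit_0)
  show ?case unfolding d
  proof (intro conjI impI)
    show "fst (inc b (rows (mkc kn T X Y {i. bit z (i - k)}) k (t # ts))) \<longleftrightarrow> ?b \<and> Suc ?z = 2 ^ length ts"
      unfolding rows.simps inc.simps mkc_sel b0 fst_conv e[of z] using IH by blast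
    assume "\<not> (?b \<and> Suc ?z = 2 ^ length ts)"
    then show "snd (inc b (rows (mkc kn T X Y {i. bit z (i - k)}) k (t # ts))) =
        rows (mkc kn T X Y {i. bit (z + of_bool b) (i - k)}) k (t # ts)"
      unfolding rows.simps inc.simps mkc_sel b0 snd_conv s e[of z] e[of "z + of_bool b"] add_of_bool_div
      using IH by simp
  qed
qed

lemma bit_less: "(z::nat) < 2 ^ n \<Longrightarrow> bit z i \<Longrightarrow> i < n"
proof (rule ccontr)
  assume "z < 2 ^ n" "bit z i" "\<not> i < n"
  then have "z < 2 ^ i" by (meson le_less_trans less_le_not_le linorder_not_le order_less_le_trans power_increasing one_le_numeral)
  then show False using \<open>bit z i\<close> by (simp add: bit_iff_odd)
qed

lemma ex_bits: "Z \<subseteq> {..<n} \<Longrightarrow> \<exists>z<2 ^ n. {i. bit (z::nat) i} = Z"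
proof (induction n arbitrary: Z)
  case 0
  then show ?case by (intro exI[of _ 0]) auto
next
  case (Suc n)
  let ?Z = "{i. Suc i \<in> Z}"
  have "?Z \<subseteq> {..<n}" using Suc.prems by auto
  then obtain z :: nat where z: "z < 2 ^ n" "{i. bit z i} = ?Z" using Suc.IH by blast
  let ?z = "2 * z + of_bool (0 \<in> Z)"
  have "bit ?z i \<longleftrightarrow> i \<in> Z" for i
  proof (cases i)
    case 0
    then show ?thesis by (simp add: bit_0)
  next
    case (Suc j)
    have "?z div 2 = z" by simp
    then have "bit ?z i \<longleftrightarrow> bit z j" using Suc by (simp add: bit_Suc)
    then show ?thesis using z(2) Suc by auto
  qed
  then have "{i. bit ?z i} = Z" by blast
  moreover have "?z < 2 ^ Suc n" using z(1) by (cases "0 \<in> Z") auto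
  ultimately show ?case by blast
qed

lemma in_row: "c \<in> set (row ts kn T X Y Z) \<longleftrightarrow> (\<exists>i<length ts. c = mkc kn T X Y Z i (ts ! i))"
proof -
  have "c \<in> set (rows F k ts) \<longleftrightarrow> (\<exists>i<length ts. c = F (k + i) (ts ! i))" for F k
  proof (induction ts arbitrary: k)
    case (Cons t ts)
    then show ?case by (auto simp: less_Suc_eq_0_disj)
  qed simp
  then show ?thesis by (simp add: row_def)
qed

lemma map_ch_row:
  "map ch (row ts KT T X Y Z) = row ts KP Z Z {} {}"
  "map ch (row ts KP T X Y Z) = row ts KD T X Z {}"
  "map ch (row ts KD T X Y Z) = row ts KP T Z {} {}"
proof -
  have m: "map ch (rows F k ts) = rows (\<lambda>i t. ch (F i t)) k ts" for F k
    by (induction ts arbitrary: k) auto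
  show "map ch (row ts KT T X Y Z) = row ts KP Z Z {} {}"
    "map ch (row ts KP T X Y Z) = row ts KD T X Z {}"
    "map ch (row ts KD T X Y Z) = row ts KP T Z {} {}"
    unfolding row_def m by (rule rows_cong, simp add: mkc_def)+
qed

subsection \<open>Correctness of the search\<close>

locale game =
  fixes ts :: "tok list" and q :: "rcell list \<Rightarrow> bool" and lim :: nat
    and qs :: "nat set \<Rightarrow> nat set \<Rightarrow> nat set \<Rightarrow> nat set \<Rightarrow> bool"
  assumes ts: "ts \<noteq> []" "ts ! 0 = TRoot" "\<And>i. 0 < i \<Longrightarrow> i < length ts \<Longrightarrow> ts ! i \<noteq> TRoot"
    and q: "\<And>T X Y Z. q (row ts KD T X Y Z) \<longleftrightarrow> qs T X Y Z"
    and lim: "2 * length ts + 3 \<le> lim"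
begin

definition ro :: "rcell list \<Rightarrow> bool" where
  "ro u \<longleftrightarrow> (\<exists>kn T X Y Z. u = row ts kn T X Y Z)"

abbreviation run where "run \<equiv> arun ro q lim"

lemma ro_row [simp]: "ro (row ts kn T X Y Z)" unfolding ro_def by blast

lemma kdr_row [simp]: "kdr (row ts kn T X Y Z) = kn"
proof -
  have "row ts kn T X Y Z \<noteq> []" using ts(1) by (cases ts) (auto simp: row_def)
  then have "last (row ts kn T X Y Z) \<in> set (row ts kn T X Y Z)" by simp
  then show ?thesis unfolding in_row by auto
qed

lemma legal_row:
  "legal b (row ts KT T X Y Z) \<longleftrightarrow> 0 \<in> Z \<and> (\<forall>i<length ts. i \<in> Z \<longrightarrow> is_mod (ts ! i))"
  "legal b (row ts KP T X Y Z) \<longleftrightarrow> Z \<inter> {..<length ts} \<subseteq> X \<and> Z \<inter> {..<length ts} \<noteq> {}"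
  "legal b (row ts KD T X Y Z) \<longleftrightarrow> Z \<inter> {..<length ts} \<subseteq> X \<and> Z \<inter> Y \<inter> {..<length ts} = {} \<and> b"
proof -
  have l: "(\<forall>c\<in>set (row ts kn T X Y Z). P c) \<longleftrightarrow> (\<forall>i<length ts. P (mkc kn T X Y Z i (ts ! i)))" for P kn
    unfolding Ball_def in_row by blast
  have x: "(\<exists>c\<in>set (row ts kn T X Y Z). P c) \<longleftrightarrow> (\<exists>i<length ts. P (mkc kn T X Y Z i (ts ! i)))" for P kn
    unfolding Bex_def in_row by blast
  have n0: "0 < length ts" using ts(1) by simp
  have f: "fits b (mkc KT T X Y Z i t) \<longleftrightarrow> (t = TRoot \<longrightarrow> i \<in> Z) \<and> (i \<in> Z \<longrightarrow> is_mod t)"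
    "fits b (mkc KP T X Y Z i t) \<longleftrightarrow> (i \<in> Z \<longrightarrow> i \<in> X)"
    "fits b (mkc KD T X Y Z i t) \<longleftrightarrow> (i \<in> Z \<longrightarrow> i \<in> X \<and> i \<notin> Y) \<and> b" for i t
    by (simp_all add: mkc_def)
  have r: "ts ! i = TRoot \<longleftrightarrow> i = 0" if "i < length ts" for i
    using ts(2) ts(3)[of i] that by (cases "i = 0") auto
  show "legal b (row ts KT T X Y Z) \<longleftrightarrow> 0 \<in> Z \<and> (\<forall>i<length ts. i \<in> Z \<longrightarrow> is_mod (ts ! i))"
    unfolding legal_def l x f wit_def mkc_sel using n0 r by auto
  show "legal b (row ts KP T X Y Z) \<longleftrightarrow> Z \<inter> {..<length ts} \<subseteq> X \<and> Z \<inter> {..<length ts} \<noteq> {}"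
    unfolding legal_def l x f wit_def mkc_sel by auto
  show "legal b (row ts KD T X Y Z) \<longleftrightarrow> Z \<inter> {..<length ts} \<subseteq> X \<and> Z \<inter> Y \<inter> {..<length ts} = {} \<and> b"
    unfolding legal_def l x f wit_def mkc_sel using n0 by auto
qed

abbreviation bs_of :: "nat \<Rightarrow> nat set" where "bs_of z \<equiv> {i. bit z i}"
abbreviation n where "n \<equiv> length ts"

lemma inc_row:
  assumes "z < 2 ^ n"
  shows "fst (inc True (row ts kn T X Y (bs_of z))) \<longleftrightarrow> Suc z = 2 ^ n"
    "Suc z \<noteq> 2 ^ n \<Longrightarrow> snd (inc True (row ts kn T X Y (bs_of z))) = row ts kn T X Y (bs_of (Suc z))"
  using inc_rows[OF assms, of True kn T X Y 0] by (simp_all add: row_def)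

lemma ro_inc: "ro u \<Longrightarrow> ro (snd (inc True u))"
  unfolding ro_def row_def using inc_some by metis

lemma ro_ch: "ro u \<Longrightarrow> ro (map ch u)"
proof -
  assume "ro u"
  then obtain kn T X Y Z where "u = row ts kn T X Y Z" unfolding ro_def by blast
  then show ?thesis by (cases kn) (simp_all add: map_ch_row)
qed

text \<open>In mode \<open>Lose\<close> the player to move after the choice on the row has no winning choice, so that this
  choice was a good one; in mode \<open>Next\<close> the next choice is tried.\<close>

lemma enumerate:
  fixes won :: "nat \<Rightarrow> bool" and kn S X Y
  defines "u \<equiv> \<lambda>z. row ts kn S X Y (bs_of z)"
  assumes kn: "kn \<noteq> KT" and y: "ro y" "\<forall>x\<in>set st. ro x" "Suc (length st) \<le> lim"
    and sub: "\<And>z b. z < 2 ^ n \<Longrightarrow> legal (q (u z)) (u z) \<Longrightarrow>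
      run (if won z then Lose else Next, u z, y # st) b \<Longrightarrow> run (Try, map ch (u z), u z # y # st) b"
    and z: "z < 2 ^ n"
    and fin: "run (if \<exists>z'. z \<le> z' \<and> z' < 2 ^ n \<and> legal (q (u z')) (u z') \<and> won z' then Next else Lose, y, st) b"
  shows "run (Try, u z, y # st) b"
  using z fin
proof (induction "2 ^ n - z" arbitrary: z rule: less_induct)
  case less
  have st: "\<forall>x\<in>set (y # st). ro x" "length (y # st) \<le> lim" using y by auto
  have ru: "ro (u z)" by (simp add: u_def)
  have ku: "kdr (u z) = kn" by (simp add: u_def)
  let ?W = "\<lambda>z. legal (q (u z)) (u z) \<and> won z"
  have lose: "run (Lose, u z, y # st) b" if "?W z"
  proof -
    have "run (Next, y, st) b" using less.prems that by (auto split: if_splits)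
    then have "run (PopN, u z, y # st) b" by (intro arun_step) (use ru st in auto)
    then show ?thesis by (intro arun_step[of Lose]) (use ru st kn ku in auto)
  qed
  have nxt: "run (Next, u z, y # st) b" if nw: "\<not> ?W z"
  proof (cases "Suc z = 2 ^ n")
    case True
    then have "\<not> (\<exists>z'. z \<le> z' \<and> z' < 2 ^ n \<and> ?W z')" using nw by (metis Suc_leI le_antisym not_less_eq_eq)
    then have L: "run (Lose, y, st) b" using less.prems(2) by (simp only: if_False)
    have c: "fst (inc True (u z))" using inc_row(1)[OF less.prems(1)] True by (simp add: u_def)
    have ri: "ro (snd (inc True (u z)))" using ro_inc ru by blast
    have "run (PopL, snd (inc True (u z)), y # st) b" by (intro arun_step) (use ri st L in auto)
    then show ?thesis by (intro arun_step[of Next]) (use ru st kn ku c in auto)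
  next
    case False
    then have z1: "Suc z < 2 ^ n" using less.prems(1) by simp
    have c: "\<not> fst (inc True (u z))" "snd (inc True (u z)) = u (Suc z)"
      using inc_row[OF less.prems(1)] False by (simp_all add: u_def)
    have "(\<exists>z'. z \<le> z' \<and> z' < 2 ^ n \<and> ?W z') \<longleftrightarrow> (\<exists>z'. Suc z \<le> z' \<and> z' < 2 ^ n \<and> ?W z')"
      using nw by (metis Suc_leD Suc_leI le_neq_implies_less)
    then have "run (Try, u (Suc z), y # st) b"
      using less.hyps[of "Suc z"] less.prems z1 by (simp add: diff_less_mono2)
    then show ?thesis by (intro arun_step[of Next]) (use ru st c in auto)
  qed
  show ?case
  proof (cases "legal (q (u z)) (u z)")
    case True
    have "run (if won z then Lose else Next, u z, y # st) b" using lose nxt True by auto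
    then have "run (Try, map ch (u z), u z # y # st) b" using sub less.prems(1) True by blast
    then show ?thesis by (intro arun_step[of Try]) (use ru st True in auto)
  next
    case False
    then have "run (Next, u z, y # st) b" using nxt by blast
    then show ?thesis by (intro arun_step[of Try]) (use ru st False in auto)
  qed
qed

lemma enumerate_top:
  fixes won :: "nat \<Rightarrow> bool" and S X Y
  defines "u \<equiv> \<lambda>z. row ts KT S X Y (bs_of z)"
  assumes sub: "\<And>z b. z < 2 ^ n \<Longrightarrow> legal (q (u z)) (u z) \<Longrightarrow>
      run (if won z then Lose else Next, u z, []) b \<Longrightarrow> run (Try, map ch (u z), [u z]) b"
    and z: "z < 2 ^ n"
  shows "run (Try, u z, []) (\<exists>z'. z \<le> z' \<and> z' < 2 ^ n \<and> legal (q (u z')) (u z') \<and> won z')"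
  using z
proof (induction "2 ^ n - z" arbitrary: z rule: less_induct)
  case less
  have ru: "ro (u z)" by (simp add: u_def)
  have ku: "kdr (u z) = KT" by (simp add: u_def)
  let ?W = "\<lambda>z. legal (q (u z)) (u z) \<and> won z"
  let ?b = "\<exists>z'. z \<le> z' \<and> z' < 2 ^ n \<and> ?W z'"
  have lose: "run (Lose, u z, []) ?b" if "?W z"
  proof -
    have b: "?b" using that less.prems by blast
    have "run (Acc, u z, []) True" by (rule arun_Acc)
    then have "run (Lose, u z, []) True" by (intro arun_step[of Lose]) (use ru ku in auto)
    then show ?thesis using b by simp
  qed
  have nxt: "run (Next, u z, []) ?b" if nw: "\<not> ?W z"
  proof (cases "Suc z = 2 ^ n")
    case True
    then have b: "\<not> ?b" using nw by (metis Suc_leI le_antisym not_less_eq_eq)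
    have c: "fst (inc True (u z))" using inc_row(1)[OF less.prems(1)] True by (simp add: u_def)
    have "run (Rej, snd (inc True (u z)), []) False" by (rule arun_Rej)
    then have "run (Next, u z, []) False" by (intro arun_step[of Next]) (use ru ku c in auto)
    moreover have "?b = False" using b by blast
    ultimately show ?thesis by (simp only:)
  next
    case False
    then have z1: "Suc z < 2 ^ n" using less.prems(1) by simp
    have c: "\<not> fst (inc True (u z))" "snd (inc True (u z)) = u (Suc z)"
      using inc_row[OF less.prems(1)] False by (simp_all add: u_def)
    have b: "?b \<longleftrightarrow> (\<exists>z'. Suc z \<le> z' \<and> z' < 2 ^ n \<and> ?W z')"
      using nw by (metis Suc_leD Suc_leI le_neq_implies_less)
    have "run (Try, u (Suc z), []) ?b"
      unfolding b using less.hyps[of "Suc z"] less.prems z1 by (simp add: diff_less_mono2)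
    then show ?thesis by (intro arun_step[of Next]) (use ru c in auto)
  qed
  show ?case
  proof (cases "legal (q (u z)) (u z)")
    case True
    have "run (if won z then Lose else Next, u z, []) ?b" using lose nxt True by auto
    then have "run (Try, map ch (u z), [u z]) ?b" using sub less.prems True by blast
    then show ?thesis by (intro arun_step[of Try]) (use ru True in auto)
  next
    case False
    then have "run (Next, u z, []) ?b" using nxt by blast
    then show ?thesis by (intro arun_step[of Try]) (use ru False in auto)
  qed
qed

lemma ex_bs: "(\<exists>z'. 0 \<le> z' \<and> z' < 2 ^ n \<and> P (bs_of z')) \<longleftrightarrow> (\<exists>Z. Z \<subseteq> {..<n} \<and> P Z)"
proof
  assume "\<exists>z'. 0 \<le> z' \<and> z' < 2 ^ n \<and> P (bs_of z')"
  then obtain z where "z < 2 ^ n" "P (bs_of z)" by blast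
  then show "\<exists>Z. Z \<subseteq> {..<n} \<and> P Z" using bit_less by (intro exI[of _ "bs_of z"]) auto
next
  assume "\<exists>Z. Z \<subseteq> {..<n} \<and> P Z"
  then obtain Z where Z: "Z \<subseteq> {..<n}" "P Z" by blast
  obtain z :: nat where "z < 2 ^ n" "bs_of z = Z" using ex_bits[OF Z(1)] by blast
  then show "\<exists>z'. 0 \<le> z' \<and> z' < 2 ^ n \<and> P (bs_of z')" using Z(2) by auto
qed

text \<open>\<open>forest\<close> in game form: the challenger has no \<open>Y\<close> without a
  winning reply \<open>Z\<close>.\<close>

lemma forest_unfold: "forest (qs S) X \<longleftrightarrow>
  \<not> (\<exists>Y. Y \<subseteq> X \<and> Y \<noteq> {} \<and> \<not> (\<exists>Z. Z \<subseteq> X \<and> Z \<inter> Y = {} \<and> qs S X Y Z \<and> forest (qs S) Z))"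
  by (subst forest.simps) blast

text \<open>In continuation style: the run that starts on a new position has the outcome
  \<open>b\<close> of the run that resumes at the parent row \<open>y\<close> with the correct
  verdict. Each decrease of \<open>X\<close> puts two rows on the stack, one with \<open>Y\<close>
  and one with \<open>Z\<close>.\<close>

lemma search:
  assumes "X \<subseteq> {..<n}" "ro y" "\<forall>x\<in>set st. ro x" "length st + 2 * card X + 2 \<le> lim"
    "run (if forest (qs S) X then Lose else Next, y, st) b"
  shows "run (Try, row ts KP S X {} {}, y # st) b"
  using assms
proof (induction "card X" arbitrary: X y st b rule: less_induct)
  case less
  have finX: "finite X" using less.prems(1) finite_subset by blast
  let ?u = "\<lambda>z. row ts KP S X {} (bs_of z)"
  define ans where "ans Y \<longleftrightarrow> (\<exists>Z. Z \<subseteq> X \<and> Z \<inter> Y = {} \<and> qs S X Y Z \<and> forest (qs S) Z)" for Y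
  have legP: "legal b (?u z) \<longleftrightarrow> bs_of z \<subseteq> X \<and> bs_of z \<noteq> {}" if "z < 2 ^ n" for z b
  proof -
    have "bs_of z \<inter> {..<n} = bs_of z" using bit_less[OF that] by auto
    then show ?thesis unfolding legal_row by simp
  qed
  have sub: "run (Try, map ch (?u z), ?u z # y # st) b'"
    if z: "z < 2 ^ n" "legal (q (?u z)) (?u z)" and r: "run (if \<not> ans (bs_of z) then Lose else Next, ?u z, y # st) b'" for z b'
  proof -
    let ?Y = "bs_of z"
    have Y: "?Y \<subseteq> X" "?Y \<noteq> {}" using legP z by auto
    have pos: "card X > 0" using Y finX card_gt_0_iff by blast
    let ?v = "\<lambda>z'. row ts KD S X ?Y (bs_of z')"
    have legD: "legal (q (?v z')) (?v z') \<longleftrightarrow> bs_of z' \<subseteq> X \<and> bs_of z' \<inter> ?Y = {} \<and> qs S X ?Y (bs_of z')"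
      if "z' < 2 ^ n" for z'
    proof -
      have "bs_of z' \<inter> {..<n} = bs_of z'" using bit_less[OF that] by auto
      then show ?thesis unfolding legal_row q by blast
    qed
    have "run (Try, ?v 0, ?u z # y # st) b'"
    proof (rule enumerate[where won = "\<lambda>z'. forest (qs S) (bs_of z')"])
      show "\<forall>x\<in>set (y # st). ro x" "ro (?u z)" "Suc (length (y # st)) \<le> lim" using less.prems pos by auto
      have "(\<exists>z'. 0 \<le> z' \<and> z' < 2 ^ n \<and> legal (q (?v z')) (?v z') \<and> forest (qs S) (bs_of z')) \<longleftrightarrow>
        (\<exists>z'. 0 \<le> z' \<and> z' < 2 ^ n \<and> bs_of z' \<subseteq> X \<and> bs_of z' \<inter> ?Y = {} \<and> qs S X ?Y (bs_of z') \<and> forest (qs S) (bs_of z'))"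
        using legD by blast
      also have "\<dots> \<longleftrightarrow> (\<exists>Z. Z \<subseteq> {..<n} \<and> Z \<subseteq> X \<and> Z \<inter> ?Y = {} \<and> qs S X ?Y Z \<and> forest (qs S) Z)"
        by (rule ex_bs)
      also have "\<dots> \<longleftrightarrow> ans ?Y" unfolding ans_def using less.prems(1) by blast
      finally have e: "(\<exists>z'. 0 \<le> z' \<and> z' < 2 ^ n \<and> legal (q (?v z')) (?v z') \<and> forest (qs S) (bs_of z')) \<longleftrightarrow> ans ?Y" .
      show "run (if \<exists>z'. 0 \<le> z' \<and> z' < 2 ^ n \<and> legal (q (?v z')) (?v z') \<and> forest (qs S) (bs_of z') then Next else Lose, ?u z, y # st) b'"
        unfolding e using r by (cases "ans ?Y") auto
      fix z' c assume z': "z' < 2 ^ n" "legal (q (?v z')) (?v z')"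
        and r': "run (if forest (qs S) (bs_of z') then Lose else Next, ?v z', ?u z # y # st) c"
      have Z: "bs_of z' \<subseteq> X" "bs_of z' \<inter> ?Y = {}" using legD z' by auto
      \<comment> \<open>The reply avoids the nonempty challenge inside \<open>X\<close>, which makes
        it a proper subset.\<close>
      then have "bs_of z' \<subset> X" using Y by blast
      then have cl: "card (bs_of z') < card X" using finX psubset_card_mono by blast
      have "run (Try, row ts KP S (bs_of z') {} {}, ?v z' # ?u z # y # st) c"
      proof (rule less.hyps[OF cl])
        show "bs_of z' \<subseteq> {..<n}" using Z less.prems(1) by blast
        show "length (?u z # y # st) + 2 * card (bs_of z') + 2 \<le> lim" using cl less.prems(4) by simp
      qed (use less.prems r' in auto)
      then show "run (Try, map ch (?v z'), ?v z' # ?u z # y # st) c" unfolding map_ch_row .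
    qed simp_all
    then show ?thesis unfolding map_ch_row by simp
  qed
  have "run (Try, ?u 0, y # st) b"
  proof (rule enumerate[where won = "\<lambda>z. \<not> ans (bs_of z)"])
    have "(\<exists>z'. 0 \<le> z' \<and> z' < 2 ^ n \<and> legal (q (?u z')) (?u z') \<and> \<not> ans (bs_of z')) \<longleftrightarrow>
        (\<exists>z'. 0 \<le> z' \<and> z' < 2 ^ n \<and> bs_of z' \<subseteq> X \<and> bs_of z' \<noteq> {} \<and> \<not> ans (bs_of z'))"
      using legP by blast
    also have "\<dots> \<longleftrightarrow> (\<exists>Y. Y \<subseteq> {..<n} \<and> Y \<subseteq> X \<and> Y \<noteq> {} \<and> \<not> ans Y)" by (rule ex_bs)
    also have "\<dots> \<longleftrightarrow> \<not> forest (qs S) X"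
      using less.prems(1) unfolding forest_unfold[of S X] ans_def[symmetric] by blast
    finally have e: "(\<exists>z'. 0 \<le> z' \<and> z' < 2 ^ n \<and> legal (q (?u z')) (?u z') \<and> \<not> ans (bs_of z')) \<longleftrightarrow> \<not> forest (qs S) X" .
    show "run (if \<exists>z'. 0 \<le> z' \<and> z' < 2 ^ n \<and> legal (q (?u z')) (?u z') \<and> \<not> ans (bs_of z') then Next else Lose, y, st) b"
      unfolding e using less.prems(5) by (cases "forest (qs S) X") auto
    show "\<And>z b. z < 2 ^ n \<Longrightarrow> legal (q (?u z)) (?u z) \<Longrightarrow>
      run (if \<not> ans (bs_of z) then Lose else Next, ?u z, y # st) b \<Longrightarrow> run (Try, map ch (?u z), ?u z # y # st) b"
      by (rule sub)
    show "KP \<noteq> KT" "ro y" "\<forall>x\<in>set st. ro x" "Suc (length st) \<le> lim" "0 < (2 :: nat) ^ n"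
      using less.prems by simp_all
  qed
  then show ?case by simp
qed

theorem search_top:
  "run (Try, row ts KT {} {} {} {}, [])
     (\<exists>S. S \<subseteq> {i. i < n \<and> is_mod (ts ! i)} \<and> 0 \<in> S \<and> forest (qs S) S)"
proof -
  let ?u = "\<lambda>z. row ts KT {} {} {} (bs_of z)"
  have leg: "legal b (?u z) \<longleftrightarrow> 0 \<in> bs_of z \<and> bs_of z \<subseteq> {i. i < n \<and> is_mod (ts ! i)}" if "z < 2 ^ n" for z b
    unfolding legal_row using bit_less[OF that] by auto
  have r: "run (Try, ?u 0, []) (\<exists>z'. 0 \<le> z' \<and> z' < 2 ^ n \<and> legal (q (?u z')) (?u z') \<and> forest (qs (bs_of z')) (bs_of z'))"
  proof (rule enumerate_top)
    fix z b assume z: "z < 2 ^ n" "legal (q (?u z)) (?u z)"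
      and r: "run (if forest (qs (bs_of z)) (bs_of z) then Lose else Next, ?u z, []) b"
    have sub: "bs_of z \<subseteq> {..<n}" using bit_less[OF z(1)] by auto
    have "card (bs_of z) \<le> n" using card_mono[OF _ sub] by simp
    then have "run (Try, row ts KP (bs_of z) (bs_of z) {} {}, [?u z]) b"
      by (intro search) (use sub r lim in auto)
    then show "run (Try, map ch (?u z), [?u z]) b" unfolding map_ch_row .
  qed simp
  have "(\<exists>z'. 0 \<le> z' \<and> z' < 2 ^ n \<and> legal (q (?u z')) (?u z') \<and> forest (qs (bs_of z')) (bs_of z')) \<longleftrightarrow>
    (\<exists>z'. 0 \<le> z' \<and> z' < 2 ^ n \<and> 0 \<in> bs_of z' \<and> bs_of z' \<subseteq> {i. i < n \<and> is_mod (ts ! i)} \<and> forest (qs (bs_of z')) (bs_of z'))"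
    using leg by blast
  also have "\<dots> \<longleftrightarrow> (\<exists>S. S \<subseteq> {..<n} \<and> 0 \<in> S \<and> S \<subseteq> {i. i < n \<and> is_mod (ts ! i)} \<and> forest (qs S) S)"
    by (rule ex_bs)
  also have "\<dots> \<longleftrightarrow> (\<exists>S. S \<subseteq> {i. i < n \<and> is_mod (ts ! i)} \<and> 0 \<in> S \<and> forest (qs S) S)" by auto
  finally show ?thesis using r by simp
qed

end

section \<open>The reduction\<close>

lemma length_bits: "length (bits n) \<le> n"
proof (induction n rule: less_induct)
  case (less n)
  show ?case
  proof (cases "n = 0")
    case False
    then have "length (bits (n div 2)) \<le> n div 2" "n div 2 < n" using less by auto
    then show ?thesis using False by (simp add: bits.simps[of n])
  qed simp
qed

lemma TDia_toks: "is_fm C \<phi> \<Longrightarrow> TDia b \<in> set (toks \<phi>) \<Longrightarrow> b < C"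
  and TRoot_toks: "TRoot \<notin> set (toks \<phi>)"
proof -
  have t: "TDia b \<notin> set (tbits n) \<and> TRoot \<notin> set (tbits n)" for n
  proof (induction n rule: less_induct)
    case (less n)
    then show ?case by (cases "n = 0") (simp_all add: tbits.simps[of n])
  qed
  show "is_fm C \<phi> \<Longrightarrow> TDia b \<in> set (toks \<phi>) \<Longrightarrow> b < C" by (induction \<phi>) (auto simp: t)
  show "TRoot \<notin> set (toks \<phi>)" by (induction \<phi>) (auto simp: t)
qed

lemma is_mod_tbits: "t \<in> set (tbits n) \<Longrightarrow> \<not> is_mod t"
proof (induction n rule: less_induct)
  case (less n)
  show ?case
  proof (cases "n = 0")
    case False
    then have "t = TBit (odd n) (n div 2 = 0) \<or> t \<in> set (tbits (n div 2))"
      using less.prems by (simp add: tbits.simps[of n])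
    then show ?thesis using less.IH[of "n div 2"] False by auto
  qed (use less.prems in simp)
qed

definition mods :: "nat \<Rightarrow> tok list \<Rightarrow> nat set" where
  "mods k ts = {i. k \<le> i \<and> i < k + length ts \<and> is_mod (ts ! (i - k))}"

lemma mods_Nil: "mods k [] = {}" by (simp add: mods_def)

lemma mods_Cons: "mods k (t # ts) = (if is_mod t then {k} else {}) \<union> mods (Suc k) ts"
proof (rule set_eqI)
  fix i
  show "i \<in> mods k (t # ts) \<longleftrightarrow> i \<in> (if is_mod t then {k} else {}) \<union> mods (Suc k) ts"
  proof (cases "Suc k \<le> i")
    case True
    then have "i - k = Suc (i - Suc k)" by simp
    then show ?thesis using True by (auto simp: mods_def)
  next
    case False
    then show ?thesis by (cases "i = k") (auto simp: mods_def)
  qed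
qed

lemma mods_append: "mods k (xs @ ys) = mods k xs \<union> mods (k + length xs) ys"
  by (induction xs arbitrary: k) (auto simp: mods_Nil mods_Cons)

lemma mods_none: "(\<And>t. t \<in> set ts \<Longrightarrow> \<not> is_mod t) \<Longrightarrow> mods k ts = {}"
  by (induction ts arbitrary: k) (auto simp: mods_Nil mods_Cons)

lemma dias_mods: "fst ` set (dias k \<phi>) = mods k (toks \<phi>)"
  by (induction \<phi> arbitrary: k)
    (auto simp: mods_Cons mods_append mods_Nil mods_none[OF is_mod_tbits] image_Un)

text \<open>Positions of arguments are visible from the tokens alone, so that \<open>fits\<close>
  can test a candidate for \<open>T\<close> cell by cell.\<close>

lemma args_mods: "fst ` set (args \<phi>) = {i. i < length (TRoot # toks \<phi>) \<and> is_mod ((TRoot # toks \<phi>) ! i)}"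
proof -
  have "fst ` set (args \<phi>) = mods 0 (TRoot # toks \<phi>)"
    unfolding mods_Cons args_def using dias_mods[of 1 \<phi>] by simp
  then show ?thesis by (simp only: mods_def) simp
qed

text \<open>The longest block has nine symbols besides its index: \<open>SImp\<close>, three for the
  guard, \<open>SDia\<close>, and four for the idle premise.\<close>

lemma length_emit: "(\<And>b. tk c = TDia b \<Longrightarrow> b < C) \<Longrightarrow> length (emit s a c) \<le> C + s + 9"
proof (cases "tk c")
  case (TDia b)
  assume "\<And>b. tk c = TDia b \<Longrightarrow> b < C"
  then have "b < C" using TDia by blast
  then show ?thesis using TDia length_bits[of "b + s"] by (simp add: emit_def)
qed (simp_all add: emit_def)

text \<open>The 8 stands for the seven symbols before and the one after a copied argument, the final
  1 for the closing \<open>Bot\<close>.\<close>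

lemma length_echain:
  assumes "\<forall>c\<in>set u. length (emit s a c) \<le> K" "length u \<le> N"
  shows "length (echain s a S u) \<le> length u * (K * N + 8) + 1"
  using assms
proof (induction u)
  case (Cons c u)
  have e: "length (emits s a cs) \<le> K * length cs" if "\<forall>c\<in>set cs. length (emit s a c) \<le> K" for cs
    using that by (induction cs) auto
  obtain r where r: "u = tf (ar (tk c)) u @ r" using tf_prefix by blast
  have "set u = set (tf (ar (tk c)) u) \<union> set r" "length u = length (tf (ar (tk c)) u) + length r"
    by (subst r, simp)+
  then have "length (emits s a (tf (ar (tk c)) u)) \<le> K * length (tf (ar (tk c)) u)" "length (tf (ar (tk c)) u) \<le> N"
    using e[of "tf (ar (tk c)) u"] Cons.prems by auto
  then have "length (emits s a (tf (ar (tk c)) u)) \<le> K * N" by (meson le_trans mult_le_mono2)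
  moreover have "length (echain s a S u) \<le> length u * (K * N + 8) + 1" using Cons by auto
  ultimately show ?case by simp
qed simp

lemma length_qword:
  assumes "\<forall>c\<in>set u. length (emit s a c) \<le> K"
  shows "length (qword s a u) \<le> 2 * (length u * (K * length u + 8)) + 5"
  using length_echain[OF assms order.refl, of fY] length_echain[OF assms order.refl, of "\<lambda>c. \<not> fX c"]
  by (simp add: qword_def)

lemma finite_codes:
  "\<exists>NA>0. (\<forall>c::rcell. (\<forall>b. tk c = TDia b \<longrightarrow> b < C) \<longrightarrow> to_nat c < NA) \<and>
     (\<forall>m k b b1 b2. to_nat (RG m k b b1 b2) < NA) \<and>
     (\<forall>v. (\<forall>x. v = Some x \<longrightarrow> x \<le> C) \<longrightarrow> to_nat (RV v) < NA)"
proof -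
  have k: "(UNIV :: kind set) = {KT, KP, KD}" using kind.exhaust by blast
  have m: "(UNIV :: mode set) = {Try, Push, Next, Lose, PopL, PopN, Acc, Rej}" using mode.exhaust by blast
  have fk: "finite (UNIV :: kind set)" and fm: "finite (UNIV :: mode set)" by (simp_all add: k m)
  define TS where "TS = {TRoot, TBot, TImp} \<union> range TVar \<union> (\<lambda>(a, b). TBit a b) ` UNIV \<union> TDia ` {..<C}"
  have fT: "finite TS" unfolding TS_def by (simp add: finite_prod)
  define R1 where "R1 = (\<lambda>(t, k, T, X, Y, Z, M). RC t k T X Y Z M) ` (TS \<times> UNIV)"
  have f1: "finite R1" unfolding R1_def using fT fk by (simp add: finite_prod)
  define R2 where "R2 = (\<lambda>(m, k, b, b1, b2). RG m k b b1 b2) ` UNIV \<union> RV ` (insert None (Some ` {..C}))"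
  have f2: "finite R2" unfolding R2_def using fk fm by (simp add: finite_prod)
  have f: "finite (to_nat ` R1 \<union> to_nat ` R2)" using f1 f2 by simp
  obtain NA where NA: "\<forall>x \<in> to_nat ` R1 \<union> to_nat ` R2. x < NA"
    using f unfolding finite_nat_set_iff_bounded by blast
  have "c \<in> R1" if "\<forall>b. tk c = TDia b \<longrightarrow> b < C" for c
  proof -
    obtain t k T X Y Z M where c: "c = RC t k T X Y Z M" by (cases c)
    have "t \<in> TS" using that c by (cases t) (auto simp: TS_def)
    then show ?thesis unfolding R1_def c by (intro image_eqI[of _ _ "(t, k, T, X, Y, Z, M)"]) auto
  qed
  moreover have "RG m k b b1 b2 \<in> R2" for m k b b1 b2
    unfolding R2_def by (intro UnI1 image_eqI[of _ _ "(m, k, b, b1, b2)"]) auto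
  moreover have "RV v \<in> R2" if "\<forall>x. v = Some x \<longrightarrow> x \<le> C" for v
    using that unfolding R2_def by (cases v) auto
  ultimately show ?thesis using NA by (intro exI[of _ "Suc NA"]) (auto simp: less_Suc_eq)
qed

lemma reduction_run:
  fixes P R :: "fm set"
  assumes C: "0 < C" and P: "\<And>\<phi>. \<phi> \<in> P \<Longrightarrow> is_fm C \<phi>"
    and iff: "\<And>\<phi>. is_fm C \<phi> \<Longrightarrow> \<phi> \<in> P \<longleftrightarrow> (\<exists>T. T \<subseteq> fst ` set (args \<phi>) \<and> 0 \<in> T \<and>
      forest (\<lambda>X Y Z. query s a \<phi> T X Y Z \<in> R) T)"
    and codes: "0 < NA" "\<And>c::rcell. (\<And>b. tk c = TDia b \<Longrightarrow> b < C) \<Longrightarrow> to_nat c < NA"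
      "\<And>m k b b1 b2. to_nat (RG m k b b1 b2) < NA"
      "\<And>v. (\<And>x. v = Some x \<Longrightarrow> x \<le> C) \<Longrightarrow> to_nat (RV v) < NA"
    and K: "K = C + s + 9" and B: "B = (2 * K + 30) * (length w + 1) ^ 2"
  shows "mrun (okt NA B) (prog C K s a) ans tst (word_of ` R)
    [tp [] (map Inp w), orc [], tp [] [], tp [] [], tp [] [], tp [] []] (w \<in> word_of ` P)"
proof -
  interpret space_tok NA B C
  proof
    show "0 < NA" by (rule codes(1))
    show "to_nat c < NA" if "\<And>b. tk c = TDia b \<Longrightarrow> b < C" for c :: rcell
      by (rule codes(2)) (rule that)
  qed
  define n where "n = length w + 1"
  have n1: "1 \<le> n" by (simp add: n_def)
  then have nn: "n \<le> n ^ 2" by (simp add: self_le_power)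
  \<comment> \<open>The summand with \<open>K\<close> pays for the query in \<open>B3\<close>; the
    other absorbs all lower terms by \<open>n \<le> n ^ 2\<close>.\<close>
  have Bn: "B = 2 * K * n ^ 2 + 30 * n ^ 2" by (simp add: B n_def algebra_simps)
  have B1: "n + 4 < B" "length w + 3 < B" using nn n1 unfolding Bn n_def by linarith+
  have B2: "n * (2 * n + 3 + 2) < B"
  proof -
    have "n * (2 * n + 3 + 2) = 2 * n ^ 2 + 5 * n" by (simp add: power2_eq_square algebra_simps)
    then show ?thesis using nn n1 unfolding Bn by linarith
  qed
  have B3: "2 * (n * (K * n + 8)) + 5 < B"
  proof -
    have "2 * (n * (K * n + 8)) + 5 = 2 * K * n ^ 2 + 16 * n + 5" by (simp add: power2_eq_square algebra_simps)
    then show ?thesis using nn n1 unfolding Bn by linarith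
  qed
  let ?i = "tp (rev (map Inp w)) []" and ?start = "[tp [] (map Inp w), orc [], tp [] [], tp [] [], tp [] [], tp [] []]"
  let ?ts = "TRoot # snd (tz C w)"
  have lt: "length (snd (tz C w)) = length w" by (induction w) auto
  have oki: "ok ?i" using B1 by (auto simp: okt_tp)
  have ok0: "ok (orc [])" "ok (stk [])" using B1 by (auto simp: oks ok_stk)
  have 1: "bs ok (tokenize C) ?start [?i, orc [], hm (map cell0 ?ts), stk [], ct 0, rgt (RV (fst (tz C w)))]"
    by (rule tokenize[OF C codes(4) B1(2)])
  have rv: "to_nat (RV (fst (tz C w))) < NA" by (rule codes(4)) (rule tz_le[OF C])
  have cto: "\<forall>c\<in>set (map cell0 ?ts). ct_ok c" using tz_ct_ok[OF C, of w] by (auto simp: ct_ok_def)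
  have mtk: "map tk (map cell0 ?ts) = ?ts" by (simp add: comp_def)
  let ?parses = "ari 1 ?ts \<and> RV (fst (tz C w)) = RV (Some 0)"
  obtain r k where 2: "bs ok check [?i, orc [], hm (map cell0 ?ts), stk [], ct 0, rgt (RV (fst (tz C w)))]
      [?i, orc [], r, stk [], ct k, rgt (if ?parses then reg_start else reg_fail)]"
    and rk: "?parses \<longrightarrow> r = hm (map cell0 ?ts) \<and> k = 0"
    using check[OF oki ok0 rv, of "map cell0 ?ts"] cto codes(3) B1 lt unfolding mtk
    by (auto simp: reg_start_def reg_fail_def n_def)
  have 3: "bs ok (Cond (L6 (\<lambda>i q r s n g. g = Blank)) (initialize C) (sweep pop fs mid psh ch)) ?start
     [?i, orc [], r, stk [], ct k, rgt (if ?parses then reg_start else reg_fail)]"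
    unfolding initialize_def by (rule bs_CondT[OF _ bs_Seq[OF 1 2]]) simp
  have parses: "?parses \<longleftrightarrow> (\<exists>\<phi>. is_fm C \<phi> \<and> w = word_of \<phi>)"
    using tz_iff[OF C, of w] by auto
  show ?thesis
  proof (cases ?parses)
    case False
    then have wP: "\<not> w \<in> word_of ` P" using P parses by blast
    have e: "(if ?parses then reg_start else reg_fail) = reg_fail" by (rule if_not_P[OF False])
    note 3 = 3[unfolded e]
    have okl: "list_all ok [?i, orc [], r, stk [], ct k, rgt reg_fail]" using bs_ok[OF 3] by blast
    have 4: "bs ok (Cond decided Skip (build_query K (emit s a)))
       [?i, orc [], r, stk [], ct k, rgt reg_fail] [?i, orc [], r, stk [], ct k, rgt reg_fail]"
      by (rule bs_CondT[OF _ bs_Skip[OF okl]]) (simp add: reg_fail_def del: not_None_eq)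
    have "mrun ok (prog C K s a) ans tst (word_of ` R) ?start False"
      by (rule mrun_halt[OF bs_Seq[OF 3 4, folded prog_def]]) (simp add: tst_def reg_fail_def)
    then show ?thesis using wP by simp
  next
    case True
    then obtain \<phi> where \<phi>: "is_fm C \<phi>" "w = word_of \<phi>" using parses by blast
    have tzw: "snd (tz C w) = toks \<phi>" using tz_word_of[OF C \<phi>(1), of "[]" "[]"] \<phi>(2) by simp
    define ts where "ts = TRoot # toks \<phi>"
    have tsl: "length ts = n" using lt by (simp add: ts_def n_def tzw[symmetric])
    let ?q = "\<lambda>u. qword s a u \<in> word_of ` R"
    let ?qs = "\<lambda>T X Y Z. query s a \<phi> T X Y Z \<in> R"
    \<comment> \<open>The stack holds one row for \<open>T\<close> and at most two for each
      position; the limit leaves two to spare.\<close>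
    interpret game ts ?q "2 * n + 3" ?qs
    proof
      show "ts \<noteq> []" "ts ! 0 = TRoot" by (simp_all add: ts_def)
      show "ts ! i \<noteq> TRoot" if "0 < i" "i < length ts" for i
      proof -
        have "i - 1 < length (toks \<phi>)" using that by (simp add: ts_def del: length_toks)
        from nth_mem[OF this] have "toks \<phi> ! (i - 1) \<noteq> TRoot" using TRoot_toks[of \<phi>] by metis
        then show ?thesis using that by (simp add: ts_def)
      qed
      show "?q (row ts KD T X Y Z) \<longleftrightarrow> ?qs T X Y Z" for T X Y Z
        unfolding ts_def qword_row by (auto simp: word_of_inj)
      show "2 * length ts + 3 \<le> 2 * n + 3" by (simp add: tsl)
    qed
    have rct: "\<forall>c\<in>set u. ct_ok c" if u: "ro u" for u
    proof
      fix c assume c: "c \<in> set u"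
      obtain kn T X Y Z where "u = row ts kn T X Y Z" using u unfolding ro_def by blast
      then obtain i where i: "i < length ts" "c = mkc kn T X Y Z i (ts ! i)" using c in_row by blast
      have "ts ! i \<in> set ts" using i(1) by simp
      then have "b < C" if "ts ! i = TDia b" for b using that TDia_toks[OF \<phi>(1), of b] by (auto simp: ts_def)
      then show "ct_ok c" by (simp add: ct_ok_def i(2))
    qed
    have remit: "\<forall>c\<in>set u. length (emit s a c) \<le> K" if u: "ro u" for u
      using rct[OF u] length_emit[of _ C s a] unfolding ct_ok_def K by blast
    have rlen: "length u = n" if "ro u" for u using that tsl unfolding ro_def row_def by auto
    interpret prog_space NA B C s a K n "2 * n + 3" ro "word_of ` R"
    proof
      show "0 < C" by (rule C)
      show "to_nat (RG m k b b1 b2) < NA" for m k b b1 b2 by (rule codes(3))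
      show "to_nat (RV v) < NA" if "\<And>x. v = Some x \<Longrightarrow> x \<le> C" for v
        by (rule codes(4)) (rule that)
      show "length u = n" if "ro u" for u using rlen[OF that] .
      show "\<forall>c\<in>set u. ct_ok c" if "ro u" for u using rct[OF that] .
      show "\<forall>c\<in>set u. \<not> fM c" if "ro u" for u using that in_row unfolding ro_def by fastforce
      show "complete u" if u: "ro u" for u
      proof -
        obtain kn T X Y Z where "u = row ts kn T X Y Z" using u unfolding ro_def by blast
        then show ?thesis using complete_row by (simp add: ts_def)
      qed
      show "\<forall>c\<in>set u. length (emit s a c) \<le> K" if "ro u" for u using remit[OF that] .
      show "length (qword s a u) < B" if "ro u" for u
        using length_qword[OF remit[OF that]] B3 unfolding rlen[OF that] by simp
      show "ro (map ch u)" if "ro u" for u using ro_ch[OF that] .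
      show "ro (snd (inc True u))" if "ro u" for u using ro_inc[OF that] .
      show "0 < n" using n1 by simp
      show "n + 4 < B" by (rule B1)
      show "n * (2 * n + 3 + 2) < B" by (rule B2)
    qed
    let ?u = "row ts KT {} {} {} {}"
    have m: "rows (mkc KT {} {} {} {}) k xs = map cell0 xs" for k xs
      by (induction xs arbitrary: k) (auto simp: mkc_def)
    have u0: "map cell0 ?ts = ?u" unfolding row_def ts_def tzw by (rule m[symmetric])
    have e: "(if ?parses then reg_start else reg_fail) = reg_start" by (rule if_P[OF True])
    have rk1: "r = hm ?u \<and> k = 0" using mp[OF rk True] unfolding u0 .
    note rk' = conjunct1[OF rk1] conjunct2[OF rk1]
    note 3 = 3[unfolded e rk']
    have okl: "list_all ok [?i, orc [], hm ?u, stk [], ct 0, rgt reg_start]" using bs_ok[OF 3] by blast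
    have ru: "ro ?u" by (rule ro_row)
    have bq: "bs ok (build_query K (emit s a)) [?i, orc [], hm ?u, stk [], ct 0, rgt reg_start]
       [?i, orc (qword s a ?u), hm ?u, stk [], ct 0, rgt reg_start]"
      by (rule build_query)
        (use okl ro_unmarked[OF ru] ro_complete[OF ru] ro_emit[OF ru] ro_ct[OF ru] ro_q[OF ru] ro_len[OF ru] B1
          in \<open>simp_all add: oks\<close>)
    have 4: "bs ok (Cond decided Skip (build_query K (emit s a)))
       [?i, orc [], hm ?u, stk [], ct 0, rgt reg_start] [?i, orc (qword s a ?u), hm ?u, stk [], ct 0, rgt reg_start]"
      by (rule bs_CondF[OF _ bq]) (simp add: reg_start_def)
    let ?T = "[?i, orc (qword s a ?u), hm ?u, stk [], ct 0, rgt reg_start]"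
    \<comment> \<open>The first round ends with a query as well, so the register has the form that
      \<open>arun_mrun\<close> expects.\<close>
    let ?g = "RG Try KT (?q ?u) True False"
    have ok4: "list_all ok ?T" using bs_ok[OF 4] by blast
    have "(\<exists>S. S \<subseteq> {i. i < length ts \<and> is_mod (ts ! i)} \<and> 0 \<in> S \<and> forest (?qs S) S) \<longleftrightarrow> \<phi> \<in> P"
      using iff[OF \<phi>(1)] unfolding args_mods ts_def by blast
    then have "arun ro ?q (2 * n + 3) (Try, ?u, []) (\<phi> \<in> P)" using search_top by simp
    from arun_mrun[OF oki this]
    have "mrun ok (prog C K s a) ans tst (word_of ` R)
        [?i, orc (qword s a ?u), hm ?u, stk (concat []), ct 0, rgt ?g] (\<phi> \<in> P)"
      using ok4 by simp
    then have fin: "mrun ok (prog C K s a) ans tst (word_of ` R)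
        [?i, orc (qword s a ?u), hm ?u, stk [], ct 0, rgt ?g] (\<phi> \<in> P)" by (simp only: concat.simps)
    have an: "ans b (map read ?T) = [(read ?i, Stay), (Blank, Stay), (Blank, Stay), (Blank, Stay),
       (Aux 0, Stay), (rg (RG Try KT b True False), Stay)]" for b
      by (simp add: ans_def reg_start_def)
    have qw: "query_word (?T ! 1) = qword s a ?u" by simp
    have "mrun ok (prog C K s a) ans tst (word_of ` R) ?start (\<phi> \<in> P)"
    proof (rule mrun_ask[OF bs_Seq[OF 3 4, folded prog_def] _ _ _ _ fin])
      show "tst (map read ?T) = None" by (simp add: tst_def reg_start_def)
      show "length (ans (query_word (?T ! 1) \<in> word_of ` R) (map read ?T)) = length ?T" by (simp add: ans_def)
      show "[?i, orc (qword s a ?u), hm ?u, stk [], ct 0, rgt ?g] =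
        map2 act (ans (query_word (?T ! 1) \<in> word_of ` R) (map read ?T)) ?T"
        unfolding qw an by simp
      show "list_all ok [?i, orc (qword s a ?u), hm ?u, stk [], ct 0, rgt ?g]"
        using ok4 codes(3) by (simp add: oks)
    qed
    moreover have "w \<in> word_of ` P \<longleftrightarrow> \<phi> \<in> P" by (auto simp: \<phi>(2) word_of_inj)
    ultimately show ?thesis by simp
  qed
qed

theorem reduction:
  fixes P R :: "fm set"
  assumes C: "0 < C" and P: "\<And>\<phi>. \<phi> \<in> P \<Longrightarrow> is_fm C \<phi>"
    and iff: "\<And>\<phi>. is_fm C \<phi> \<Longrightarrow> \<phi> \<in> P \<longleftrightarrow> (\<exists>T. T \<subseteq> fst ` set (args \<phi>) \<and> 0 \<in> T \<and>
      forest (\<lambda>X Y Z. query s a \<phi> T X Y Z \<in> R) T)"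
  shows "word_of ` P \<le>\<^sub>T\<^sub>P\<^sub>S\<^sub>P\<^sub>A\<^sub>C\<^sub>E word_of ` R"
proof -
  from finite_codes[of C] obtain NA where N: "NA > 0 \<and> (\<forall>c::rcell. (\<forall>b. tk c = TDia b \<longrightarrow> b < C) \<longrightarrow> to_nat c < NA) \<and>
     (\<forall>m k b b1 b2. to_nat (RG m k b b1 b2) < NA) \<and>
     (\<forall>v. (\<forall>x. v = Some x \<longrightarrow> x \<le> C) \<longrightarrow> to_nat (RV v) < NA)" by (rule exE)
  note N1 = conjunct1[OF N] and N2 = conjunct1[OF conjunct2[OF N], rule_format]
    and N3 = conjunct1[OF conjunct2[OF conjunct2[OF N]], rule_format]
    and N4 = conjunct2[OF conjunct2[OF conjunct2[OF N]], rule_format]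
  define K where "K = C + s + 9"
  \<comment> \<open>The bound \<open>B\<close> of \<open>reduction_run\<close> as a polynomial in
    the length of the input.\<close>
  let ?p = "smult (2 * K + 30) ([:1, 1:] ^ 2) :: nat poly"
  show ?thesis
  proof (rule pspace_reducibleI[where nt = 6 and NA = NA and p = ?p and c = "prog C K s a" and ans = ans and tst = tst])
    fix w :: "sym list"
    have t0: "((\<lambda>i. if i < length w then Inp (w ! i) else Blank), 0) = tp [] (map Inp w)"
      by (auto simp: tp_def cont_def)
    have t1: "((\<lambda>_. Blank), 0) = tp [] []" by (simp add: tp_def cont_def)
    have p: "poly ?p (length w) = (2 * K + 30) * (length w + 1) ^ 2" by (simp add: add.commute)
    have r: "replicate (6 - 1) (\<lambda>_. Blank, 0) = [orc [], tp [] [], tp [] [], tp [] [], tp [] []]"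
      unfolding t1 by (simp add: eval_nat_numeral orc_def)
    show "mrun (okt NA (poly ?p (length w))) (prog C K s a) ans tst (word_of ` R)
      (((\<lambda>i. if i < length w then Inp (w ! i) else Blank), 0) # replicate (6 - 1) (\<lambda>_. Blank, 0)) (w \<in> word_of ` P)"
      unfolding t0 r
    proof (rule reduction_run)
      show "0 < C" by (rule C)
      show "is_fm C \<phi>" if "\<phi> \<in> P" for \<phi> by (rule P[OF that])
      show "\<phi> \<in> P \<longleftrightarrow> (\<exists>T. T \<subseteq> fst ` set (args \<phi>) \<and> 0 \<in> T \<and>
        forest (\<lambda>X Y Z. query s a \<phi> T X Y Z \<in> R) T)" if "is_fm C \<phi>" for \<phi> by (rule iff[OF that])
      show "0 < NA" by (rule N1)
      show "to_nat c < NA" if "\<And>b. tk c = TDia b \<Longrightarrow> b < C" for c :: rcell by (rule N2) (rule that)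
      show "to_nat (RG m k b b1 b2) < NA" for m k b b1 b2 by (rule N3)
      show "to_nat (RV v) < NA" if "\<And>x. v = Some x \<Longrightarrow> x \<le> C" for v by (rule N4) (rule that)
      show "K = C + s + 9" by (rule K_def)
      show "poly ?p (length w) = (2 * K + 30) * (length w + 1) ^ 2" by (rule p)
    qed
  qed simp
qed

theorem theorem4p1:
  fixes a A :: nat
    and \<F> :: "'w frame set"
    and \<I> :: "'i frame set"
  assumes "a < A"
    and "\<forall>F\<in>\<F>. is_frame A F"
    and "\<forall>I\<in>\<I>. noetherian_order I"
    and "contains_finite_trees \<I>"
  shows "(word_of ` Sat A (a_sums a \<I> \<F>)
           \<le>\<^sub>T\<^sub>P\<^sub>S\<^sub>P\<^sub>A\<^sub>C\<^sub>E word_of ` Sat (1 + A) (univ_frame ` \<F>)) \<and>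
        (closed_disjoint_unions \<I> \<longrightarrow>
         word_of ` Sat (1 + A) (univ_frame ` a_sums a \<I> \<F>)
           \<le>\<^sub>T\<^sub>P\<^sub>S\<^sub>P\<^sub>A\<^sub>C\<^sub>E word_of ` Sat (1 + A) (univ_frame ` \<F>))"
proof (intro conjI impI)
  have C: "0 < A" "0 < Suc A" using assms(1) by simp_all
  show "word_of ` Sat A (a_sums a \<I> \<F>) \<le>\<^sub>T\<^sub>P\<^sub>S\<^sub>P\<^sub>A\<^sub>C\<^sub>E word_of ` Sat (1 + A) (univ_frame ` \<F>)"
  proof (rule reduction[OF C(1)])
    show "is_fm A \<phi>" if "\<phi> \<in> Sat A (a_sums a \<I> \<F>)" for \<phi>
      using that by (simp add: Sat_def)
    show "\<phi> \<in> Sat A (a_sums a \<I> \<F>) \<longleftrightarrow> (\<exists>T. T \<subseteq> fst ` set (args \<phi>) \<and> 0 \<in> T \<and>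
      forest (\<lambda>X Y Z. query 1 a \<phi> T X Y Z \<in> Sat (1 + A) (univ_frame ` \<F>)) T)" if "is_fm A \<phi>" for \<phi>
      using Sat_sums_iff_forest[OF assms(3,4) that, of 1 A a \<F>] by simp
  qed
  assume du: "closed_disjoint_unions \<I>"
  show "word_of ` Sat (1 + A) (univ_frame ` a_sums a \<I> \<F>) \<le>\<^sub>T\<^sub>P\<^sub>S\<^sub>P\<^sub>A\<^sub>C\<^sub>E
    word_of ` Sat (1 + A) (univ_frame ` \<F>)"
  proof (rule reduction[OF C(2)])
    show "is_fm (Suc A) \<phi>" if "\<phi> \<in> Sat (1 + A) (univ_frame ` a_sums a \<I> \<F>)" for \<phi>
      using that by (simp add: Sat_def)
    show "\<phi> \<in> Sat (1 + A) (univ_frame ` a_sums a \<I> \<F>) \<longleftrightarrow> (\<exists>T. T \<subseteq> fst ` set (args \<phi>) \<and> 0 \<in> T \<and>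
      forest (\<lambda>X Y Z. query 0 a \<phi> T X Y Z \<in> Sat (1 + A) (univ_frame ` \<F>)) T)" if "is_fm (Suc A) \<phi>" for \<phi>
      using Sat_sums_iff_forest[OF assms(3,4) that, of 0 A a \<F>] du by simp
  qed
qed


end
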